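(* Let $m\in\mathbb N$ be odd, let $\Psi_1,\ldots,\Psi_m$ be bounded sets of nonnegative matrices that define operators on $l^2(R)$, let $\alpha\ge\frac1m$ and $r\in\{\rho,\hat\rho\}$. Let $$\Omega_j=\Psi_{2j-1}\Psi_{2j}^*\cdots\Psi_{m-2}\Psi_{m-1}^*\Psi_m\Psi_1^*\Psi_2\Psi_3^*\cdots\Psi_{m-1}\Psi_m^*\Psi_1\Psi_2^*\cdots\Psi_{2j-3}\Psi_{2j-2}^*\quad\text{for }1\le j\le\tfrac{m-1}2,$$ $$\Omega_{\frac{m+1}2}=\Psi_m\Psi_1^*\Psi_2\Psi_3^*\cdots\Psi_{m-1}\Psi_m^*\Psi_1\Psi_2^*\Psi_3\Psi_4^*\cdots\Psi_{m-2}\Psi_{m-1}^*,$$ $$\Omega_j=\Psi_{2j-m-1}\Psi_{2j-m}^*\cdots\Psi_{m-1}\Psi_m^*\Psi_1\Psi_2^*\Psi_3\Psi_4^*\cdots\Psi_m\Psi_1^*\cdots\Psi_{2j-m-3}\Psi_{2j-m-2}^*\quad\text{for }\tfrac{m+3}2\le j\le m.$$ (That is, with indices read modulo $m$ in $\{1,\ldots,m\}$, $\Omega_j$ is the product of the $2m$ factors $\Psi_{2j-1}\Psi_{2j}^*\Psi_{2j+1}\Psi_{2j+2}^*\cdots\Psi_{2j+2m-3}\Psi_{2j+2m-2}^*$.) Then $$\big\|\Psi_1^{(\alpha)}\circ\Psi_2^{(\alpha)}\circ\cdots\circ\Psi_m^{(\alpha)}\big\|$$ $$\le r\big((\Psi_1\Psi_2^*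 )^{(\alpha)}\circ(\Psi_3\Psi_4^* )^{(\alpha)}\circ\cdots\circ(\Psi_{m-2}\Psi_{m-1}^* )^{(\alpha)}\circ(\Psi_m\Psi_1^* )^{(\alpha)}\circ(\Psi_2\Psi_3^* )^{(\alpha)}\circ\cdots\circ(\Psi_{m-1}\Psi_m^* )^{(\alpha)}\big)^{\frac12}$$ $$\le r\big(\Omega_1^{(\alpha)}\circ\cdots\circ\Omega_m^{(\alpha)}\big)^{\frac1{2m}}\le r\big(\Psi_1\Psi_2^*\Psi_3\Psi_4^*\cdots\Psi_{m-2}\Psi_{m-1}^*\Psi_m\Psi_1^*\Psi_2\Psi_3^*\cdots\Psi_{m-1}\Psi_m^*\big)^{\frac\alpha2},$$ where the Hadamard product in the second line has the $m$ factors $(\Psi_i\Psi_{i+1}^* )^{(\alpha)}$, $i=1,\ldots,m$ (indices modulo $m$), and the last product in the chain is $\Omega_1$.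
   Context: $R$ is $\mathbb N$ or $\{1,\ldots,N\}$ for some $N\in\mathbb N$, and $l^2(R)$ is the complex Hilbert space. A matrix $A=[a_{ij}]_{i,j\in R}$ is nonnegative if all $a_{ij}\ge0$; it defines an operator on $l^2(R)$ if $Ax\in l^2(R)$ for all $x\in l^2(R)$, where $(Ax)_i=\sum_j a_{ij}x_j$ (the operator is then positive and bounded). Matrices are identified with the operators they define; "bounded set" means bounded in operator norm. For nonnegative matrices $A_j=[a^{(j)}_{ik}]$ and positive $\alpha_j$, $A_1^{(\alpha_1)}\circ\cdots\circ A_m^{(\alpha_m)}$ is the matrix with entries $\prod_j (a^{(j)}_{ik})^{\alpha_j}$ (if $\sum_j\alpha_j\ge1$ and the $A_j$ define operators on $l^2(R)$, it defines an operator on $l^2(R)$). For bounded sets: $\Psi_1\cdots\Psi_k=\{A_1\cdots A_k: A_i\in\Psi_i\}$, $\Sigma^k=\{A_1\cdots A_k:A_i\in\Sigma\}$, $\Psi^*=\{A^*:A\in\Psi\}$ ($A^*$ the adjoint), $\|\Psi\|=\sup_{A\in\Psi}\|A\|$, and $\Psi_1^{(\alpha_1)}\circ\cdots\circ\Psi_m^{(\alpha_m)}=\{A_1^{(\alpha_1)}\circ\cdots\circ A_m^{(\alpha_m)}:A_j\in\Psi_j\}$ (elements chosen independently from each factor). With $\rho(A)$ the spectral radius of an operator, for a bounded set $\Sigma$ of bounded operators: $\rho(\Sigma)=\limsup_{k\to\infty}[\sup_{A\in\Sigma^k}\rho(A)]^{1/k}$ and $\hat\rho(\Sigma)=\lim_{k\to\infty}[\sup_{A\in\Sigma^k}\|A\|]^{1/k}$.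 *)

theory Defs
  imports "HOL-Analysis.Analysis"
begin

text \<open>
  Vectors and matrices over an index set \<open>R \<subseteq> {1, 2, \<dots>}\<close> are functions on \<^typ>\<open>nat\<close> that vanish
  outside \<open>R\<close>, resp. outside \<open>R \<times> R\<close>, so that equality of functions is equality of vectors and
  of matrices.
\<close>

type_synonym rmat = "nat \<Rightarrow> nat \<Rightarrow> real"

definition l2 :: "nat set \<Rightarrow> (nat \<Rightarrow> complex) set" where
  "l2 R = {x. (\<forall>i. i \<notin> R \<longrightarrow> x i = 0) \<and> (\<lambda>i. (cmod (x i))\<^sup>2) summable_on R}"

definition l2_norm :: "nat set \<Rightarrow> (nat \<Rightarrow> complex) \<Rightarrow> real" where
  "l2_norm R x = sqrt (\<Sum>\<^sub>\<infinity>i\<in>R. (cmod (x i))\<^sup>2)"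

definition l2_inner :: "nat set \<Rightarrow> (nat \<Rightarrow> complex) \<Rightarrow> (nat \<Rightarrow> complex) \<Rightarrow> complex" where
  "l2_inner R x y = (\<Sum>\<^sub>\<infinity>i\<in>R. x i * cnj (y i))"

definition bounded_operator ::
  "nat set \<Rightarrow> ((nat \<Rightarrow> complex) \<Rightarrow> (nat \<Rightarrow> complex)) \<Rightarrow> bool" where
  "bounded_operator R T \<longleftrightarrow>
     (\<forall>x\<in>l2 R. T x \<in> l2 R) \<and>
     (\<forall>x\<in>l2 R. \<forall>y\<in>l2 R. T (\<lambda>i. x i + y i) = (\<lambda>i. T x i + T y i)) \<and>
     (\<forall>c. \<forall>x\<in>l2 R. T (\<lambda>i. c * x i) = (\<lambda>i. c * T x i)) \<and>
     (\<exists>C. \<forall>x\<in>l2 R. l2_norm R (T x) \<le> C * l2_norm R x)"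

definition op_norm :: "nat set \<Rightarrow> ((nat \<Rightarrow> complex) \<Rightarrow> (nat \<Rightarrow> complex)) \<Rightarrow> real" where
  "op_norm R T = (SUP x\<in>{x \<in> l2 R. l2_norm R x \<le> 1}. l2_norm R (T x))"

definition op_spectrum ::
  "nat set \<Rightarrow> ((nat \<Rightarrow> complex) \<Rightarrow> (nat \<Rightarrow> complex)) \<Rightarrow> complex set" where
  "op_spectrum R T = {c. \<not> (\<exists>S. bounded_operator R S \<and>
     (\<forall>x\<in>l2 R. S (\<lambda>i. c * x i - T x i) = x \<and> (\<lambda>i. c * S x i - T (S x) i) = x))}"

definition op_spectral_radius ::
  "nat set \<Rightarrow> ((nat \<Rightarrow> complex) \<Rightarrow> (nat \<Rightarrow> complex)) \<Rightarrow> real" where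
  "op_spectral_radius R T = (SUP c\<in>op_spectrum R T. cmod c)"

definition is_matrix :: "nat set \<Rightarrow> rmat \<Rightarrow> bool" where
  "is_matrix R A \<longleftrightarrow> (\<forall>i j. i \<notin> R \<or> j \<notin> R \<longrightarrow> A i j = 0)"

definition nonneg_matrix :: "nat set \<Rightarrow> rmat \<Rightarrow> bool" where
  "nonneg_matrix R A \<longleftrightarrow> is_matrix R A \<and> (\<forall>i j. 0 \<le> A i j)"

definition mat_vec :: "nat set \<Rightarrow> rmat \<Rightarrow> (nat \<Rightarrow> complex) \<Rightarrow> (nat \<Rightarrow> complex)" where
  "mat_vec R A x = (\<lambda>i. \<Sum>\<^sub>\<infinity>j\<in>R. of_real (A i j) * x j)"

text \<open>
  \<open>Ax \<in> l\<^sup>2(R)\<close> includes the convergence of the series for each coordinate. Requiring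
  unconditional convergence is no restriction: for nonnegative \<open>A\<close>, apply the condition to
  \<open>|x|\<close>, which is again in \<open>l\<^sup>2(R)\<close>.
\<close>

definition defines_operator :: "nat set \<Rightarrow> rmat \<Rightarrow> bool" where
  "defines_operator R A \<longleftrightarrow>
     (\<forall>x\<in>l2 R. (\<forall>i\<in>R. (\<lambda>j. of_real (A i j) * x j) summable_on R) \<and> mat_vec R A x \<in> l2 R)"

definition mat_one :: "nat set \<Rightarrow> rmat" where
  "mat_one R = (\<lambda>i j. if i = j \<and> i \<in> R then 1 else 0)"

definition mat_mul :: "nat set \<Rightarrow> rmat \<Rightarrow> rmat \<Rightarrow> rmat" where
  "mat_mul R A B = (\<lambda>i k. \<Sum>\<^sub>\<infinity>j\<in>R. A i j * B j k)"

text \<open>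
  The matrix of the Hilbert space adjoint. It is again a real matrix when \<open>A\<close> is real and
  defines a bounded operator.
\<close>

definition mat_adj :: "nat set \<Rightarrow> rmat \<Rightarrow> rmat" where
  "mat_adj R A = (THE B. is_matrix R B \<and> defines_operator R B \<and>
     (\<forall>x\<in>l2 R. \<forall>y\<in>l2 R. l2_inner R (mat_vec R A x) y = l2_inner R x (mat_vec R B y)))"

text \<open>
  The Hadamard product \<open>A\<^sub>1\<^sup>(\<^sup>a\<^sup>1\<^sup>) \<circ> \<dots> \<circ> A\<^sub>m\<^sup>(\<^sup>a\<^sup>m\<^sup>)\<close>. Recall that \<open>0 powr a = 0\<close>, as required for
  zero entries and positive exponents.
\<close>

definition hadamard :: "nat \<Rightarrow> (nat \<Rightarrow> real) \<Rightarrow> (nat \<Rightarrow> rmat) \<Rightarrow> rmat" where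
  "hadamard m a A = (\<lambda>i k. \<Prod>j=1..m. A j i k powr a j)"

text \<open>
  Boundedness is stated without \<^const>\<open>op_norm\<close>, as the real supremum of an unbounded set is
  unspecified.
\<close>

definition bounded_mats :: "nat set \<Rightarrow> rmat set \<Rightarrow> bool" where
  "bounded_mats R \<Psi> \<longleftrightarrow>
     (\<exists>C. \<forall>A\<in>\<Psi>. \<forall>x\<in>l2 R. l2_norm R (mat_vec R A x) \<le> C * l2_norm R x)"

definition set_mul :: "nat set \<Rightarrow> rmat set \<Rightarrow> rmat set \<Rightarrow> rmat set" where
  "set_mul R \<Phi> \<Psi> = {mat_mul R A B | A B. A \<in> \<Phi> \<and> B \<in> \<Psi>}"

definition set_prod :: "nat set \<Rightarrow> rmat set list \<Rightarrow> rmat set" where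
  "set_prod R \<Psi>s = foldr (set_mul R) \<Psi>s {mat_one R}"

definition set_power :: "nat set \<Rightarrow> rmat set \<Rightarrow> nat \<Rightarrow> rmat set" where
  "set_power R \<Sigma> k = set_prod R (replicate k \<Sigma>)"

definition set_adj :: "nat set \<Rightarrow> rmat set \<Rightarrow> rmat set" where
  "set_adj R \<Psi> = mat_adj R ` \<Psi>"

definition set_hadamard :: "nat \<Rightarrow> (nat \<Rightarrow> real) \<Rightarrow> (nat \<Rightarrow> rmat set) \<Rightarrow> rmat set" where
  "set_hadamard m a \<Psi> = {hadamard m a A | A. \<forall>j\<in>{1..m}. A j \<in> \<Psi> j}"

text \<open>
  Suprema of norms and of spectral radii are taken in \<open>[0,\<infinity>)\<close>; inserting \<open>0\<close> only fixes the
  value for the empty set of matrices.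
\<close>

definition set_norm :: "nat set \<Rightarrow> rmat set \<Rightarrow> real" where
  "set_norm R \<Psi> = Sup (insert 0 ((\<lambda>A. op_norm R (mat_vec R A)) ` \<Psi>))"

definition set_sup_radius :: "nat set \<Rightarrow> rmat set \<Rightarrow> real" where
  "set_sup_radius R \<Psi> = Sup (insert 0 ((\<lambda>A. op_spectral_radius R (mat_vec R A)) ` \<Psi>))"

text \<open>The generalized spectral radius \<open>\<rho>(\<Sigma>)\<close> and the joint spectral radius \<open>\<rho>^(\<Sigma>)\<close>.\<close>

definition gen_spectral_radius :: "nat set \<Rightarrow> rmat set \<Rightarrow> real" where
  "gen_spectral_radius R \<Sigma> = real_of_ereal
     (limsup (\<lambda>k. ereal (set_sup_radius R (set_power R \<Sigma> k) powr (1 / real k))))"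

definition joint_spectral_radius :: "nat set \<Rightarrow> rmat set \<Rightarrow> real" where
  "joint_spectral_radius R \<Sigma> = lim (\<lambda>k. set_norm R (set_power R \<Sigma> k) powr (1 / real k))"

text \<open>The representative of \<open>i \<ge> 1\<close> modulo \<open>m\<close> in \<open>{1..m}\<close>.\<close>

definition cyc :: "nat \<Rightarrow> nat \<Rightarrow> nat" where
  "cyc m i = (i - 1) mod m + 1"

text \<open>\<open>\<Psi>\<^sub>i \<Psi>\<^sub>i\<^sub>+\<^sub>1\<^sup>*\<close> with indices modulo \<open>m\<close>.\<close>

definition pair_prod :: "nat set \<Rightarrow> nat \<Rightarrow> (nat \<Rightarrow> rmat set) \<Rightarrow> nat \<Rightarrow> rmat set" where
  "pair_prod R m \<Psi> i = set_mul R (\<Psi> (cyc m i)) (set_adj R (\<Psi> (cyc m (i + 1))))"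

text \<open>
  \<open>\<Omega>\<^sub>j = (\<Psi>\<^sub>2\<^sub>j\<^sub>-\<^sub>1 \<Psi>\<^sub>2\<^sub>j\<^sup>*) (\<Psi>\<^sub>2\<^sub>j\<^sub>+\<^sub>1 \<Psi>\<^sub>2\<^sub>j\<^sub>+\<^sub>2\<^sup>*) \<dots> (\<Psi>\<^sub>2\<^sub>j\<^sub>+\<^sub>2\<^sub>m\<^sub>-\<^sub>3 \<Psi>\<^sub>2\<^sub>j\<^sub>+\<^sub>2\<^sub>m\<^sub>-\<^sub>2\<^sup>*)\<close>, indices modulo \<open>m\<close>.
\<close>

definition Omega :: "nat set \<Rightarrow> nat \<Rightarrow> (nat \<Rightarrow> rmat set) \<Rightarrow> nat \<Rightarrow> rmat set" where
  "Omega R m \<Psi> j = set_prod R (map (\<lambda>t. pair_prod R m \<Psi> (2 * j - 1 + 2 * t)) [0..<m])"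

end

theory Submission
  imports Defs
begin

text \<open>
  Write \<open>H\<close> for the second Hadamard product of the chain and \<open>K\<close> for the third. The engine is the
  entrywise inequality \<open>(A\<^sub>1 \<circ> \<dots> \<circ> A\<^sub>m)(B\<^sub>1 \<circ> \<dots> \<circ> B\<^sub>m) \<le> A\<^sub>1B\<^sub>1 \<circ> \<dots> \<circ> A\<^sub>mB\<^sub>m\<close> for Hadamard
  products with exponents \<open>\<alpha> \<ge> 1/m\<close>. Since Hadamard multiplication commutes, the factors may be
  paired in any order. If \<open>A = A\<^sub>1 \<circ> \<dots> \<circ> A\<^sub>m\<close>, then \<open>AA\<^sup>* \<le> A\<^sub>1A\<^sub>2\<^sup>* \<circ> \<dots> \<circ> A\<^sub>mA\<^sub>1\<^sup>*\<close>, an element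
  of \<open>H\<close>, and \<open>\<parallel>A\<parallel>\<^sup>2\<close> is at most the spectral radius of the self-adjoint \<open>AA\<^sup>*\<close>. For odd \<open>m\<close> the map
  \<open>j \<mapsto> 2j - 1 + 2t\<close> permutes the residues modulo \<open>m\<close>, so \<open>H\<^sup>m\<close> is dominated by \<open>K\<close>, whence
  \<open>r(H)\<^sup>m \<le> r(K)\<close>. Finally \<open>r(K) \<le> r(\<Omega>\<^sub>1)\<^sup>\<alpha> \<cdots> r(\<Omega>\<^sub>m)\<^sup>\<alpha>\<close>, and the \<open>\<Omega>\<^sub>j\<close> are cyclic rearrangements of
  \<open>\<Omega>\<^sub>1\<close>, so that \<open>r(\<Omega>\<^sub>j) = r(\<Omega>\<^sub>1)\<close>.

  All statements about the spectral radius \<open>\<rho>(A)\<close> reduce to the joint spectral radius of \<open>{A}\<close> by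
  the formula \<open>\<rho>(A) = lim \<parallel>A\<^sup>k\<parallel>\<^sup>1\<^sup>/\<^sup>k\<close>, which for nonnegative matrices has an elementary proof. Sums over
  the index set are taken in \<open>[0,\<infinity>]\<close>, where they may be interchanged unconditionally.
\<close>

section \<open>Nonnegative matrices on extended nonnegative vectors\<close>

text \<open>The hypothesis \<alpha> \<ge> 1/m is exploited by scaling: once matrices or summands are
  normalised, their entries are at most 1, larger exponents only shrink them, and a product of m-th
  roots is at most an arithmetic mean, for which bounds simply add up. The two radii need different
  treatment. The joint radius is the infimum of the roots of submultiplicative norms, so norm
  estimates for powers suffice. The generalized radius is a limsup, and spectral radii are not
  submultiplicative; hence each estimate is made for a fixed k and an arbitrary matrix in the k-th
  power, where the joint radius of a single matrix is available, and only then passed to the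
  supremum and the limsup. The norm formula for \<rho>(A) makes monotonicity of the spectral radius
  in the entries accessible, which is not visible in the spectrum. Its harder half is that the limit
  of the norm roots itself lies in the spectrum; positivity gives this without complex analysis.
  Oddness of m is coprimality of 2 and m: for even m all indices 2j - 1 + 2t stay odd modulo m, and
  half of the pairs would never occur.\<close>

definition mat_app :: "nat set \<Rightarrow> rmat \<Rightarrow> (nat \<Rightarrow> ennreal) \<Rightarrow> nat \<Rightarrow> ennreal" where
  "mat_app R A x i = (\<integral>\<^sup>+j. ennreal (A i j) * x j \<partial>count_space R)"

definition sq_norm :: "nat set \<Rightarrow> (nat \<Rightarrow> ennreal) \<Rightarrow> ennreal" where
  "sq_norm R x = (\<integral>\<^sup>+i. (x i)\<^sup>2 \<partial>count_space R)"

text \<open>Since |Ax| \<le> A|x| entrywise, the norm of a nonnegative matrix is determined by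
  nonnegative vectors. Admitting the value infinity removes convergence conditions, and a predicate
  with an explicit constant avoids suprema.\<close>

definition op_bound :: "nat set \<Rightarrow> rmat \<Rightarrow> real \<Rightarrow> bool" where
  "op_bound R A C \<longleftrightarrow>
     0 \<le> C \<and> (\<forall>x. sq_norm R x \<le> 1 \<longrightarrow> sq_norm R (mat_app R A x) \<le> ennreal (C\<^sup>2))"

lemma count_space_Fubini:
  fixes f :: "nat \<Rightarrow> nat \<Rightarrow> ennreal"
  shows "(\<integral>\<^sup>+i. \<integral>\<^sup>+j. f i j \<partial>count_space B \<partial>count_space A) =
         (\<integral>\<^sup>+j. \<integral>\<^sup>+i. f i j \<partial>count_space A \<partial>count_space B)"
  by (rule nn_integral_count_space_nn_integral) auto

lemma sq_norm_cmult: "sq_norm R (\<lambda>i. c * x i) = c\<^sup>2 * sq_norm R x"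
  unfolding sq_norm_def by (simp add: power_mult_distrib nn_integral_cmult)

lemma mat_app_cmult: "mat_app R A (\<lambda>j. c * x j) i = c * mat_app R A x i"
  unfolding mat_app_def by (subst nn_integral_cmult[symmetric]) (auto simp: mult_ac)

lemma mat_app_cong: "(\<And>j. j \<in> R \<Longrightarrow> x j = y j) \<Longrightarrow> mat_app R A x i = mat_app R A y i"
  unfolding mat_app_def by (intro nn_integral_cong) simp

lemma mat_app_mono:
  assumes "\<And>j. j \<in> R \<Longrightarrow> A i j \<le> B i j" "\<And>j. j \<in> R \<Longrightarrow> x j \<le> y j"
  shows "mat_app R A x i \<le> mat_app R B y i"
  unfolding mat_app_def by (intro nn_integral_mono mult_mono ennreal_leI) (auto simp: assms)

lemma sq_norm_mono: "(\<And>i. i \<in> R \<Longrightarrow> x i \<le> y i) \<Longrightarrow> sq_norm R x \<le> sq_norm R y"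
  unfolding sq_norm_def by (intro nn_integral_mono power_mono) auto

lemma sq_norm_cong: "(\<And>i. i \<in> R \<Longrightarrow> x i = y i) \<Longrightarrow> sq_norm R x = sq_norm R y"
  unfolding sq_norm_def by (intro nn_integral_cong) auto

lemma sq_norm_ge: "i \<in> R \<Longrightarrow> (x i)\<^sup>2 \<le> sq_norm R x"
proof -
  assume "i \<in> R"
  then have "(x i)\<^sup>2 = (\<integral>\<^sup>+k. (x k)\<^sup>2 * indicator {i} k \<partial>count_space R)"
    by (subst nn_integral_count_space'[of "{i}"]) auto
  also have "\<dots> \<le> sq_norm R x"
    unfolding sq_norm_def by (intro nn_integral_mono) (auto simp: indicator_def)
  finally show ?thesis .
qed

lemma power2_le_imp_le_ennreal: "a\<^sup>2 \<le> b\<^sup>2 \<Longrightarrow> a \<le> (b::ennreal)"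
proof (cases a b rule: ennreal2_cases)
  case (real_real r q)
  assume "a\<^sup>2 \<le> b\<^sup>2"
  with real_real have "r\<^sup>2 \<le> q\<^sup>2" by (simp add: ennreal_power)
  then show ?thesis using real_real by (auto intro!: ennreal_leI power2_le_imp_le)
next
  case (top_real r)
  assume "a\<^sup>2 \<le> b\<^sup>2"
  with top_real show ?thesis by (simp add: ennreal_power top_unique)
qed auto
lemma mat_app_unit: "k \<in> R \<Longrightarrow> mat_app R A (\<lambda>j. if j = k then c else 0) i = ennreal (A i k) * c"
  unfolding mat_app_def by (subst nn_integral_count_space'[of "{k}"]) auto

lemma sq_norm_unit: "k \<in> R \<Longrightarrow> sq_norm R (\<lambda>j. if j = k then c else 0) = c\<^sup>2"
  unfolding sq_norm_def by (subst nn_integral_count_space'[of "{k}"]) auto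

lemma op_bound_app:
  assumes "op_bound R A C" "0 \<le> D" "sq_norm R x \<le> ennreal (D\<^sup>2)"
  shows "sq_norm R (mat_app R A x) \<le> ennreal ((C * D)\<^sup>2)"
proof (cases "D = 0")
  \<comment> \<open>With bound 0 the vector vanishes on \<open>R\<close>, and rescaling by 1 / D is
    impossible.\<close>
  case True
  then have "(x i)\<^sup>2 \<le> 0" if "i \<in> R" for i
    using assms(3) sq_norm_ge[OF that, of x] by simp
  then have "mat_app R A x i = mat_app R A (\<lambda>_. 0) i" for i
    by (intro mat_app_cong) auto
  then show ?thesis by (simp add: sq_norm_def mat_app_def)
next
  case False
  then have D: "D > 0" using assms by simp
  let ?y = "\<lambda>i. ennreal (1 / D) * x i"
  have "sq_norm R ?y \<le> ennreal (1 / D)^2 * ennreal (D\<^sup>2)"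
    unfolding sq_norm_cmult by (intro mult_left_mono assms) simp
  also have "\<dots> = 1"
    using D by (simp add: ennreal_power ennreal_mult[symmetric] power_divide)
  finally have "sq_norm R (mat_app R A ?y) \<le> ennreal (C\<^sup>2)"
    using assms(1) by (simp add: op_bound_def)
  then have "ennreal (1 / D)^2 * sq_norm R (mat_app R A x) \<le> ennreal (C\<^sup>2)"
    by (simp add: mat_app_cmult[abs_def] sq_norm_cmult)
  then have "ennreal D^2 * (ennreal (1 / D)^2 * sq_norm R (mat_app R A x)) \<le> ennreal D^2 * ennreal (C\<^sup>2)"
    by (rule mult_left_mono) simp
  moreover have "ennreal D^2 * ennreal (1 / D)^2 = 1"
    using D by (simp add: ennreal_power ennreal_mult[symmetric] power_divide)
  ultimately show ?thesis using D
    by (simp add: mult.assoc[symmetric] ennreal_power ennreal_mult[symmetric] power_mult_distrib mult.commute)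
qed

lemma op_bound_imp_form_le:
  assumes "op_bound R A C" "sq_norm R x \<le> 1" "sq_norm R y \<le> 1"
  shows "(\<integral>\<^sup>+i. mat_app R A x i * y i \<partial>count_space R) \<le> ennreal C"
proof -
  have C: "0 \<le> C" using assms(1) by (simp add: op_bound_def)
  have "(\<integral>\<^sup>+i. mat_app R A x i * y i \<partial>count_space R)\<^sup>2
      \<le> sq_norm R (mat_app R A x) * sq_norm R y"
    unfolding sq_norm_def by (rule Cauchy_Schwarz_nn_integral) auto
  also have "\<dots> \<le> ennreal (C\<^sup>2) * 1"
    using assms by (intro mult_mono) (auto simp: op_bound_def)
  also have "\<dots> = (ennreal C)\<^sup>2" using C by (simp add: ennreal_power)
  finally show ?thesis by (rule power2_le_imp_le_ennreal)
qed

text \<open>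
  In terms of the bilinear form, an operator bound is visibly invariant under transposition and
  additive over series of matrices.
\<close>

lemma op_boundI_form:
  assumes C: "0 \<le> C"
    and le: "\<And>x y. sq_norm R x \<le> 1 \<Longrightarrow> sq_norm R y \<le> 1 \<Longrightarrow>
              (\<integral>\<^sup>+i. mat_app R A x i * y i \<partial>count_space R) \<le> ennreal C"
  shows "op_bound R A C"
  unfolding op_bound_def
proof (intro conjI allI impI C)
  fix x assume x: "sq_norm R x \<le> 1"
  let ?u = "mat_app R A x"
  \<comment> \<open>Testing against the unit vector at \<open>i\<close> isolates one coordinate.
    Finite coordinates make the truncated norms below finite, so that one may divide by
    them.\<close>
  have fin: "?u i < top" if "i \<in> R" for i
  proof -
    have "?u i = (\<integral>\<^sup>+k. ?u k * (if k = i then 1 else 0) \<partial>count_space R)"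
      using that by (subst nn_integral_count_space'[of "{i}"]) auto
    also have "\<dots> \<le> ennreal C"
      using that by (intro le x) (simp add: sq_norm_unit)
    finally show ?thesis using ennreal_less_top le_less_trans by blast
  qed
  \<comment> \<open>The extremal test vector is \<open>?u\<close> divided by its own norm, which
    must be finite and nonzero. Cutting off at \<open>n\<close> secures the former, the case
    \<open>Z = 0\<close> is trivial, and monotone convergence removes the cut-off
    afterwards.\<close>
  have trunc: "sq_norm R (\<lambda>i. ?u i * indicator {..<n} i) \<le> ennreal (C\<^sup>2)" for n :: nat
  proof -
    let ?z = "\<lambda>i. ?u i * indicator {..<n} i"
    have "sq_norm R ?z = (\<Sum>i\<in>R \<inter> {..<n}. (?z i)\<^sup>2)"
      unfolding sq_norm_def by (intro nn_integral_count_space') auto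
    also have "\<dots> < top"
      using fin by (auto simp: power2_eq_square ennreal_mult_less_top indicator_def)
    finally obtain Z where Z: "0 \<le> Z" "sq_norm R ?z = ennreal (Z\<^sup>2)"
      by (metis less_top_ennreal real_sqrt_ge_zero real_sqrt_pow2)
    show ?thesis
    proof (cases "Z = 0")
      case False
      then have Zp: "Z > 0" using Z by simp
      let ?y = "\<lambda>i. ennreal (1 / Z) * ?z i"
      have "sq_norm R ?y \<le> 1"
        using Zp by (simp add: sq_norm_cmult Z ennreal_power ennreal_mult[symmetric] power_divide)
      then have "(\<integral>\<^sup>+i. ?u i * ?y i \<partial>count_space R) \<le> ennreal C" by (intro le x)
      also have "(\<integral>\<^sup>+i. ?u i * ?y i \<partial>count_space R)
          = (\<integral>\<^sup>+i. ennreal (1 / Z) * (?z i)\<^sup>2 \<partial>count_space R)"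
        by (intro nn_integral_cong) (auto simp: power2_eq_square indicator_def mult_ac)
      also have "\<dots> = ennreal (1 / Z) * sq_norm R ?z"
        by (simp add: sq_norm_def nn_integral_cmult)
      also have "\<dots> = ennreal Z"
        using Zp by (simp add: Z ennreal_mult[symmetric] power2_eq_square)
      finally have "Z \<le> C" using C by simp
      then show ?thesis using Z Zp by (simp add: power_mono ennreal_leI)
    qed (use Z in simp)
  qed
  have "sq_norm R ?u = (\<integral>\<^sup>+i. (SUP n. (?u i * indicator {..<n} i)\<^sup>2) \<partial>count_space R)"
    unfolding sq_norm_def
  proof (intro nn_integral_cong)
    fix i
    show "(?u i)\<^sup>2 = (SUP n. (?u i * indicator {..<n} i)\<^sup>2)"
    proof (rule antisym)
      show "(?u i)\<^sup>2 \<le> (SUP n. (?u i * indicator {..<n} i)\<^sup>2)"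
        by (rule SUP_upper2[of "Suc i"]) auto
    qed (auto intro!: SUP_least power_mono simp: indicator_def)
  qed
  also have "\<dots> = (SUP n. sq_norm R (\<lambda>i. ?u i * indicator {..<n} i))"
    unfolding sq_norm_def
    by (intro nn_integral_monotone_convergence_SUP)
      (auto simp: incseq_def le_fun_def indicator_def)
  also have "\<dots> \<le> ennreal (C\<^sup>2)" by (intro SUP_least trunc)
  finally show "sq_norm R ?u \<le> ennreal (C\<^sup>2)" .
qed

lemma form_transpose:
  "(\<integral>\<^sup>+i. mat_app R (\<lambda>i j. A j i) x i * y i \<partial>count_space R)
     = (\<integral>\<^sup>+i. mat_app R A y i * x i \<partial>count_space R)"
proof -
  have "(\<integral>\<^sup>+i. mat_app R (\<lambda>i j. A j i) x i * y i \<partial>count_space R)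
      = (\<integral>\<^sup>+i. \<integral>\<^sup>+j. ennreal (A j i) * x j * y i \<partial>count_space R \<partial>count_space R)"
    unfolding mat_app_def by (simp add: nn_integral_multc)
  also have "\<dots> = (\<integral>\<^sup>+j. \<integral>\<^sup>+i. ennreal (A j i) * x j * y i \<partial>count_space R \<partial>count_space R)"
    by (rule count_space_Fubini)
  also have "\<dots> = (\<integral>\<^sup>+j. mat_app R A y j * x j \<partial>count_space R)"
    unfolding mat_app_def
    by (intro nn_integral_cong, subst nn_integral_multc[symmetric]) (auto simp: mult_ac)
  finally show ?thesis .
qed

lemma op_bound_transpose: "op_bound R A C \<Longrightarrow> op_bound R (\<lambda>i j. A j i) C"
  by (rule op_boundI_form, simp add: op_bound_def, subst form_transpose) (rule op_bound_imp_form_le)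

lemma op_bound_mono:
  assumes "op_bound R B C" "\<And>i j. i \<in> R \<Longrightarrow> j \<in> R \<Longrightarrow> A i j \<le> B i j"
  shows "op_bound R A C"
  unfolding op_bound_def
proof (intro conjI allI impI)
  fix x assume x: "sq_norm R x \<le> 1"
  have "sq_norm R (mat_app R A x) \<le> sq_norm R (mat_app R B x)"
    by (intro sq_norm_mono mat_app_mono assms) auto
  also have "\<dots> \<le> ennreal (C\<^sup>2)" using assms(1) x by (simp add: op_bound_def)
  finally show "sq_norm R (mat_app R A x) \<le> ennreal (C\<^sup>2)" .
qed (use assms in \<open>simp add: op_bound_def\<close>)

lemma op_bound_weaken: "op_bound R A C \<Longrightarrow> C \<le> D \<Longrightarrow> op_bound R A D"
  by (auto simp: op_bound_def intro: order_trans ennreal_leI power_mono)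

text \<open>Test on a unit vector. This is what makes the entries of a normalised matrix at most 1
  in the Hadamard estimates.\<close>

lemma op_bound_entry:
  assumes "op_bound R A C" "i \<in> R" "j \<in> R"
  shows "A i j \<le> C"
proof -
  have C: "0 \<le> C" using assms(1) by (simp add: op_bound_def)
  let ?e = "\<lambda>k. if k = j then 1 else (0::ennreal)"
  have "(mat_app R A ?e i)\<^sup>2 \<le> sq_norm R (mat_app R A ?e)"
    by (rule sq_norm_ge[OF assms(2)])
  also have "\<dots> \<le> ennreal (C\<^sup>2)"
    using assms(1,3) by (simp add: op_bound_def sq_norm_unit)
  also have "\<dots> = (ennreal C)\<^sup>2" using C by (simp add: ennreal_power)
  finally have "mat_app R A ?e i \<le> ennreal C" by (rule power2_le_imp_le_ennreal)
  then have "ennreal (A i j) \<le> ennreal C"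
    using assms(3) by (simp add: mat_app_unit)
  then show ?thesis using C by (metis ennreal_le_iff)
qed

lemma op_bound_scale:
  assumes "op_bound R A C" "0 \<le> c"
  shows "op_bound R (\<lambda>i j. c * A i j) (c * C)"
  unfolding op_bound_def
proof (intro conjI allI impI)
  fix x assume x: "sq_norm R x \<le> 1"
  have *: "mat_app R (\<lambda>i j. c * A i j) x = (\<lambda>i. ennreal c * mat_app R A x i)"
    unfolding mat_app_def using assms(2)
    by (simp add: nn_integral_cmult[symmetric] ennreal_mult' mult.assoc)
  have "sq_norm R (mat_app R (\<lambda>i j. c * A i j) x) = ennreal (c\<^sup>2) * sq_norm R (mat_app R A x)"
    using assms(2) unfolding * sq_norm_cmult by (simp add: ennreal_power)
  also have "\<dots> \<le> ennreal (c\<^sup>2) * ennreal (C\<^sup>2)"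
    using assms(1) x by (intro mult_left_mono) (auto simp: op_bound_def)
  also have "\<dots> = ennreal ((c * C)\<^sup>2)"
    by (simp add: ennreal_mult[symmetric] power_mult_distrib)
  finally show "sq_norm R (mat_app R (\<lambda>i j. c * A i j) x) \<le> ennreal ((c * C)\<^sup>2)" .
qed (use assms in \<open>auto simp: op_bound_def\<close>)

section \<open>Operators on \<open>l\<^sup>2(R)\<close>\<close>

lemma summable_on_iff_nn_integral:
  fixes f :: "'a \<Rightarrow> real"
  assumes "\<And>x. x \<in> A \<Longrightarrow> 0 \<le> f x"
  shows "f summable_on A \<longleftrightarrow> (\<integral>\<^sup>+x. ennreal (f x) \<partial>count_space A) < top"
proof -
  have "f summable_on A \<longleftrightarrow> (\<lambda>x. norm (f x)) summable_on A"
    using assms by (intro summable_on_cong) auto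
  also have "\<dots> \<longleftrightarrow> integrable (count_space A) f"
    using abs_summable_equivalent[of f A] by (simp add: abs_summable_on_def)
  also have "\<dots> \<longleftrightarrow> (\<integral>\<^sup>+x. ennreal (norm (f x)) \<partial>count_space A) < top"
    by (simp add: integrable_iff_bounded)
  also have "(\<integral>\<^sup>+x. ennreal (norm (f x)) \<partial>count_space A) = (\<integral>\<^sup>+x. ennreal (f x) \<partial>count_space A)"
    using assms by (intro nn_integral_cong) auto
  finally show ?thesis .
qed

lemma nn_integral_eq_infsum:
  fixes f :: "'a \<Rightarrow> real"
  assumes nonneg: "\<And>x. x \<in> A \<Longrightarrow> 0 \<le> f x" and summable: "f summable_on A"
  shows "(\<integral>\<^sup>+x. ennreal (f x) \<partial>count_space A) = ennreal (infsum f A)"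
proof -
  have "(\<lambda>x. norm (f x)) summable_on A"
    using summable by (rule summable_on_cong[THEN iffD1, rotated]) (use nonneg in auto)
  then have "Infinite_Set_Sum.abs_summable_on f A" using abs_summable_equivalent by blast
  then show ?thesis
    using nn_integral_conv_infsetsum[of f A] nonneg infsetsum_infsum[of f A] by simp
qed

lemma
  fixes f :: "'a \<Rightarrow> complex"
  assumes "(\<integral>\<^sup>+x. ennreal (cmod (f x)) \<partial>count_space A) < top"
  shows abs_summable_nn_integral: "(\<lambda>x. cmod (f x)) summable_on A"
    and summable_nn_integral: "f summable_on A"
    and cmod_infsum_le_nn_integral:
      "ennreal (cmod (infsum f A)) \<le> (\<integral>\<^sup>+x. ennreal (cmod (f x)) \<partial>count_space A)"
proof -
  show *: "(\<lambda>x. cmod (f x)) summable_on A"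
    using assms by (subst summable_on_iff_nn_integral) auto
  then show "f summable_on A" by (rule abs_summable_summable)
  have "cmod (infsum f A) \<le> infsum (\<lambda>x. cmod (f x)) A"
    using * by (rule norm_infsum_bound)
  then show "ennreal (cmod (infsum f A)) \<le> (\<integral>\<^sup>+x. ennreal (cmod (f x)) \<partial>count_space A)"
    using * by (subst nn_integral_eq_infsum) (auto intro: ennreal_leI)
qed

lemma infsum_swap_nn_integral:
  fixes f :: "nat \<Rightarrow> nat \<Rightarrow> complex"
  assumes "(\<integral>\<^sup>+i. \<integral>\<^sup>+j. ennreal (cmod (f i j)) \<partial>count_space B \<partial>count_space A) < top"
  shows "infsum (\<lambda>i. infsum (f i) B) A = infsum (\<lambda>j. infsum (\<lambda>i. f i j) A) B"
proof (rule infsum_swap_banach)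
  let ?g = "\<lambda>p. ennreal (cmod (case p of (i, j) \<Rightarrow> f i j))"
  interpret sigma_finite_measure "count_space B"
    by (rule sigma_finite_measure_count_space_countable) simp
  have M: "count_space A \<Otimes>\<^sub>M count_space B = count_space (A \<times> B)"
    by (rule pair_measure_countable) auto
  have "(\<integral>\<^sup>+i. \<integral>\<^sup>+j. ?g (i, j) \<partial>count_space B \<partial>count_space A)
      = (\<integral>\<^sup>+p. ?g p \<partial>(count_space A \<Otimes>\<^sub>M count_space B))"
    by (rule nn_integral_fst) (simp add: M)
  then have "(\<integral>\<^sup>+p. ?g p \<partial>count_space (A \<times> B)) < top"
    using assms by (simp add: M)
  then show "(\<lambda>(i, j). f i j) summable_on A \<times> B" by (rule summable_nn_integral)
qed

lemma infsum_complex_of_real: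
  fixes f :: "'a \<Rightarrow> real"
  shows "f summable_on A \<Longrightarrow> infsum (\<lambda>x. complex_of_real (f x)) A = of_real (infsum f A)"
  by (rule infsum_bounded_linear_strong) (auto simp: bounded_linear_of_real summable_on_of_real)

section \<open>The dictionary between complex vectors and extended nonnegative vectors\<close>

abbreviation cabs :: "(nat \<Rightarrow> complex) \<Rightarrow> nat \<Rightarrow> ennreal" where
  "cabs x \<equiv> \<lambda>i. ennreal (cmod (x i))"

lemma l2_iff: "x \<in> l2 R \<longleftrightarrow> (\<forall>i. i \<notin> R \<longrightarrow> x i = 0) \<and> sq_norm R (cabs x) < top"
  by (simp add: l2_def sq_norm_def summable_on_iff_nn_integral ennreal_power)

lemma l2_norm_nonneg: "0 \<le> l2_norm R x"
  by (simp add: l2_norm_def infsum_nonneg)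

lemma sq_norm_l2: "x \<in> l2 R \<Longrightarrow> sq_norm R (cabs x) = ennreal ((l2_norm R x)\<^sup>2)"
  by (simp add: l2_def sq_norm_def l2_norm_def ennreal_power nn_integral_eq_infsum infsum_nonneg)

lemma sq_norm_cabs_le_iff:
  "x \<in> l2 R \<Longrightarrow> 0 \<le> C \<Longrightarrow> sq_norm R (cabs x) \<le> ennreal (C\<^sup>2) \<longleftrightarrow> l2_norm R x \<le> C"
  using l2_norm_nonneg[of R x] by (simp add: sq_norm_l2 power2_le_iff_abs_le)

text \<open>\<open>enn2real\<close> sends infinity to 0. This does no harm: a vector of finite
  square norm has only finite entries on \<open>R\<close>.\<close>

definition to_l2 :: "nat set \<Rightarrow> (nat \<Rightarrow> ennreal) \<Rightarrow> nat \<Rightarrow> complex" where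
  "to_l2 R y = (\<lambda>i. if i \<in> R then of_real (enn2real (y i)) else 0)"

lemma finite_of_sq_norm: "sq_norm R y < top \<Longrightarrow> i \<in> R \<Longrightarrow> y i < top"
  using sq_norm_ge[of i R y] by (cases "y i") (auto simp: power2_eq_square top_unique)

lemma
  assumes "sq_norm R y < top"
  shows sq_norm_to_l2: "sq_norm R (cabs (to_l2 R y)) = sq_norm R y"
    and to_l2_in_l2: "to_l2 R y \<in> l2 R"
proof -
  have *: "cabs (to_l2 R y) i = y i" if "i \<in> R" for i
    using that finite_of_sq_norm[OF assms that] by (simp add: to_l2_def)
  then show **: "sq_norm R (cabs (to_l2 R y)) = sq_norm R y" by (rule sq_norm_cong)
  show "to_l2 R y \<in> l2 R" using ** assms by (simp add: l2_iff to_l2_def)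
qed

lemma l2_norm_to_l2: "sq_norm R y \<le> ennreal (C\<^sup>2) \<Longrightarrow> 0 \<le> C \<Longrightarrow> l2_norm R (to_l2 R y) \<le> C"
  using sq_norm_to_l2[of R y] to_l2_in_l2[of R y] sq_norm_cabs_le_iff[of "to_l2 R y" R C]
    le_less_trans[OF _ ennreal_less_top, of "sq_norm R y" "C\<^sup>2"] by simp

text \<open>\<open>C\<close> is some bound rather than the norm, so that boundedness passes through
  constructions without suprema; \<open>nonneg_op_op_norm\<close> replaces it by the best
  constant.\<close>

definition nonneg_op :: "nat set \<Rightarrow> rmat \<Rightarrow> real \<Rightarrow> bool" where
  "nonneg_op R A C \<longleftrightarrow> nonneg_matrix R A \<and> op_bound R A C"

lemma nonneg_opD:
  assumes "nonneg_op R A C"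
  shows "0 \<le> A i j" "op_bound R A C" "0 \<le> C" "nonneg_matrix R A" "i \<notin> R \<or> j \<notin> R \<Longrightarrow> A i j = 0"
  using assms by (auto simp: nonneg_op_def nonneg_matrix_def op_bound_def is_matrix_def)

lemma mat_app_outside: "nonneg_op R A C \<Longrightarrow> i \<notin> R \<Longrightarrow> mat_app R A x i = 0"
  by (simp add: mat_app_def nonneg_opD)

lemma sq_norm_mat_app_finite:
  assumes "op_bound R A C" "sq_norm R x < top"
  shows "sq_norm R (mat_app R A x) < top"
proof -
  obtain D where D: "0 \<le> D" "sq_norm R x = ennreal (D\<^sup>2)"
    using assms(2) by (metis less_top_ennreal real_sqrt_ge_zero real_sqrt_pow2)
  show ?thesis using op_bound_app[OF assms(1) D(1)] D
    by (metis ennreal_less_top le_less_trans order_refl)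
qed

lemma nn_integral_cmod_row:
  assumes "nonneg_op R A C"
  shows "(\<integral>\<^sup>+j. ennreal (cmod (of_real (A i j) * x j)) \<partial>count_space R) = mat_app R A (cabs x) i"
  unfolding mat_app_def
  by (intro nn_integral_cong) (simp add: norm_mult ennreal_mult nonneg_opD[OF assms])

lemma mat_app_cabs_finite:
  assumes "nonneg_op R A C" "x \<in> l2 R"
  shows "mat_app R A (cabs x) i < top"
proof (cases "i \<in> R")
  case True
  then show ?thesis
    using assms by (auto simp: nonneg_op_def l2_iff
        intro: finite_of_sq_norm[OF sq_norm_mat_app_finite])
qed (simp add: mat_app_outside[OF assms(1)])

lemma
  assumes A: "nonneg_op R A C" and x: "x \<in> l2 R"
  shows mat_vec_summable: "(\<lambda>j. of_real (A i j) * x j) summable_on R"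
    and cabs_mat_vec_le: "cabs (mat_vec R A x) i \<le> mat_app R A (cabs x) i"
    and mat_vec_in_l2: "mat_vec R A x \<in> l2 R"
    and l2_norm_mat_vec_le: "l2_norm R (mat_vec R A x) \<le> C * l2_norm R x"
proof -
  have fin: "(\<integral>\<^sup>+j. ennreal (cmod (of_real (A i j) * x j)) \<partial>count_space R) < top" for i
    using mat_app_cabs_finite[OF A x] by (simp only: nn_integral_cmod_row[OF A])
  show "(\<lambda>j. of_real (A i j) * x j) summable_on R" by (rule summable_nn_integral[OF fin])
  have le: "cabs (mat_vec R A x) i \<le> mat_app R A (cabs x) i" for i
    unfolding mat_vec_def using cmod_infsum_le_nn_integral[OF fin]
    by (simp only: nn_integral_cmod_row[OF A])
  then show "cabs (mat_vec R A x) i \<le> mat_app R A (cabs x) i" .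
  have *: "sq_norm R (cabs (mat_vec R A x)) \<le> ennreal ((C * l2_norm R x)\<^sup>2)"
    by (rule order_trans[OF sq_norm_mono[OF le] op_bound_app])
      (use A x in \<open>auto simp: nonneg_op_def sq_norm_l2 l2_norm_nonneg\<close>)
  then show "mat_vec R A x \<in> l2 R"
    unfolding l2_iff using nonneg_opD[OF A]
    by (auto simp: mat_vec_def intro: le_less_trans)
  then show "l2_norm R (mat_vec R A x) \<le> C * l2_norm R x"
    using * nonneg_opD(3)[OF A] by (subst (asm) sq_norm_cabs_le_iff) (auto simp: l2_norm_nonneg)
qed

lemma mat_vec_to_l2:
  assumes A: "nonneg_op R A C" and y: "sq_norm R y < top"
  shows "mat_vec R A (to_l2 R y) = to_l2 R (mat_app R A y)"
proof
  fix i
  show "mat_vec R A (to_l2 R y) i = to_l2 R (mat_app R A y) i"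
  proof (cases "i \<in> R")
    case True
    let ?f = "\<lambda>j. A i j * enn2real (y j)"
    have eq: "(\<integral>\<^sup>+j. ennreal (?f j) \<partial>count_space R) = mat_app R A y i"
      unfolding mat_app_def
      by (intro nn_integral_cong)
        (simp add: ennreal_mult nonneg_opD[OF A] finite_of_sq_norm[OF y])
    have fin: "mat_app R A y i < top"
      using True A y by (auto intro: finite_of_sq_norm[OF sq_norm_mat_app_finite] simp: nonneg_op_def)
    have "?f summable_on R"
      using fin by (subst summable_on_iff_nn_integral) (auto simp: eq nonneg_opD[OF A])
    then have "ennreal (infsum ?f R) = mat_app R A y i"
      using nn_integral_eq_infsum[of R ?f] eq nonneg_opD[OF A] by simp
    then have "enn2real (ennreal (infsum ?f R)) = enn2real (mat_app R A y i)" by simp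
    then have "infsum ?f R = enn2real (mat_app R A y i)"
      by (simp add: infsum_nonneg nonneg_opD(1)[OF A])
    moreover have "mat_vec R A (to_l2 R y) i = infsum (\<lambda>j. of_real (?f j)) R"
      unfolding mat_vec_def to_l2_def by (intro infsum_cong) simp
    moreover have "infsum (\<lambda>j. of_real (?f j)) R = (of_real (infsum ?f R) :: complex)"
      using \<open>?f summable_on R\<close> by (rule infsum_complex_of_real)
    ultimately show ?thesis using True by (simp add: to_l2_def)
  next
    case False
    then show ?thesis by (simp add: mat_vec_def to_l2_def nonneg_opD[OF A])
  qed
qed

lemma nonneg_op_defines_operator: "nonneg_op R A C \<Longrightarrow> defines_operator R A"
  unfolding defines_operator_def by (blast intro: mat_vec_summable mat_vec_in_l2)

abbreviation mat_norm :: "nat set \<Rightarrow> rmat \<Rightarrow> real" where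
  "mat_norm R A \<equiv> op_norm R (mat_vec R A)"

lemma op_norm_le:
  assumes "nonneg_op R A C"
  shows "mat_norm R A \<le> C"
  unfolding op_norm_def
proof (rule cSUP_least)
  have "(\<lambda>_. 0) \<in> {x \<in> l2 R. l2_norm R x \<le> 1}" by (simp add: l2_def l2_norm_def)
  then show "{x \<in> l2 R. l2_norm R x \<le> 1} \<noteq> {}" by blast
  fix x assume "x \<in> {x \<in> l2 R. l2_norm R x \<le> 1}"
  then have "x \<in> l2 R" "l2_norm R x \<le> 1" by auto
  then show "l2_norm R (mat_vec R A x) \<le> C"
    using l2_norm_mat_vec_le[OF assms, of x] nonneg_opD(3)[OF assms]
      mult_left_mono[of "l2_norm R x" 1 C] by simp
qed

text \<open>The given \<open>C\<close> makes the supremum over complex vectors finite. Extended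
  nonnegative vectors of norm at most 1 are, through \<open>to_l2\<close>, among those complex
  vectors, and on them the operator acts as \<open>mat_app\<close>.\<close>

lemma nonneg_op_op_norm:
  assumes "nonneg_op R A C"
  shows "nonneg_op R A (mat_norm R A)"
proof -
  have bdd: "bdd_above ((\<lambda>x. l2_norm R (mat_vec R A x)) ` {x \<in> l2 R. l2_norm R x \<le> 1})"
  proof (rule bdd_aboveI2)
    fix x assume "x \<in> {x \<in> l2 R. l2_norm R x \<le> 1}"
    then have "x \<in> l2 R" "l2_norm R x \<le> 1" by auto
    then show "l2_norm R (mat_vec R A x) \<le> C"
      using l2_norm_mat_vec_le[OF assms, of x] nonneg_opD(3)[OF assms]
        mult_left_mono[of "l2_norm R x" 1 C] by simp
  qed
  have le: "l2_norm R (mat_vec R A x) \<le> mat_norm R A" if "x \<in> l2 R" "l2_norm R x \<le> 1" for x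
    unfolding op_norm_def using that by (intro cSUP_upper[OF _ bdd]) auto
  have nn: "0 \<le> mat_norm R A"
  proof -
    have "(\<lambda>_. 0) \<in> l2 R" "l2_norm R (\<lambda>_. 0) \<le> 1" by (simp_all add: l2_def l2_norm_def)
    from le[OF this] show ?thesis using l2_norm_nonneg by (rule order_trans[rotated])
  qed
  have "op_bound R A (mat_norm R A)"
    unfolding op_bound_def
  proof (intro conjI allI impI nn)
    fix y assume y: "sq_norm R y \<le> 1"
    then have fin: "sq_norm R y < top" by (auto intro: le_less_trans)
    have "l2_norm R (to_l2 R y) \<le> 1" using l2_norm_to_l2[of R y 1] y by simp
    then have "l2_norm R (to_l2 R (mat_app R A y)) \<le> mat_norm R A"
      using le[OF to_l2_in_l2[OF fin]] mat_vec_to_l2[OF assms fin] by simp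
    moreover have fin': "sq_norm R (mat_app R A y) < top"
      using assms fin by (auto intro: sq_norm_mat_app_finite simp: nonneg_op_def)
    ultimately show "sq_norm R (mat_app R A y) \<le> ennreal ((mat_norm R A)\<^sup>2)"
      using sq_norm_cabs_le_iff[OF to_l2_in_l2[OF fin'] nn] sq_norm_to_l2[OF fin'] by simp
  qed
  then show ?thesis using assms by (simp add: nonneg_op_def)
qed

lemma op_norm_nonneg: "nonneg_op R A C \<Longrightarrow> 0 \<le> mat_norm R A"
  by (rule nonneg_opD(3)[OF nonneg_op_op_norm])

text \<open>This carries the hypotheses of the theorem, stated for complex vectors, over to extended
  nonnegative ones. The absolute value supplies the nonnegative constant that
  \<open>op_bound\<close> demands.\<close>

lemma nonneg_opI_defines_operator:
  assumes A: "nonneg_matrix R A" "defines_operator R A"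
    and C: "\<And>x. x \<in> l2 R \<Longrightarrow> l2_norm R (mat_vec R A x) \<le> C * l2_norm R x"
  shows "nonneg_op R A \<bar>C\<bar>"
  unfolding nonneg_op_def op_bound_def
proof (intro conjI allI impI A)
  fix y assume y: "sq_norm R y \<le> 1"
  then have fin: "sq_norm R y < top" by (auto intro: le_less_trans)
  let ?x = "to_l2 R y"
  have x: "?x \<in> l2 R" by (rule to_l2_in_l2[OF fin])
  have Ann: "0 \<le> A i j" for i j using A by (simp add: nonneg_matrix_def)
  have Ax: "mat_vec R A ?x \<in> l2 R" using A(2) x by (simp add: defines_operator_def)
  have app: "cabs (mat_vec R A ?x) i = mat_app R A y i" if i: "i \<in> R" for i
  proof -
    let ?f = "\<lambda>j. A i j * enn2real (y j)"
    have "(\<lambda>j. of_real (A i j) * ?x j) summable_on R"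
      using A(2) x i by (simp add: defines_operator_def)
    then have "(\<lambda>j. complex_of_real (?f j)) summable_on R"
      by (rule summable_on_cong[THEN iffD1, rotated]) (simp add: to_l2_def)
    then have sm: "?f summable_on R" using summable_on_Re by fastforce
    have "mat_app R A y i = (\<integral>\<^sup>+j. ennreal (?f j) \<partial>count_space R)"
      unfolding mat_app_def
      by (intro nn_integral_cong)
        (simp add: ennreal_mult Ann finite_of_sq_norm[OF fin])
    also have "\<dots> = ennreal (infsum ?f R)"
      using sm by (intro nn_integral_eq_infsum) (auto simp: Ann)
    also have "infsum ?f R = cmod (of_real (infsum ?f R))"
      by (simp add: infsum_nonneg Ann)
    also have "of_real (infsum ?f R) = infsum (\<lambda>j. complex_of_real (?f j)) R"
      using sm by (rule infsum_complex_of_real[symmetric])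
    also have "\<dots> = mat_vec R A ?x i"
      unfolding mat_vec_def to_l2_def by (intro infsum_cong) simp
    finally show ?thesis by simp
  qed
  have "l2_norm R (mat_vec R A ?x) \<le> C * l2_norm R ?x" by (rule C[OF x])
  also have "\<dots> \<le> \<bar>C\<bar> * 1"
    using l2_norm_to_l2[of R y 1] y by (intro mult_mono) (auto simp: l2_norm_nonneg)
  finally have "sq_norm R (cabs (mat_vec R A ?x)) \<le> ennreal (\<bar>C\<bar>\<^sup>2)"
    using sq_norm_cabs_le_iff[OF Ax, of "\<bar>C\<bar>"] by simp
  then show "sq_norm R (mat_app R A y) \<le> ennreal (\<bar>C\<bar>\<^sup>2)"
    using sq_norm_cong[of R "cabs (mat_vec R A ?x)" "mat_app R A y"] app by simp
qed simp

abbreviation (input) transpose_mat :: "rmat \<Rightarrow> rmat" where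
  "transpose_mat A \<equiv> \<lambda>i j. A j i"

lemma nonneg_op_transpose:
  assumes "nonneg_op R A C"
  shows "nonneg_op R (transpose_mat A) C"
proof -
  have "op_bound R (transpose_mat A) C"
    by (rule op_bound_transpose) (use assms in \<open>simp add: nonneg_op_def\<close>)
  then show ?thesis
    using assms by (auto simp: nonneg_op_def nonneg_matrix_def is_matrix_def)
qed

lemma nonneg_op_weaken: "nonneg_op R A C \<Longrightarrow> C \<le> D \<Longrightarrow> nonneg_op R A D"
  by (auto simp: nonneg_op_def intro: op_bound_weaken)

lemma nn_integral_mult_finite:
  assumes "sq_norm R x < top" "sq_norm R y < top"
  shows "(\<integral>\<^sup>+i. x i * y i \<partial>count_space R) < top"
proof -
  have "(\<integral>\<^sup>+i. x i * y i \<partial>count_space R)\<^sup>2 \<le> sq_norm R x * sq_norm R y"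
    unfolding sq_norm_def by (rule Cauchy_Schwarz_nn_integral) auto
  also have "\<dots> < top" using assms by (simp add: ennreal_mult_less_top)
  finally show ?thesis
    by (cases "\<integral>\<^sup>+i. x i * y i \<partial>count_space R") (auto simp: power2_eq_square)
qed

lemma l2_inner_mat_vec:
  assumes A: "nonneg_op R A C" and x: "x \<in> l2 R" and y: "y \<in> l2 R"
  shows "l2_inner R (mat_vec R A x) y = l2_inner R x (mat_vec R (transpose_mat A) y)"
proof -
  let ?f = "\<lambda>i j. of_real (A i j) * x j * cnj (y i)"
  have "(\<integral>\<^sup>+i. \<integral>\<^sup>+j. ennreal (cmod (?f i j)) \<partial>count_space R \<partial>count_space R)
      = (\<integral>\<^sup>+i. mat_app R A (cabs x) i * cabs y i \<partial>count_space R)"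
    unfolding mat_app_def
    by (intro nn_integral_cong, subst nn_integral_multc[symmetric])
      (auto simp: norm_mult ennreal_mult nonneg_opD[OF A])
  also have "\<dots> < top"
    using A x y by (intro nn_integral_mult_finite sq_norm_mat_app_finite[of R A C])
      (auto simp: nonneg_op_def l2_iff)
  finally have swap: "infsum (\<lambda>i. infsum (?f i) R) R = infsum (\<lambda>j. infsum (\<lambda>i. ?f i j) R) R"
    by (rule infsum_swap_nn_integral)
  have "l2_inner R (mat_vec R A x) y = infsum (\<lambda>i. infsum (?f i) R) R"
    unfolding l2_inner_def mat_vec_def by (simp add: infsum_cmult_left')
  also note swap
  also have "infsum (\<lambda>j. infsum (\<lambda>i. ?f i j) R) R
      = infsum (\<lambda>j. infsum (\<lambda>i. x j * cnj (of_real (A i j) * y i)) R) R"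
    by (simp add: mult_ac)
  also have "\<dots> = l2_inner R x (mat_vec R (transpose_mat A) y)"
    unfolding l2_inner_def mat_vec_def by (simp only: infsum_cmult_right' infsum_cnj)
  finally show ?thesis .
qed

text \<open>The transpose satisfies the adjoint relation by interchanging sums; any other candidate
  is determined entry by entry through unit vectors, so the description in \<open>mat_adj\<close>
  denotes.\<close>

lemma mat_adj_eq_transpose:
  assumes A: "nonneg_op R A C"
  shows "mat_adj R A = transpose_mat A"
  unfolding mat_adj_def
proof (rule the_equality)
  show "is_matrix R (transpose_mat A) \<and> defines_operator R (transpose_mat A) \<and>
    (\<forall>x\<in>l2 R. \<forall>y\<in>l2 R. l2_inner R (mat_vec R A x) y
      = l2_inner R x (mat_vec R (transpose_mat A) y))"
    using nonneg_op_transpose[OF A] nonneg_op_defines_operator l2_inner_mat_vec[OF A]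
    by (auto simp: nonneg_op_def nonneg_matrix_def)
next
  fix B assume B: "is_matrix R B \<and> defines_operator R B \<and>
    (\<forall>x\<in>l2 R. \<forall>y\<in>l2 R. l2_inner R (mat_vec R A x) y = l2_inner R x (mat_vec R B y))"
  define e :: "nat \<Rightarrow> nat \<Rightarrow> complex" where "e = (\<lambda>k i. if i = k then 1 else 0)"
  have single: "infsum (\<lambda>j. f j * e k j) R = f k" "infsum (\<lambda>j. e k j * f j) R = f k"
    if "k \<in> R" for k and f :: "nat \<Rightarrow> complex"
    using that infsum_cong_neutral[of "{k}" R "\<lambda>j. f j * e k j" "\<lambda>j. f j * e k j"]
      infsum_cong_neutral[of "{k}" R "\<lambda>j. e k j * f j" "\<lambda>j. e k j * f j"]
    by (auto simp: e_def)
  have e: "e k \<in> l2 R" if "k \<in> R" for k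
  proof -
    have "cabs (e k) = (\<lambda>i. if i = k then 1 else 0)" by (auto simp: e_def)
    then show ?thesis using that sq_norm_unit[OF that, of 1] by (auto simp: l2_iff e_def)
  qed
  have "B j i = A i j" if ij: "i \<in> R" "j \<in> R" for i j
  proof -
    have "l2_inner R (mat_vec R A (e j)) (e i) = l2_inner R (e j) (mat_vec R B (e i))"
      using B e ij by blast
    moreover have "cnj (e i k) = e i k" for k by (simp add: e_def)
    ultimately show ?thesis
      using ij by (simp add: l2_inner_def mat_vec_def single)
  qed
  then show "B = transpose_mat A"
    using B nonneg_opD(5)[OF A] by (auto simp: is_matrix_def fun_eq_iff) metis
qed

section \<open>Matrix products\<close>

lemma
  assumes A: "nonneg_op R A C" and B: "nonneg_op R B D"
  shows mat_mul_summable: "(\<lambda>j. A i j * B j k) summable_on R"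
    and ennreal_mat_mul: "ennreal (mat_mul R A B i k) = mat_app R A (\<lambda>j. ennreal (B j k)) i"
proof -
  have eq: "(\<integral>\<^sup>+j. ennreal (A i j * B j k) \<partial>count_space R) = mat_app R A (\<lambda>j. ennreal (B j k)) i"
    by (simp add: mat_app_def ennreal_mult nonneg_opD[OF A] nonneg_opD[OF B])
  have "mat_app R A (\<lambda>j. ennreal (B j k)) i < top"
  proof (cases "i \<in> R \<and> k \<in> R")
    case True
    \<comment> \<open>Column \<open>k\<close> of \<open>B\<close> is the image of a unit vector,
      hence square-summable; \<open>A\<close> maps it to a vector with finite coordinates.\<close>
    have "sq_norm R (mat_app R B (\<lambda>j. if j = k then 1 else 0)) < top"
      using True by (intro sq_norm_mat_app_finite[OF nonneg_opD(2)[OF B]]) (simp add: sq_norm_unit)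
    then have "sq_norm R (\<lambda>j. ennreal (B j k)) < top"
      using True by (simp add: mat_app_unit cong: sq_norm_cong)
    then show ?thesis
      using True A by (auto intro: finite_of_sq_norm[OF sq_norm_mat_app_finite] simp: nonneg_op_def)
  next
    case False
    then show ?thesis
      by (auto simp: mat_app_def nonneg_opD(5)[OF A] nonneg_opD(5)[OF B])
  qed
  then show sm: "(\<lambda>j. A i j * B j k) summable_on R"
    by (subst summable_on_iff_nn_integral)
      (auto simp: eq nonneg_opD(1)[OF A] nonneg_opD(1)[OF B])
  show "ennreal (mat_mul R A B i k) = mat_app R A (\<lambda>j. ennreal (B j k)) i"
    unfolding mat_mul_def eq[symmetric]
    by (rule nn_integral_eq_infsum[symmetric])
      (auto simp: sm nonneg_opD(1)[OF A] nonneg_opD(1)[OF B])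
qed

lemma mat_app_mat_mul:
  assumes A: "nonneg_op R A C" and B: "nonneg_op R B D"
  shows "mat_app R (mat_mul R A B) x i = mat_app R A (mat_app R B x) i"
proof -
  have "mat_app R (mat_mul R A B) x i
      = (\<integral>\<^sup>+k. (\<integral>\<^sup>+j. ennreal (A i j) * ennreal (B j k) * x k \<partial>count_space R) \<partial>count_space R)"
    unfolding mat_app_def[of R "mat_mul R A B"] ennreal_mat_mul[OF A B]
    unfolding mat_app_def by (simp add: nn_integral_multc)
  also have "\<dots> = (\<integral>\<^sup>+j. (\<integral>\<^sup>+k. ennreal (A i j) * ennreal (B j k) * x k \<partial>count_space R) \<partial>count_space R)"
    by (rule count_space_Fubini)
  also have "\<dots> = mat_app R A (mat_app R B x) i"
    unfolding mat_app_def by (simp add: nn_integral_cmult mult.assoc)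
  finally show ?thesis .
qed

lemma nonneg_op_mat_mul:
  assumes A: "nonneg_op R A C" and B: "nonneg_op R B D"
  shows "nonneg_op R (mat_mul R A B) (C * D)"
  unfolding nonneg_op_def
proof
  show "nonneg_matrix R (mat_mul R A B)"
    by (auto simp: nonneg_matrix_def is_matrix_def mat_mul_def infsum_nonneg
        nonneg_opD[OF A] nonneg_opD[OF B])
  have "mat_app R (mat_mul R A B) x = mat_app R A (mat_app R B x)" for x
    by (simp add: mat_app_mat_mul[OF A B] fun_eq_iff)
  then show "op_bound R (mat_mul R A B) (C * D)"
    using nonneg_opD(2,3)[OF A] nonneg_opD(2,3)[OF B] op_bound_app[of R A C D]
    by (auto simp: op_bound_def)
qed

text \<open>Matrix identities such as associativity are proved through the action on extended
  nonnegative vectors, where products become compositions; unit vectors recover the entries.\<close>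

lemma nonneg_op_eqI:
  assumes A: "nonneg_op R A C" and B: "nonneg_op R B D"
    and eq: "\<And>x i. i \<in> R \<Longrightarrow> mat_app R A x i = mat_app R B x i"
  shows "A = B"
proof (intro ext)
  fix i k
  show "A i k = B i k"
  proof (cases "i \<in> R \<and> k \<in> R")
    case True
    then have "ennreal (A i k) = ennreal (B i k)"
      using eq[of i "\<lambda>j. if j = k then 1 else 0"] by (simp add: mat_app_unit)
    then show ?thesis by (simp add: nonneg_opD[OF A] nonneg_opD[OF B])
  qed (use nonneg_opD(5)[OF A] nonneg_opD(5)[OF B] in force)
qed

lemma mat_app_one: "i \<in> R \<Longrightarrow> mat_app R (mat_one R) x i = x i"
  unfolding mat_app_def mat_one_def by (subst nn_integral_count_space'[of "{i}"]) auto

lemma nonneg_op_one: "nonneg_op R (mat_one R) 1"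
proof -
  have "sq_norm R (mat_app R (mat_one R) x) = sq_norm R x" for x
    by (intro sq_norm_cong mat_app_one)
  then show ?thesis
    by (auto simp: nonneg_op_def nonneg_matrix_def is_matrix_def op_bound_def mat_one_def)
qed

lemma mat_mul_assoc:
  assumes A: "nonneg_op R A a" and B: "nonneg_op R B b" and C: "nonneg_op R C c"
  shows "mat_mul R (mat_mul R A B) C = mat_mul R A (mat_mul R B C)"
  by (rule nonneg_op_eqI[OF nonneg_op_mat_mul[OF nonneg_op_mat_mul[OF A B] C]
        nonneg_op_mat_mul[OF A nonneg_op_mat_mul[OF B C]]])
    (auto simp: mat_app_mat_mul[OF nonneg_op_mat_mul[OF A B] C] mat_app_mat_mul[OF A B]
      mat_app_mat_mul[OF A nonneg_op_mat_mul[OF B C]] mat_app_mat_mul[OF B C] intro!: mat_app_cong)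

lemma mat_mul_one_left: "nonneg_op R A C \<Longrightarrow> mat_mul R (mat_one R) A = A"
  by (rule nonneg_op_eqI[OF nonneg_op_mat_mul[OF nonneg_op_one]])
    (auto simp: mat_app_mat_mul[OF nonneg_op_one] mat_app_one)

lemma mat_mul_one_right: "nonneg_op R A C \<Longrightarrow> mat_mul R A (mat_one R) = A"
  by (rule nonneg_op_eqI[OF nonneg_op_mat_mul[OF _ nonneg_op_one]])
    (auto simp: mat_app_mat_mul[OF _ nonneg_op_one] mat_app_one intro!: mat_app_cong)

lemma mat_mul_mono:
  assumes ops: "nonneg_op R A a" "nonneg_op R B b" "nonneg_op R A' a'" "nonneg_op R B' b'"
    and "\<And>i j. A i j \<le> A' i j" "\<And>i j. B i j \<le> B' i j"
  shows "mat_mul R A B i k \<le> mat_mul R A' B' i k"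
proof -
  have "ennreal (mat_mul R A B i k) \<le> ennreal (mat_mul R A' B' i k)"
    unfolding ennreal_mat_mul[OF ops(1,2)] ennreal_mat_mul[OF ops(3,4)]
    by (intro mat_app_mono ennreal_leI assms)
  then show ?thesis using nonneg_opD(1)[OF nonneg_op_mat_mul[OF ops(3,4)]] by simp
qed

lemma nonneg_op_mono:
  assumes "nonneg_matrix R A" "nonneg_op R B C" "\<And>i j. A i j \<le> B i j"
  shows "nonneg_op R A C"
  using assms by (auto simp: nonneg_op_def intro: op_bound_mono)

section \<open>Hadamard products\<close>

text \<open>On [0,1] a larger exponent gives a smaller power, so \<alpha> may be lowered to 1/m, the
  exponent for which the arithmetic and geometric means compare. This is the origin of the threshold
  1/m.\<close>

lemma prod_powr_le_mean:
  fixes f :: "nat \<Rightarrow> real"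
  assumes m: "1 \<le> m" and \<alpha>: "1 / real m \<le> \<alpha>"
    and f: "\<And>j. j \<in> {1..m} \<Longrightarrow> 0 \<le> f j" "\<And>j. j \<in> {1..m} \<Longrightarrow> f j \<le> 1"
  shows "(\<Prod>j=1..m. f j powr \<alpha>) \<le> (\<Sum>j=1..m. f j) / real m"
proof -
  have "(\<Prod>j=1..m. f j powr \<alpha>) \<le> (\<Prod>j=1..m. f j powr (1 / real m))"
    using f \<alpha> by (intro prod_mono conjI powr_mono') auto
  also have "\<dots> = (\<Prod>j=1..m. f j) powr (1 / real m)"
    using f by (subst prod_powr_distrib) auto
  also have "\<dots> \<le> (\<Sum>j=1..m. f j) / real m"
    using arith_geom_mean[of "{1..m}" f] m f by (simp add: sum_divide_distrib)
  finally show ?thesis .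
qed

lemma has_sum_finite_sum:
  fixes f :: "'b \<Rightarrow> 'a \<Rightarrow> real"
  assumes "finite S" "\<And>j. j \<in> S \<Longrightarrow> (f j has_sum s j) R"
  shows "((\<lambda>l. \<Sum>j\<in>S. f j l) has_sum (\<Sum>j\<in>S. s j)) R"
  using assms by (induction S rule: finite_induct) (auto intro: has_sum_add)

text \<open>
  After scaling each \<open>f j\<close> to have sum \<open>1\<close>, all its values are at most \<open>1\<close>, so the exponents may be
  lowered to \<open>1/m\<close>; the inequality of arithmetic and geometric means then replaces Hoelder's.
\<close>

lemma infsum_prod_powr_le:
  fixes f :: "nat \<Rightarrow> 'a \<Rightarrow> real"
  assumes m: "1 \<le> m" and \<alpha>: "1 / real m \<le> \<alpha>"
    and nonneg: "\<And>j l. j \<in> {1..m} \<Longrightarrow> l \<in> R \<Longrightarrow> 0 \<le> f j l"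
    and sm: "\<And>j. j \<in> {1..m} \<Longrightarrow> f j summable_on R"
  shows "infsum (\<lambda>l. \<Prod>j=1..m. f j l powr \<alpha>) R \<le> (\<Prod>j=1..m. infsum (f j) R powr \<alpha>)"
proof (cases "\<exists>j\<in>{1..m}. infsum (f j) R = 0")
  case True
  then obtain j where j: "j \<in> {1..m}" "infsum (f j) R = 0" by blast
  have "f j l = 0" if "l \<in> R" for l
    using j nonneg sm that by (intro nonneg_infsum_le_0D[of "f j" R]) auto
  then have "(\<Prod>j=1..m. f j l powr \<alpha>) = 0" if "l \<in> R" for l
    using that j(1) by (intro prod_zero) (auto intro!: bexI[of _ j])
  then have "infsum (\<lambda>l. \<Prod>j=1..m. f j l powr \<alpha>) R = 0" by (intro infsum_0)
  then show ?thesis by (simp add: prod_nonneg)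
next
  case False
  define F where "F j = infsum (f j) R" for j
  have Fpos: "0 < F j" if "j \<in> {1..m}" for j
    using False that infsum_nonneg[of R "f j"] nonneg by (force simp: F_def)
  have le1: "f j l / F j \<le> 1" if "j \<in> {1..m}" "l \<in> R" for j l
    using finite_sum_le_infsum[of "f j" R "{l}"] sm nonneg that Fpos[OF that(1)]
    by (auto simp: F_def divide_le_eq)
  let ?K = "\<Prod>j=1..m. F j powr \<alpha>"
  \<comment> \<open>The right-hand side is \<open>?K\<close> times the mean of m sequences of sum 1,
    so it sums to exactly \<open>?K\<close>. It serves both as summable majorant and as the final
    bound.\<close>
  have pw: "(\<Prod>j=1..m. f j l powr \<alpha>) \<le> ?K / real m * (\<Sum>j=1..m. f j l * (1 / F j))" if "l \<in> R" for l
  proof -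
    have "(\<Prod>j=1..m. f j l powr \<alpha>) = ?K * (\<Prod>j=1..m. (f j l / F j) powr \<alpha>)"
      unfolding prod.distrib[symmetric]
      using Fpos nonneg[OF _ that] by (intro prod.cong) (auto simp: powr_divide less_le)
    also have "\<dots> \<le> ?K * ((\<Sum>j=1..m. f j l / F j) / real m)"
      using Fpos nonneg[OF _ that] le1[OF _ that]
      by (intro mult_left_mono prod_powr_le_mean m \<alpha> prod_nonneg) (auto simp: less_imp_le)
    finally show ?thesis by simp
  qed
  have sm1: "(\<lambda>l. f j l * (1 / F j)) summable_on R" if "j \<in> {1..m}" for j
    by (intro summable_on_cmult_left sm that)
  have hs: "((\<lambda>l. \<Sum>j=1..m. f j l * (1 / F j)) has_sum (\<Sum>j=1..m. 1)) R"
  proof (rule has_sum_finite_sum)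
    show "finite {1..m}" by simp
  next
    fix j assume j: "j \<in> {1..m}"
    have "((\<lambda>l. f j l * (1 / F j)) has_sum (F j * (1 / F j))) R"
      unfolding F_def by (intro has_sum_cmult_left has_sum_infsum sm j)
    then show "((\<lambda>l. f j l * (1 / F j)) has_sum 1) R" using Fpos[OF j] by simp
  qed
  have hs': "((\<lambda>l. ?K / real m * (\<Sum>j=1..m. f j l * (1 / F j))) has_sum ?K) R"
    using has_sum_cmult_right[OF hs, of "?K / real m"] m by simp
  have "(\<lambda>l. norm (\<Prod>j=1..m. f j l powr \<alpha>)) summable_on R"
    by (rule Infinite_Sum.abs_summable_on_comparison_test'[OF has_sum_imp_summable[OF hs']])
      (use pw in \<open>auto simp: prod_nonneg\<close>)
  then have "(\<lambda>l. \<Prod>j=1..m. f j l powr \<alpha>) summable_on R" by (rule abs_summable_summable)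
  then have "infsum (\<lambda>l. \<Prod>j=1..m. f j l powr \<alpha>) R
      \<le> infsum (\<lambda>l. ?K / real m * (\<Sum>j=1..m. f j l * (1 / F j))) R"
    by (rule infsum_mono[OF _ has_sum_imp_summable[OF hs'] pw])
  also have "\<dots> = ?K" by (rule infsumI[OF hs'])
  finally show ?thesis by (simp add: F_def)
qed

text \<open>For fixed \<open>i\<close> and \<open>k\<close> this is
  \<open>infsum_prod_powr_le\<close> for the m sequences \<open>A j i l * B j l k\<close> in the
  inner index \<open>l\<close>, each summable because the matrix products exist.\<close>

lemma mat_mul_hadamard_le:
  assumes m: "1 \<le> m" and \<alpha>: "1 / real m \<le> \<alpha>"
    and A: "\<And>j. j \<in> {1..m} \<Longrightarrow> nonneg_op R (A j) (a j)"
    and B: "\<And>j. j \<in> {1..m} \<Longrightarrow> nonneg_op R (B j) (b j)"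
  shows "mat_mul R (hadamard m (\<lambda>_. \<alpha>) A) (hadamard m (\<lambda>_. \<alpha>) B) i k
      \<le> hadamard m (\<lambda>_. \<alpha>) (\<lambda>j. mat_mul R (A j) (B j)) i k"
proof -
  have "mat_mul R (hadamard m (\<lambda>_. \<alpha>) A) (hadamard m (\<lambda>_. \<alpha>) B) i k
      = infsum (\<lambda>l. \<Prod>j=1..m. (A j i l * B j l k) powr \<alpha>) R"
    unfolding mat_mul_def hadamard_def prod.distrib[symmetric]
    using nonneg_opD(1)[OF A] nonneg_opD(1)[OF B] by (simp add: powr_mult)
  also have "\<dots> \<le> hadamard m (\<lambda>_. \<alpha>) (\<lambda>j. mat_mul R (A j) (B j)) i k"
    unfolding hadamard_def mat_mul_def
    using nonneg_opD(1)[OF A] nonneg_opD(1)[OF B] mat_mul_summable[OF A B]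
    by (intro infsum_prod_powr_le m \<alpha>) auto
  finally show ?thesis .
qed

text \<open>In terms of the form, the triangle inequality for a series is an interchange of sum and
  integral. It serves the Neumann series and, with finitely many terms, the arithmetic mean that
  majorises a Hadamard product.\<close>

lemma op_bound_suminf:
  assumes nonneg: "\<And>n i j. 0 \<le> A n i j" and sm: "\<And>i j. summable (\<lambda>n. A n i j)"
    and bd: "\<And>n. op_bound R (A n) (C n)" and C: "summable C"
  shows "op_bound R (\<lambda>i j. \<Sum>n. A n i j) (\<Sum>n. C n)"
proof (rule op_boundI_form)
  have Cnn: "0 \<le> C n" for n using bd by (simp add: op_bound_def)
  then show "0 \<le> (\<Sum>n. C n)" by (intro suminf_nonneg C)
  fix x y assume xy: "sq_norm R x \<le> 1" "sq_norm R y \<le> 1"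
  have "mat_app R (\<lambda>i j. \<Sum>n. A n i j) x i = (\<Sum>n. mat_app R (A n) x i)" for i
    unfolding mat_app_def
    by (subst nn_integral_suminf[symmetric]) (simp_all add: suminf_ennreal2[symmetric] nonneg sm)
  then have "(\<integral>\<^sup>+i. mat_app R (\<lambda>i j. \<Sum>n. A n i j) x i * y i \<partial>count_space R)
      = (\<Sum>n. \<integral>\<^sup>+i. mat_app R (A n) x i * y i \<partial>count_space R)"
    by (subst nn_integral_suminf[symmetric]) simp_all
  also have "\<dots> \<le> (\<Sum>n. ennreal (C n))"
    by (intro suminf_le op_bound_imp_form_le[OF bd] xy) auto
  also have "\<dots> = ennreal (\<Sum>n. C n)" by (rule suminf_ennreal2[OF Cnn C])
  finally show "(\<integral>\<^sup>+i. mat_app R (\<lambda>i j. \<Sum>n. A n i j) x i * y i \<partial>count_space R)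
      \<le> ennreal (\<Sum>n. C n)" .
qed

lemma op_bound_zero: "op_bound R (\<lambda>_ _. 0) 0"
  by (simp add: op_bound_def mat_app_def sq_norm_def)

lemma op_bound_sum:
  fixes A :: "nat \<Rightarrow> rmat"
  assumes fin: "finite S" and A: "\<And>n i j. n \<in> S \<Longrightarrow> 0 \<le> A n i j"
    and bd: "\<And>n. n \<in> S \<Longrightarrow> op_bound R (A n) (C n)"
  shows "op_bound R (\<lambda>i j. \<Sum>n\<in>S. A n i j) (\<Sum>n\<in>S. C n)"
proof -
  let ?A = "\<lambda>n i j. if n \<in> S then A n i j else 0" and ?C = "\<lambda>n. if n \<in> S then C n else 0"
  have "op_bound R (\<lambda>i j. \<Sum>n. ?A n i j) (\<Sum>n. ?C n)"
    using bd op_bound_zero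
    by (intro op_bound_suminf summable_finite[OF fin]) (auto simp: A)
  moreover have "(\<Sum>n. ?A n i j) = (\<Sum>n\<in>S. A n i j)" for i j
    by (subst suminf_finite[OF fin]) auto
  moreover have "(\<Sum>n. ?C n) = (\<Sum>n\<in>S. C n)"
    by (subst suminf_finite[OF fin]) auto
  ultimately show ?thesis by simp
qed

text \<open>Each \<open>A j\<close> divided by \<open>C j\<close> has norm and hence entries at most
  1. Therefore the Hadamard product lies entrywise below \<open>?K\<close> times the mean of these
  matrices, and a mean of contractions is a contraction.\<close>

lemma nonneg_op_hadamard:
  assumes m: "1 \<le> m" and \<alpha>: "1 / real m \<le> \<alpha>"
    and A: "\<And>j. j \<in> {1..m} \<Longrightarrow> nonneg_op R (A j) (C j)"
  shows "nonneg_op R (hadamard m (\<lambda>_. \<alpha>) A) (\<Prod>j=1..m. C j powr \<alpha>)"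
  unfolding nonneg_op_def
proof
  show "nonneg_matrix R (hadamard m (\<lambda>_. \<alpha>) A)"
  proof -
    have "hadamard m (\<lambda>_. \<alpha>) A i j = 0" if "i \<notin> R \<or> j \<notin> R" for i j
      unfolding hadamard_def using m nonneg_opD(5)[OF A that] by (intro prod_zero) auto
    then show ?thesis
      by (auto simp: nonneg_matrix_def is_matrix_def hadamard_def prod_nonneg)
  qed
  have C: "0 \<le> C j" if "j \<in> {1..m}" for j by (rule nonneg_opD(3)[OF A[OF that]])
  show "op_bound R (hadamard m (\<lambda>_. \<alpha>) A) (\<Prod>j=1..m. C j powr \<alpha>)"
  proof (cases "\<exists>j\<in>{1..m}. C j = 0")
    \<comment> \<open>\<open>C j = 0\<close> forces \<open>A j\<close> to vanish on
      \<open>R\<close>, since its entries are at most its norm; normalising is impossible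
      here.\<close>
    case True
    then obtain j where j: "j \<in> {1..m}" "C j = 0" by blast
    have "hadamard m (\<lambda>_. \<alpha>) A i k = 0" if "i \<in> R" "k \<in> R" for i k
    proof -
      have "A j i k = 0"
        using op_bound_entry[OF nonneg_opD(2)[OF A[OF j(1)]] that] nonneg_opD(1)[OF A[OF j(1)]] j(2)
        by (simp add: order_antisym)
      then show ?thesis unfolding hadamard_def using j(1) by (intro prod_zero) auto
    qed
    then have "op_bound R (hadamard m (\<lambda>_. \<alpha>) A) 0"
      by (intro op_bound_mono[OF op_bound_zero]) simp
    then show ?thesis by (rule op_bound_weaken) (simp add: prod_nonneg)
  next
    case False
    then have Cpos: "0 < C j" if "j \<in> {1..m}" for j using C[OF that] that by force
    let ?K = "\<Prod>j=1..m. C j powr \<alpha>"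
    let ?B = "\<lambda>i k. ?K / real m * (\<Sum>j=1..m. 1 / C j * A j i k)"
    have "op_bound R ?B (?K / real m * (\<Sum>j=1..m. 1 / C j * C j))"
      using Cpos nonneg_opD(1,2)[OF A]
      by (intro op_bound_scale op_bound_sum) (auto simp: prod_nonneg less_imp_le)
    moreover have "(\<Sum>j=1..m. 1 / C j * C j) = real m"
      using Cpos by (simp add: less_imp_neq[symmetric])
    ultimately have "op_bound R ?B ?K" using m by simp
    then show ?thesis
    proof (rule op_bound_mono)
      fix i k assume ik: "i \<in> R" "k \<in> R"
      have le1: "A j i k / C j \<le> 1" if "j \<in> {1..m}" for j
        using op_bound_entry[OF nonneg_opD(2)[OF A[OF that]] ik] Cpos[OF that]
        by (simp add: divide_le_eq)
      have "hadamard m (\<lambda>_. \<alpha>) A i k = ?K * (\<Prod>j=1..m. (A j i k / C j) powr \<alpha>)"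
        unfolding hadamard_def prod.distrib[symmetric]
        using Cpos nonneg_opD(1)[OF A]
        by (intro prod.cong) (auto simp: powr_divide less_le)
      also have "\<dots> \<le> ?K * ((\<Sum>j=1..m. A j i k / C j) / real m)"
        using Cpos nonneg_opD(1)[OF A] le1
        by (intro mult_left_mono prod_powr_le_mean m \<alpha> prod_nonneg) (auto simp: less_imp_le)
      finally show "hadamard m (\<lambda>_. \<alpha>) A i k \<le> ?B i k" by simp
    qed
  qed
qed

section \<open>The joint spectral radius\<close>

lemma Fekete_submultiplicative:
  fixes a :: "nat \<Rightarrow> real"
  assumes nonneg: "\<And>n. 0 \<le> a n" and submult: "\<And>m n. a (m + n) \<le> a m * a n"
  obtains L where "(\<lambda>n. a n powr (1 / real n)) \<longlonglongrightarrow> L" "0 \<le> L"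
    "\<And>n. 1 \<le> n \<Longrightarrow> L \<le> a n powr (1 / real n)"
proof
  define L where "L = (INF n\<in>{1..}. a n powr (1 / real n))"
  have bdd: "bdd_below ((\<lambda>n. a n powr (1 / real n)) ` {1..})"
    by (rule bdd_belowI2[of _ 0]) simp
  show L_le: "L \<le> a n powr (1 / real n)" if "1 \<le> n" for n
    unfolding L_def using that by (intro cINF_lower bdd) auto
  show "0 \<le> L" unfolding L_def by (intro cINF_greatest) auto
  show "(\<lambda>n. a n powr (1 / real n)) \<longlonglongrightarrow> L"
  proof (rule order_tendstoI)
    fix u assume u: "u < L"
    show "\<forall>\<^sub>F n in sequentially. u < a n powr (1 / real n)"
      by (rule eventually_sequentiallyI[of 1]) (use u L_le in \<open>auto intro: less_le_trans\<close>)
  next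
    fix u assume u: "L < u"
    then obtain c where c: "L < c" "c < u" using dense by blast
    have c0: "0 < c" using \<open>0 \<le> L\<close> c by simp
    obtain N where N: "1 \<le> N" "a N powr (1 / real N) < c"
      using c(1) cINF_less_iff[OF _ bdd] unfolding L_def by auto
    have aN: "a N \<le> c ^ N"
    proof -
      have "a N = (a N powr (1 / real N)) powr real N"
        using N nonneg by (simp add: powr_powr)
      also have "\<dots> \<le> c powr real N" using N by (intro powr_mono2) auto
      also have "\<dots> = c ^ N" using c0 by (rule powr_realpow)
      finally show ?thesis .
    qed
    \<comment> \<open>With n = qN + r, each block of length \<open>N\<close> costs a factor c^N.
      \<open>K\<close> absorbs every possible remainder r < N, and the summand 1 keeps it
      positive.\<close>
    define K where "K = 1 + (\<Sum>r<N. a r / c ^ r)"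
    have K0: "0 < K" unfolding K_def using c0 nonneg by (intro add_pos_nonneg sum_nonneg) auto
    have mult: "a (q * N + r) \<le> c ^ (q * N) * a r" for q r
    proof (induction q)
      case (Suc q)
      have "a (Suc q * N + r) \<le> a N * a (q * N + r)" using submult[of N "q * N + r"] by (simp add: add.assoc)
      also have "\<dots> \<le> c ^ N * (c ^ (q * N) * a r)"
        using Suc aN nonneg c0 by (intro mult_mono) auto
      finally show ?case by (simp add: power_add mult.assoc)
    qed simp
    have bound: "a n \<le> K * c ^ n" for n
    proof -
      have r: "n mod N < N" using N by simp
      have "a n \<le> c ^ (n div N * N) * a (n mod N)" using mult[of "n div N" "n mod N"] by simp
      also have "\<dots> = c ^ n * (a (n mod N) / c ^ (n mod N))"
      proof -
        have "c ^ n = c ^ (n div N * N) * c ^ (n mod N)" by (metis div_mult_mod_eq power_add)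
        then show ?thesis using c0 by simp
      qed
      also have "a (n mod N) / c ^ (n mod N) \<le> (\<Sum>r<N. a r / c ^ r)"
        using r nonneg c0 by (intro member_le_sum) auto
      then have "c ^ n * (a (n mod N) / c ^ (n mod N)) \<le> c ^ n * K"
        using c0 by (intro mult_left_mono) (auto simp: K_def)
      finally show ?thesis by (simp add: mult.commute)
    qed
    have root_bound: "a n powr (1 / real n) \<le> K powr (1 / real n) * c" if "1 \<le> n" for n
    proof -
      have "a n powr (1 / real n) \<le> (K * c ^ n) powr (1 / real n)"
        by (intro powr_mono2 bound nonneg) simp
      also have "\<dots> = K powr (1 / real n) * c"
        using that c0 K0 by (simp add: powr_mult powr_realpow[symmetric] powr_powr)
      finally show ?thesis .
    qed
    have "(\<lambda>n. K powr (1 / real n) * c) \<longlonglongrightarrow> K powr 0 * c"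
      using K0 by (intro tendsto_intros lim_1_over_n) auto
    then have "\<forall>\<^sub>F n in sequentially. K powr (1 / real n) * c < u"
      using K0 c by (intro order_tendstoD(2)[of _ "K powr 0 * c"]) auto
    then show "\<forall>\<^sub>F n in sequentially. a n powr (1 / real n) < u"
      using eventually_ge_at_top[of 1]
      by eventually_elim (use root_bound in \<open>auto intro: le_less_trans\<close>)
  qed
qed

text \<open>The condition on \<open>C\<close> stands apart so that it holds for the empty set too.
  \<open>C\<close> is any common bound; \<open>set_norm\<close> is the least one.\<close>

definition nonneg_ops :: "nat set \<Rightarrow> rmat set \<Rightarrow> real \<Rightarrow> bool" where
  "nonneg_ops R \<Sigma> C \<longleftrightarrow> 0 \<le> C \<and> (\<forall>A\<in>\<Sigma>. nonneg_op R A C)"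

lemma nonneg_opsD: "nonneg_ops R \<Sigma> C \<Longrightarrow> A \<in> \<Sigma> \<Longrightarrow> nonneg_op R A C"
  by (simp add: nonneg_ops_def)

lemma nonneg_opsD_nonneg: "nonneg_ops R \<Sigma> C \<Longrightarrow> 0 \<le> C"
  by (simp add: nonneg_ops_def)

lemma nonneg_ops_singleton: "nonneg_op R A C \<Longrightarrow> nonneg_ops R {A} C"
  by (simp add: nonneg_ops_def nonneg_opD(3))

lemma set_norm_le: "nonneg_ops R \<Sigma> C \<Longrightarrow> set_norm R \<Sigma> \<le> C"
  unfolding set_norm_def
  by (intro cSup_least) (auto simp: nonneg_ops_def op_norm_le)

lemma nonneg_ops_set_norm:
  assumes "nonneg_ops R \<Sigma> C"
  shows "nonneg_ops R \<Sigma> (set_norm R \<Sigma>)"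
proof -
  have bdd: "bdd_above (insert 0 ((\<lambda>A. mat_norm R A) ` \<Sigma>))"
    using assms by (intro bdd_aboveI[of _ C]) (auto simp: nonneg_ops_def op_norm_le)
  have "0 \<le> set_norm R \<Sigma>" unfolding set_norm_def by (intro cSup_upper bdd) simp
  moreover have "mat_norm R A \<le> set_norm R \<Sigma>" if "A \<in> \<Sigma>" for A
    unfolding set_norm_def using that by (intro cSup_upper bdd) simp
  ultimately show ?thesis
    using assms nonneg_op_op_norm nonneg_op_weaken unfolding nonneg_ops_def by blast
qed

lemma set_norm_nonneg: "nonneg_ops R \<Sigma> C \<Longrightarrow> 0 \<le> set_norm R \<Sigma>"
  by (rule nonneg_opsD_nonneg[OF nonneg_ops_set_norm])

lemma set_norm_singleton: "nonneg_op R A C \<Longrightarrow> set_norm R {A} = mat_norm R A"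
  using op_norm_nonneg[of R A C] by (simp add: set_norm_def cSup_insert_If sup_absorb2)

lemma nonneg_ops_set_mul:
  "nonneg_ops R \<Sigma> C \<Longrightarrow> nonneg_ops R \<Phi> D \<Longrightarrow> nonneg_ops R (set_mul R \<Sigma> \<Phi>) (C * D)"
  by (auto simp: nonneg_ops_def set_mul_def intro: nonneg_op_mat_mul)

lemma nonneg_ops_one: "nonneg_ops R {mat_one R} 1"
  by (simp add: nonneg_ops_def nonneg_op_one)

lemma set_mul_assoc:
  assumes "nonneg_ops R \<Sigma> a" "nonneg_ops R \<Phi> b" "nonneg_ops R \<Psi> c"
  shows "set_mul R (set_mul R \<Sigma> \<Phi>) \<Psi> = set_mul R \<Sigma> (set_mul R \<Phi> \<Psi>)"
proof -
  have "mat_mul R (mat_mul R A B) C = mat_mul R A (mat_mul R B C)"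
    if "A \<in> \<Sigma>" "B \<in> \<Phi>" "C \<in> \<Psi>" for A B C
    using assms that by (intro mat_mul_assoc) (auto simp: nonneg_ops_def)
  then show ?thesis unfolding set_mul_def by (auto; metis)
qed

lemma set_mul_one_left: "nonneg_ops R \<Sigma> C \<Longrightarrow> set_mul R {mat_one R} \<Sigma> = \<Sigma>"
  using mat_mul_one_left by (force simp: set_mul_def nonneg_ops_def)

lemma set_mul_one_right: "nonneg_ops R \<Sigma> C \<Longrightarrow> set_mul R \<Sigma> {mat_one R} = \<Sigma>"
  using mat_mul_one_right by (force simp: set_mul_def nonneg_ops_def)

lemma set_prod_Nil: "set_prod R [] = {mat_one R}"
  by (simp add: set_prod_def)

lemma set_prod_Cons: "set_prod R (\<Sigma> # \<Sigma>s) = set_mul R \<Sigma> (set_prod R \<Sigma>s)"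
  by (simp add: set_prod_def)

lemma nonneg_ops_set_prod:
  "(\<And>\<Sigma>. \<Sigma> \<in> set \<Sigma>s \<Longrightarrow> \<exists>C. nonneg_ops R \<Sigma> C) \<Longrightarrow> \<exists>C. nonneg_ops R (set_prod R \<Sigma>s) C"
proof (induction \<Sigma>s)
  case Nil
  then show ?case using nonneg_ops_one by (auto simp: set_prod_Nil)
next
  case (Cons \<Sigma> \<Sigma>s)
  then show ?case using nonneg_ops_set_mul by (fastforce simp: set_prod_Cons)
qed

lemma set_prod_append:
  assumes "\<And>\<Sigma>. \<Sigma> \<in> set \<Sigma>s \<Longrightarrow> \<exists>C. nonneg_ops R \<Sigma> C" "\<And>\<Sigma>. \<Sigma> \<in> set \<Phi>s \<Longrightarrow> \<exists>C. nonneg_ops R \<Sigma> C"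
  shows "set_prod R (\<Sigma>s @ \<Phi>s) = set_mul R (set_prod R \<Sigma>s) (set_prod R \<Phi>s)"
  using assms(1)
proof (induction \<Sigma>s)
  case Nil
  obtain b where "nonneg_ops R (set_prod R \<Phi>s) b"
    using nonneg_ops_set_prod[OF assms(2)] by blast
  then show ?case by (simp add: set_prod_Nil set_mul_one_left)
next
  case (Cons \<Sigma> \<Sigma>s)
  obtain a where a: "nonneg_ops R \<Sigma> a" using Cons.prems[of \<Sigma>] by auto
  obtain b where b: "nonneg_ops R (set_prod R \<Sigma>s) b"
    using nonneg_ops_set_prod[of \<Sigma>s R] Cons.prems by auto
  obtain c where c: "nonneg_ops R (set_prod R \<Phi>s) c"
    using nonneg_ops_set_prod[OF assms(2)] by auto
  show ?case using Cons.IH Cons.prems by (simp add: set_prod_Cons set_mul_assoc[OF a b c])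
qed

lemma set_power_0: "set_power R \<Sigma> 0 = {mat_one R}"
  by (simp add: set_power_def set_prod_Nil)

lemma set_power_Suc: "set_power R \<Sigma> (Suc k) = set_mul R \<Sigma> (set_power R \<Sigma> k)"
  by (simp add: set_power_def set_prod_Cons)

lemma nonneg_ops_set_power: "nonneg_ops R \<Sigma> C \<Longrightarrow> nonneg_ops R (set_power R \<Sigma> k) (C ^ k)"
  by (induction k) (simp_all add: set_power_0 set_power_Suc nonneg_ops_one nonneg_ops_set_mul)

lemma set_power_add:
  assumes "nonneg_ops R \<Sigma> C"
  shows "set_power R \<Sigma> (k + l) = set_mul R (set_power R \<Sigma> k) (set_power R \<Sigma> l)"
  unfolding set_power_def replicate_add using assms by (intro set_prod_append) auto

lemma set_power_1: "nonneg_ops R \<Sigma> C \<Longrightarrow> set_power R \<Sigma> 1 = \<Sigma>"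
  by (simp add: set_power_Suc set_power_0 set_mul_one_right)

lemma set_power_mult:
  assumes "nonneg_ops R \<Sigma> C"
  shows "set_power R \<Sigma> (m * k) = set_power R (set_power R \<Sigma> m) k"
  by (induction k) (simp_all add: set_power_0 set_power_Suc set_power_add[OF assms])

text \<open>The norms of the powers are submultiplicative, so Fekete's lemma shows that
  \<open>lim\<close> in the definition denotes a true limit, and that this limit is a lower bound
  for all the roots.\<close>

lemma
  assumes "nonneg_ops R \<Sigma> C"
  shows joint_spectral_radius_tendsto:
      "(\<lambda>k. set_norm R (set_power R \<Sigma> k) powr (1 / real k)) \<longlonglongrightarrow> joint_spectral_radius R \<Sigma>"
    and joint_spectral_radius_nonneg: "0 \<le> joint_spectral_radius R \<Sigma>"
    and joint_spectral_radius_le_root: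
      "1 \<le> k \<Longrightarrow> joint_spectral_radius R \<Sigma> \<le> set_norm R (set_power R \<Sigma> k) powr (1 / real k)"
proof -
  let ?a = "\<lambda>k. set_norm R (set_power R \<Sigma> k)"
  have ops: "nonneg_ops R (set_power R \<Sigma> k) (?a k)" for k
    by (rule nonneg_ops_set_norm[OF nonneg_ops_set_power[OF assms]])
  have "0 \<le> ?a k" for k by (rule nonneg_opsD_nonneg[OF ops])
  moreover have "?a (k + l) \<le> ?a k * ?a l" for k l
    unfolding set_power_add[OF assms] by (intro set_norm_le nonneg_ops_set_mul ops)
  ultimately obtain L where L: "(\<lambda>k. ?a k powr (1 / real k)) \<longlonglongrightarrow> L" "0 \<le> L"
    "\<And>n. 1 \<le> n \<Longrightarrow> L \<le> ?a n powr (1 / real n)"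
    using Fekete_submultiplicative[of ?a] by blast
  have "joint_spectral_radius R \<Sigma> = L"
    unfolding joint_spectral_radius_def using L(1) by (rule limI)
  with L show "(\<lambda>k. ?a k powr (1 / real k)) \<longlonglongrightarrow> joint_spectral_radius R \<Sigma>"
    "0 \<le> joint_spectral_radius R \<Sigma>"
    "1 \<le> k \<Longrightarrow> joint_spectral_radius R \<Sigma> \<le> ?a k powr (1 / real k)"
    by auto
qed

lemma joint_spectral_radius_power_le:
  assumes "nonneg_ops R \<Sigma> C" "1 \<le> k"
  shows "joint_spectral_radius R \<Sigma> ^ k \<le> set_norm R (set_power R \<Sigma> k)"
proof -
  have "joint_spectral_radius R \<Sigma> ^ k \<le> (set_norm R (set_power R \<Sigma> k) powr (1 / real k)) ^ k"
    using assms by (intro power_mono joint_spectral_radius_le_root joint_spectral_radius_nonneg) auto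
  also have "\<dots> = set_norm R (set_power R \<Sigma> k)"
    using assms(2) set_norm_nonneg[OF nonneg_ops_set_power[OF assms(1), of k]]
    by (cases "set_norm R (set_power R \<Sigma> k) = 0") (auto simp: powr_powr simp flip: powr_realpow)
  finally show ?thesis .
qed

lemma eventually_set_norm_power_le:
  assumes "nonneg_ops R \<Sigma> C" "joint_spectral_radius R \<Sigma> < t"
  shows "\<forall>\<^sub>F k in sequentially. set_norm R (set_power R \<Sigma> k) \<le> t ^ k"
  using order_tendstoD(2)[OF joint_spectral_radius_tendsto[OF assms(1)] assms(2)] eventually_ge_at_top[of 1]
proof eventually_elim
  case (elim k)
  have t: "0 < t" using joint_spectral_radius_nonneg[OF assms(1)] assms(2) by simp
  have "set_norm R (set_power R \<Sigma> k) = (set_norm R (set_power R \<Sigma> k) powr (1 / real k)) powr real k"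
    using elim set_norm_nonneg[OF nonneg_ops_set_power[OF assms(1), of k]] by (simp add: powr_powr)
  also have "\<dots> \<le> t powr real k" using elim by (intro powr_mono2) auto
  also have "\<dots> = t ^ k" using t by (rule powr_realpow)
  finally show ?case .
qed

lemma joint_spectral_radius_leI:
  assumes ops: "nonneg_ops R \<Sigma> C" and pos: "0 < K" "0 < t"
    and le: "\<forall>\<^sub>F k in sequentially. set_norm R (set_power R \<Sigma> k) \<le> K * t ^ k"
  shows "joint_spectral_radius R \<Sigma> \<le> t"
proof (rule tendsto_le[OF _ _ joint_spectral_radius_tendsto[OF ops]])
  have "(\<lambda>n. K powr (1 / real n) * t) \<longlonglongrightarrow> K powr 0 * t"
    using pos by (intro tendsto_intros lim_1_over_n) auto
  then show "(\<lambda>n. K powr (1 / real n) * t) \<longlonglongrightarrow> t" using pos by simp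
  show "\<forall>\<^sub>F k in sequentially. set_norm R (set_power R \<Sigma> k) powr (1 / real k) \<le> K powr (1 / real k) * t"
    using le eventually_ge_at_top[of 1]
  proof eventually_elim
    case (elim k)
    have "set_norm R (set_power R \<Sigma> k) powr (1 / real k) \<le> (K * t ^ k) powr (1 / real k)"
      using elim by (intro powr_mono2 set_norm_nonneg[OF nonneg_ops_set_power[OF ops]]) auto
    also have "\<dots> = K powr (1 / real k) * t"
      using elim pos by (simp add: powr_mult powr_realpow[symmetric] powr_powr)
    finally show ?case .
  qed
qed simp

text \<open>A product of Hadamard products is in general not a Hadamard product of products; it only
  has an entrywise majorant of that form. Multiplication of nonnegative matrices is monotone in the
  entries, so the relation passes to powers, norms and radii.\<close>

definition dominated :: "rmat set \<Rightarrow> rmat set \<Rightarrow> bool" where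
  "dominated \<Sigma> \<Phi> \<longleftrightarrow> (\<forall>A\<in>\<Sigma>. \<exists>B\<in>\<Phi>. \<forall>i k. A i k \<le> B i k)"

lemma dominated_refl: "dominated \<Sigma> \<Sigma>"
  by (auto simp: dominated_def)

lemma dominated_trans: "dominated \<Sigma> \<Phi> \<Longrightarrow> dominated \<Phi> \<Psi> \<Longrightarrow> dominated \<Sigma> \<Psi>"
  unfolding dominated_def by (meson order_trans)

lemma dominated_set_mul:
  assumes ops: "nonneg_ops R \<Sigma> a" "nonneg_ops R \<Sigma>' a'" "nonneg_ops R \<Phi> b" "nonneg_ops R \<Phi>' b'"
    and dom: "dominated \<Sigma> \<Sigma>'" "dominated \<Phi> \<Phi>'"
  shows "dominated (set_mul R \<Sigma> \<Phi>) (set_mul R \<Sigma>' \<Phi>')"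
  unfolding dominated_def
proof
  fix X assume "X \<in> set_mul R \<Sigma> \<Phi>"
  then obtain A B where AB: "A \<in> \<Sigma>" "B \<in> \<Phi>" "X = mat_mul R A B" by (auto simp: set_mul_def)
  obtain A' where A': "A' \<in> \<Sigma>'" "\<And>i k. A i k \<le> A' i k" using dom AB unfolding dominated_def by blast
  obtain B' where B': "B' \<in> \<Phi>'" "\<And>i k. B i k \<le> B' i k" using dom AB unfolding dominated_def by blast
  have "mat_mul R A B i k \<le> mat_mul R A' B' i k" for i k
    using ops AB A' B' by (intro mat_mul_mono) (auto simp: nonneg_ops_def)
  then show "\<exists>Y\<in>set_mul R \<Sigma>' \<Phi>'. \<forall>i k. X i k \<le> Y i k"
    using AB A' B' by (auto simp: set_mul_def)
qed

lemma dominated_set_power: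
  assumes "nonneg_ops R \<Sigma> a" "nonneg_ops R \<Phi> b" "dominated \<Sigma> \<Phi>"
  shows "dominated (set_power R \<Sigma> k) (set_power R \<Phi> k)"
proof (induction k)
  case (Suc k)
  then show ?case
    unfolding set_power_Suc using assms
    by (intro dominated_set_mul[OF assms(1,2) nonneg_ops_set_power[OF assms(1)] nonneg_ops_set_power[OF assms(2)]])
qed (simp add: set_power_0 dominated_refl)

lemma set_norm_dominated:
  assumes "nonneg_ops R \<Sigma> a" "nonneg_ops R \<Phi> b" "dominated \<Sigma> \<Phi>"
  shows "set_norm R \<Sigma> \<le> set_norm R \<Phi>"
proof (rule set_norm_le)
  have \<Phi>: "nonneg_ops R \<Phi> (set_norm R \<Phi>)" by (rule nonneg_ops_set_norm[OF assms(2)])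
  have "nonneg_op R A (set_norm R \<Phi>)" if "A \<in> \<Sigma>" for A
  proof -
    from assms(3) that obtain B where B: "B \<in> \<Phi>" "\<And>i k. A i k \<le> B i k"
      unfolding dominated_def by blast
    show ?thesis
      by (rule nonneg_op_mono[OF nonneg_opD(4)[OF nonneg_opsD[OF assms(1) that]]
            nonneg_opsD[OF \<Phi> B(1)] B(2)])
  qed
  then show "nonneg_ops R \<Sigma> (set_norm R \<Phi>)" using \<Phi> by (simp add: nonneg_ops_def)
qed

lemma joint_spectral_radius_dominated:
  assumes "nonneg_ops R \<Sigma> a" "nonneg_ops R \<Phi> b" "dominated \<Sigma> \<Phi>"
  shows "joint_spectral_radius R \<Sigma> \<le> joint_spectral_radius R \<Phi>"
proof (rule LIMSEQ_le[OF joint_spectral_radius_tendsto[OF assms(1)] joint_spectral_radius_tendsto[OF assms(2)]])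
  have "set_norm R (set_power R \<Sigma> k) \<le> set_norm R (set_power R \<Phi> k)" for k
    by (rule set_norm_dominated[OF nonneg_ops_set_power[OF assms(1)] nonneg_ops_set_power[OF assms(2)]
          dominated_set_power[OF assms]])
  then show "\<exists>N. \<forall>n\<ge>N. set_norm R (set_power R \<Sigma> n) powr (1 / real n)
      \<le> set_norm R (set_power R \<Phi> n) powr (1 / real n)"
    using set_norm_nonneg[OF nonneg_ops_set_power[OF assms(1)]] by (auto intro!: powr_mono2)
qed

text \<open>The brackets in the alternating word are shifted by one letter. Both exchange results,
  for norms and for spectral radii, build on this.\<close>

lemma set_power_mul_Suc:
  assumes X: "nonneg_ops R X a" and Y: "nonneg_ops R Y b"
  shows "set_power R (set_mul R X Y) (Suc k)
       = set_mul R X (set_mul R (set_power R (set_mul R Y X) k) Y)"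
proof (induction k)
  case 0
  show ?case using set_power_1[OF nonneg_ops_set_mul[OF X Y]] set_mul_one_left[OF Y]
    by (simp add: set_power_0)
next
  case (Suc k)
  have P: "nonneg_ops R (set_power R (set_mul R Y X) k) ((b * a) ^ k)"
    by (rule nonneg_ops_set_power[OF nonneg_ops_set_mul[OF Y X]])
  note PY = nonneg_ops_set_mul[OF P Y]
  have "set_power R (set_mul R X Y) (Suc (Suc k))
      = set_mul R (set_mul R X Y) (set_mul R X (set_mul R (set_power R (set_mul R Y X) k) Y))"
    using Suc by (simp add: set_power_Suc)
  also have "\<dots> = set_mul R X (set_mul R Y (set_mul R X (set_mul R (set_power R (set_mul R Y X) k) Y)))"
    by (rule set_mul_assoc[OF X Y nonneg_ops_set_mul[OF X PY]])
  also have "set_mul R Y (set_mul R X (set_mul R (set_power R (set_mul R Y X) k) Y))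
      = set_mul R (set_mul R Y X) (set_mul R (set_power R (set_mul R Y X) k) Y)"
    by (rule set_mul_assoc[OF Y X PY, symmetric])
  also have "\<dots> = set_mul R (set_power R (set_mul R Y X) (Suc k)) Y"
    unfolding set_power_Suc by (rule set_mul_assoc[OF nonneg_ops_set_mul[OF Y X] P Y, symmetric])
  finally show ?case .
qed

lemma joint_spectral_radius_commute:
  assumes X: "nonneg_ops R X a" and Y: "nonneg_ops R Y b"
  shows "joint_spectral_radius R (set_mul R X Y) \<le> joint_spectral_radius R (set_mul R Y X)"
proof (rule dense_ge)
  note XY = nonneg_ops_set_mul[OF X Y] and YX = nonneg_ops_set_mul[OF Y X]
  fix t assume t: "joint_spectral_radius R (set_mul R Y X) < t"
  then have t0: "0 < t" using joint_spectral_radius_nonneg[OF YX] by simp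
  obtain k0 where k0: "\<And>k. k \<ge> k0 \<Longrightarrow> set_norm R (set_power R (set_mul R Y X) k) \<le> t ^ k"
    using eventually_set_norm_power_le[OF YX t] by (auto simp: eventually_sequentially)
  have ab: "0 \<le> a" "0 \<le> b" using X Y by (auto simp: nonneg_ops_def)
  \<comment> \<open>The factor \<open>a * b / t\<close> pays for the outer \<open>X\<close> and
    \<open>Y\<close> and for the exponent dropping from k to k - 1; the summand 1 keeps the constant
    positive when a * b = 0.\<close>
  have "set_norm R (set_power R (set_mul R X Y) k) \<le> (a * b / t + 1) * t ^ k" if "k \<ge> Suc k0" for k
  proof -
    from that obtain n where n: "k = Suc n" "n \<ge> k0" by (cases k) auto
    have "set_norm R (set_power R (set_mul R X Y) k)
        \<le> a * (set_norm R (set_power R (set_mul R Y X) n) * b)"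
      unfolding n set_power_mul_Suc[OF X Y]
      by (intro set_norm_le nonneg_ops_set_mul X Y nonneg_ops_set_norm[OF nonneg_ops_set_power[OF YX]])
    also have "\<dots> \<le> a * (t ^ n * b)"
      by (intro mult_left_mono mult_right_mono k0 n ab)
    also have "\<dots> \<le> (a * b / t + 1) * t ^ k"
      using t0 by (simp add: n field_simps)
    finally show ?thesis .
  qed
  then have ev: "\<forall>\<^sub>F k in sequentially. set_norm R (set_power R (set_mul R X Y) k) \<le> (a * b / t + 1) * t ^ k"
    by (auto simp: eventually_sequentially)
  show "joint_spectral_radius R (set_mul R X Y) \<le> t"
    by (rule joint_spectral_radius_leI[OF XY _ t0 ev]) (use ab t0 in \<open>auto intro: add_nonneg_pos\<close>)
qed

text \<open>The radius is at most every root, so its (mk)-th power is at most the norm of the k-th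
  power of \<Sigma>^m; take k-th roots and let k grow.\<close>

lemma joint_spectral_radius_power:
  assumes \<Sigma>: "nonneg_ops R \<Sigma> C" and m: "1 \<le> m"
  shows "joint_spectral_radius R \<Sigma> ^ m \<le> joint_spectral_radius R (set_power R \<Sigma> m)"
proof (rule LIMSEQ_le_const[OF joint_spectral_radius_tendsto[OF nonneg_ops_set_power[OF \<Sigma>]]])
  have "joint_spectral_radius R \<Sigma> ^ m
      \<le> set_norm R (set_power R (set_power R \<Sigma> m) k) powr (1 / real k)" if "k \<ge> 1" for k
  proof -
    have "joint_spectral_radius R \<Sigma> ^ m = (joint_spectral_radius R \<Sigma> ^ (m * k)) powr (1 / real k)"
      using that m joint_spectral_radius_nonneg[OF \<Sigma>]
      by (cases "joint_spectral_radius R \<Sigma> = 0")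
        (auto simp: powr_powr power_0_left simp flip: powr_realpow)
    also have "\<dots> \<le> set_norm R (set_power R \<Sigma> (m * k)) powr (1 / real k)"
      by (intro powr_mono2 joint_spectral_radius_power_le[OF \<Sigma>])
        (use that m in \<open>auto simp: joint_spectral_radius_nonneg[OF \<Sigma>]\<close>)
    finally show ?thesis by (simp add: set_power_mult[OF \<Sigma>])
  qed
  then show "\<exists>N. \<forall>k\<ge>N. joint_spectral_radius R \<Sigma> ^ m
      \<le> set_norm R (set_power R (set_power R \<Sigma> m) k) powr (1 / real k)" by blast
qed

section \<open>Hadamard products of sets of matrices\<close>

lemma nonneg_ops_set_hadamard:
  assumes "1 \<le> m" "1 / real m \<le> \<alpha>" "\<And>j. j \<in> {1..m} \<Longrightarrow> nonneg_ops R (\<Sigma> j) (C j)"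
  shows "nonneg_ops R (set_hadamard m (\<lambda>_. \<alpha>) \<Sigma>) (\<Prod>j=1..m. C j powr \<alpha>)"
  unfolding nonneg_ops_def
proof (intro conjI ballI)
  fix X assume "X \<in> set_hadamard m (\<lambda>_. \<alpha>) \<Sigma>"
  then obtain A where X: "X = hadamard m (\<lambda>_. \<alpha>) A" and A: "\<And>j. j \<in> {1..m} \<Longrightarrow> A j \<in> \<Sigma> j"
    unfolding set_hadamard_def by blast
  show "nonneg_op R X (\<Prod>j=1..m. C j powr \<alpha>)"
    unfolding X by (rule nonneg_op_hadamard[OF assms(1,2)]) (rule nonneg_opsD[OF assms(3) A])
qed (simp add: prod_nonneg)

lemma dominated_mul_set_hadamard:
  assumes m: "1 \<le> m" "1 / real m \<le> \<alpha>"
    and \<Sigma>: "\<And>j. j \<in> {1..m} \<Longrightarrow> nonneg_ops R (\<Sigma> j) (C j)"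
    and \<Phi>: "\<And>j. j \<in> {1..m} \<Longrightarrow> nonneg_ops R (\<Phi> j) (D j)"
  shows "dominated (set_mul R (set_hadamard m (\<lambda>_. \<alpha>) \<Sigma>) (set_hadamard m (\<lambda>_. \<alpha>) \<Phi>))
    (set_hadamard m (\<lambda>_. \<alpha>) (\<lambda>j. set_mul R (\<Sigma> j) (\<Phi> j)))"
  unfolding dominated_def
proof
  fix X assume "X \<in> set_mul R (set_hadamard m (\<lambda>_. \<alpha>) \<Sigma>) (set_hadamard m (\<lambda>_. \<alpha>) \<Phi>)"
  then obtain A B where AB: "\<And>j. j \<in> {1..m} \<Longrightarrow> A j \<in> \<Sigma> j" "\<And>j. j \<in> {1..m} \<Longrightarrow> B j \<in> \<Phi> j"
    and X: "X = mat_mul R (hadamard m (\<lambda>_. \<alpha>) A) (hadamard m (\<lambda>_. \<alpha>) B)"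
    unfolding set_mul_def set_hadamard_def by blast
  have "X i k \<le> hadamard m (\<lambda>_. \<alpha>) (\<lambda>j. mat_mul R (A j) (B j)) i k" for i k
    unfolding X
    by (rule mat_mul_hadamard_le[OF m nonneg_opsD[OF \<Sigma> AB(1)] nonneg_opsD[OF \<Phi> AB(2)]])
  moreover have "hadamard m (\<lambda>_. \<alpha>) (\<lambda>j. mat_mul R (A j) (B j))
      \<in> set_hadamard m (\<lambda>_. \<alpha>) (\<lambda>j. set_mul R (\<Sigma> j) (\<Phi> j))"
    using AB by (force simp: set_hadamard_def set_mul_def)
  ultimately show "\<exists>Y\<in>set_hadamard m (\<lambda>_. \<alpha>) (\<lambda>j. set_mul R (\<Sigma> j) (\<Phi> j)). \<forall>i k. X i k \<le> Y i k"
    by blast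
qed

lemma dominated_one_set_hadamard:
  assumes "1 \<le> m"
  shows "dominated {mat_one R} (set_hadamard m (\<lambda>_. \<alpha>) (\<lambda>_. {mat_one R}))"
proof -
  have "hadamard m (\<lambda>_. \<alpha>) (\<lambda>_. mat_one R) = mat_one R"
    using assms by (auto simp: hadamard_def mat_one_def fun_eq_iff)
  then show ?thesis by (force simp: dominated_def set_hadamard_def)
qed

text \<open>Iterates the two-factor inequality. The components \<Sigma> t j may change with
  \<open>t\<close>, because the cyclic argument rewrites each factor of a power with its own
  ordering of the Hadamard components.\<close>

lemma dominated_prod_set_hadamard:
  assumes m: "1 \<le> m" "1 / real m \<le> \<alpha>"
    and ops: "\<And>t j. t \<in> set ts \<Longrightarrow> j \<in> {1..m} \<Longrightarrow> nonneg_ops R (\<Sigma> t j) (C t j)"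
  shows "dominated (set_prod R (map (\<lambda>t. set_hadamard m (\<lambda>_. \<alpha>) (\<Sigma> t)) ts))
    (set_hadamard m (\<lambda>_. \<alpha>) (\<lambda>j. set_prod R (map (\<lambda>t. \<Sigma> t j) ts)))"
  using ops
proof (induction ts)
  case Nil
  then show ?case using dominated_one_set_hadamard[OF m(1)] by (simp add: set_prod_Nil)
next
  case (Cons t ts)
  have "\<exists>D. nonneg_ops R (set_prod R (map (\<lambda>t. \<Sigma> t j) ts)) D" if "j \<in> {1..m}" for j
    using Cons.prems that by (intro nonneg_ops_set_prod) auto
  then obtain D where D: "\<And>j. j \<in> {1..m} \<Longrightarrow> nonneg_ops R (set_prod R (map (\<lambda>t. \<Sigma> t j) ts)) (D j)"
    by metis
  have t: "nonneg_ops R (\<Sigma> t j) (C t j)" if "j \<in> {1..m}" for j using Cons.prems that by simp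
  have "\<exists>c. nonneg_ops R (set_prod R (map (\<lambda>t. set_hadamard m (\<lambda>_. \<alpha>) (\<Sigma> t)) ts)) c"
  proof (rule nonneg_ops_set_prod)
    fix \<Phi> assume "\<Phi> \<in> set (map (\<lambda>t. set_hadamard m (\<lambda>_. \<alpha>) (\<Sigma> t)) ts)"
    then obtain s where s: "s \<in> set ts" "\<Phi> = set_hadamard m (\<lambda>_. \<alpha>) (\<Sigma> s)" by auto
    have "nonneg_ops R \<Phi> (\<Prod>j=1..m. C s j powr \<alpha>)"
      unfolding s(2) by (rule nonneg_ops_set_hadamard[OF m]) (use Cons.prems s(1) in auto)
    then show "\<exists>C. nonneg_ops R \<Phi> C" ..
  qed
  then obtain c where c: "nonneg_ops R (set_prod R (map (\<lambda>t. set_hadamard m (\<lambda>_. \<alpha>) (\<Sigma> t)) ts)) c" ..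
  have "dominated (set_mul R (set_hadamard m (\<lambda>_. \<alpha>) (\<Sigma> t))
        (set_prod R (map (\<lambda>t. set_hadamard m (\<lambda>_. \<alpha>) (\<Sigma> t)) ts)))
      (set_mul R (set_hadamard m (\<lambda>_. \<alpha>) (\<Sigma> t))
        (set_hadamard m (\<lambda>_. \<alpha>) (\<lambda>j. set_prod R (map (\<lambda>t. \<Sigma> t j) ts))))"
    using Cons
    by (intro dominated_set_mul[OF nonneg_ops_set_hadamard[OF m t] nonneg_ops_set_hadamard[OF m t] c
          nonneg_ops_set_hadamard[OF m D]] dominated_refl) auto
  then show ?case
    unfolding list.map set_prod_Cons
    by (rule dominated_trans) (rule dominated_mul_set_hadamard[OF m t D])
qed

lemma dominated_power_set_hadamard:
  assumes "1 \<le> m" "1 / real m \<le> \<alpha>" "\<And>j. j \<in> {1..m} \<Longrightarrow> nonneg_ops R (\<Sigma> j) (C j)"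
  shows "dominated (set_power R (set_hadamard m (\<lambda>_. \<alpha>) \<Sigma>) k)
    (set_hadamard m (\<lambda>_. \<alpha>) (\<lambda>j. set_power R (\<Sigma> j) k))"
  \<comment> \<open>All factors agree, so only the length of the index list matters; a list of units
    provides it.\<close>
  using dominated_prod_set_hadamard[of m \<alpha> "replicate k ()" R "\<lambda>_. \<Sigma>" "\<lambda>_. C"] assms
  by (simp add: set_power_def)

text \<open>The k-th power of the Hadamard set is dominated by the Hadamard set of the k-th powers,
  whose norm is at most the product of the \<alpha>-th powers of the norms. Taking k-th roots
  commutes with this product, and the limits exist factor by factor.\<close>

lemma joint_spectral_radius_set_hadamard:
  assumes m: "1 \<le> m" "1 / real m \<le> \<alpha>"
    and \<Sigma>: "\<And>j. j \<in> {1..m} \<Longrightarrow> nonneg_ops R (\<Sigma> j) (C j)"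
  shows "joint_spectral_radius R (set_hadamard m (\<lambda>_. \<alpha>) \<Sigma>)
    \<le> (\<Prod>j=1..m. joint_spectral_radius R (\<Sigma> j) powr \<alpha>)"
proof (rule LIMSEQ_le[OF joint_spectral_radius_tendsto[OF nonneg_ops_set_hadamard[OF m \<Sigma>]]])
  let ?N = "\<lambda>j k. set_norm R (set_power R (\<Sigma> j) k)"
  have \<alpha>: "0 < \<alpha>" using m by (intro less_le_trans[OF _ m(2)]) simp
  show "(\<lambda>k. \<Prod>j=1..m. (?N j k powr (1 / real k)) powr \<alpha>) \<longlonglongrightarrow> (\<Prod>j=1..m. joint_spectral_radius R (\<Sigma> j) powr \<alpha>)"
    using \<alpha> by (intro tendsto_prod tendsto_powr2 joint_spectral_radius_tendsto[OF \<Sigma>] tendsto_const) auto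
  have "set_norm R (set_power R (set_hadamard m (\<lambda>_. \<alpha>) \<Sigma>) k) powr (1 / real k)
      \<le> (\<Prod>j=1..m. (?N j k powr (1 / real k)) powr \<alpha>)" for k
  proof -
    have N: "nonneg_ops R (set_power R (\<Sigma> j) k) (?N j k)" if "j \<in> {1..m}" for j
      by (rule nonneg_ops_set_norm[OF nonneg_ops_set_power[OF \<Sigma>[OF that]]])
    have "set_norm R (set_power R (set_hadamard m (\<lambda>_. \<alpha>) \<Sigma>) k)
        \<le> set_norm R (set_hadamard m (\<lambda>_. \<alpha>) (\<lambda>j. set_power R (\<Sigma> j) k))"
      by (rule set_norm_dominated[OF nonneg_ops_set_power[OF nonneg_ops_set_hadamard[OF m \<Sigma>]]
            nonneg_ops_set_hadamard[OF m N] dominated_power_set_hadamard[OF m \<Sigma>]])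
    also have "\<dots> \<le> (\<Prod>j=1..m. ?N j k powr \<alpha>)"
      by (intro set_norm_le nonneg_ops_set_hadamard m N)
    finally have "set_norm R (set_power R (set_hadamard m (\<lambda>_. \<alpha>) \<Sigma>) k) powr (1 / real k)
        \<le> (\<Prod>j=1..m. ?N j k powr \<alpha>) powr (1 / real k)"
      by (intro powr_mono2 set_norm_nonneg[OF nonneg_ops_set_power[OF nonneg_ops_set_hadamard[OF m \<Sigma>]]]) auto
    also have "\<dots> = (\<Prod>j=1..m. (?N j k powr (1 / real k)) powr \<alpha>)"
      by (subst prod_powr_distrib) (auto simp: powr_powr mult.commute)
    finally show ?thesis .
  qed
  then show "\<exists>N. \<forall>k\<ge>N. set_norm R (set_power R (set_hadamard m (\<lambda>_. \<alpha>) \<Sigma>) k) powr (1 / real k)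
      \<le> (\<Prod>j=1..m. (?N j k powr (1 / real k)) powr \<alpha>)" by blast
qed

section \<open>The spectral radius of a nonnegative matrix\<close>

definition mat_pow :: "nat set \<Rightarrow> rmat \<Rightarrow> nat \<Rightarrow> rmat" where
  "mat_pow R A k = (mat_mul R A ^^ k) (mat_one R)"

lemma set_mul_singleton: "set_mul R {A} {B} = {mat_mul R A B}"
  by (auto simp: set_mul_def)

lemma set_power_singleton: "set_power R {A} k = {mat_pow R A k}"
  by (induction k) (simp_all add: set_power_0 set_power_Suc mat_pow_def set_mul_singleton)

lemma nonneg_op_mat_pow:
  assumes "nonneg_op R A C"
  shows "nonneg_op R (mat_pow R A k) (set_norm R (set_power R {A} k))"
  using nonneg_opsD[OF nonneg_ops_set_norm[OF nonneg_ops_set_power[OF nonneg_ops_singleton[OF assms]]], of _ k]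
  by (simp add: set_power_singleton)

lemma mat_app_mat_pow_0: "i \<in> R \<Longrightarrow> mat_app R (mat_pow R A 0) x i = x i"
  by (simp add: mat_pow_def mat_app_one)

lemma mat_app_mat_pow_Suc:
  assumes "nonneg_op R A C"
  shows "mat_app R (mat_pow R A (Suc k)) x i = mat_app R A (mat_app R (mat_pow R A k) x) i"
  using mat_app_mat_mul[OF assms nonneg_op_mat_pow[OF assms, of k]] by (simp add: mat_pow_def)

lemma mat_app_mat_pow_add:
  assumes "nonneg_op R A C" "i \<in> R"
  shows "mat_app R (mat_pow R A (k + l)) x i = mat_app R (mat_pow R A k) (mat_app R (mat_pow R A l) x) i"
  using assms(2)
proof (induction k arbitrary: i)
  case (Suc k)
  show ?case
    unfolding add_Suc mat_app_mat_pow_Suc[OF assms(1)] by (rule mat_app_cong[OF Suc.IH])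
qed (simp add: mat_app_mat_pow_0)

section \<open>Resolvents as Neumann series\<close>

lemma set_norm_power_growth:
  assumes "nonneg_ops R \<Sigma> C" "joint_spectral_radius R \<Sigma> < t"
  obtains K where "0 < K" "\<And>k. set_norm R (set_power R \<Sigma> k) \<le> K * t ^ k"
proof -
  let ?N = "\<lambda>k. set_norm R (set_power R \<Sigma> k)"
  have t: "0 < t" using joint_spectral_radius_nonneg[OF assms(1)] assms(2) by simp
  have N: "0 \<le> ?N k" for k by (rule set_norm_nonneg[OF nonneg_ops_set_power[OF assms(1)]])
  obtain k0 where k0: "\<And>k. k \<ge> k0 \<Longrightarrow> ?N k \<le> t ^ k"
    using eventually_set_norm_power_le[OF assms] by (auto simp: eventually_sequentially)
  \<comment> \<open>The sum covers the finitely many k at which the eventual bound may still fail,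
    and \<open>K\<close> is at least 1 for the others.\<close>
  define K where "K = 1 + (\<Sum>k<k0. ?N k / t ^ k)"
  have K1: "1 \<le> K" unfolding K_def using N t by (simp add: sum_nonneg)
  have "?N k \<le> K * t ^ k" for k
  proof (cases "k \<ge> k0")
    case True
    have "t ^ k \<le> K * t ^ k" using K1 t by (simp add: mult_le_cancel_right1)
    then show ?thesis using k0[OF True] by simp
  next
    case False
    then have "?N k / t ^ k \<le> (\<Sum>k<k0. ?N k / t ^ k)"
      using N t by (intro member_le_sum) auto
    then have "?N k / t ^ k \<le> K" by (simp add: K_def)
    then show ?thesis using t by (simp add: divide_le_eq)
  qed
  then show thesis using that[of K] K1 by simp
qed

text \<open>The Neumann series of the inverse of t - A. For t above the joint radius of
  \<open>A\<close> it is again a nonnegative matrix and stays within the extended nonnegative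
  calculus.\<close>

definition resolvent_mat :: "nat set \<Rightarrow> rmat \<Rightarrow> real \<Rightarrow> rmat" where
  "resolvent_mat R A t = (\<lambda>i j. \<Sum>n. mat_pow R A n i j / t ^ Suc n)"

lemma
  assumes A: "nonneg_op R A C" and t: "joint_spectral_radius R {A} < t"
  shows nonneg_op_resolvent_mat: "\<exists>D. nonneg_op R (resolvent_mat R A t) D"
    and mat_app_resolvent_mat: "mat_app R (resolvent_mat R A t) x i
      = (\<Sum>n. ennreal (1 / t ^ Suc n) * mat_app R (mat_pow R A n) x i)"
proof -
  let ?P = "mat_pow R A"
  let ?N = "\<lambda>n. set_norm R (set_power R {A} n)"
  note sing = nonneg_ops_singleton[OF A]
  have t0: "0 < t" using joint_spectral_radius_nonneg[OF sing] t by simp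
  \<comment> \<open>A rate \<open>s\<close> strictly below \<open>t\<close> turns the growth bound
    into a convergent geometric majorant of ratio s / t.\<close>
  obtain s where s: "joint_spectral_radius R {A} < s" "s < t" using t dense by blast
  have s0: "0 < s" using joint_spectral_radius_nonneg[OF sing] s by simp
  obtain K where K: "0 < K" "\<And>k. ?N k \<le> K * s ^ k" using set_norm_power_growth[OF sing s(1)] by blast
  have P: "nonneg_op R (?P n) (?N n)" for n by (rule nonneg_op_mat_pow[OF A])
  have Pnn: "0 \<le> ?P n i j" for n i j by (rule nonneg_opD(1)[OF P])
  have Pout: "i \<notin> R \<or> j \<notin> R \<Longrightarrow> ?P n i j = 0" for n i j by (rule nonneg_opD(5)[OF P])
  have geo: "summable (\<lambda>n. K / t * (s / t) ^ n)"
    using s s0 by (intro summable_mult summable_geometric) simp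
  have Nle: "?N n / t ^ Suc n \<le> K / t * (s / t) ^ n" for n
    using divide_right_mono[OF K(2)[of n], of "t ^ Suc n"] t0 by (simp add: power_divide field_simps)
  have smN: "summable (\<lambda>n. ?N n / t ^ Suc n)"
    by (rule summable_comparison_test'[OF geo, of 0])
      (use Nle t0 nonneg_opD(3)[OF P] in simp)
  have smP: "summable (\<lambda>n. ?P n i j / t ^ Suc n)" for i j
  proof (cases "i \<in> R \<and> j \<in> R")
    case True
    have "?P n i j / t ^ Suc n \<le> ?N n / t ^ Suc n" for n
      using op_bound_entry[OF nonneg_opD(2)[OF P]] True t0 by (intro divide_right_mono) auto
    then show ?thesis
      by (intro summable_comparison_test'[OF smN, of 0]) (use Pnn t0 in simp)
  next
    case False
    then have "?P n i j = 0" for n using Pout by blast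
    then show ?thesis by simp
  qed
  have "op_bound R (resolvent_mat R A t) (\<Sum>n. ?N n / t ^ Suc n)"
    unfolding resolvent_mat_def
  proof (rule op_bound_suminf[OF _ smP _ smN])
    show "0 \<le> ?P n i j / t ^ Suc n" for n i j using Pnn t0 by simp
    show "op_bound R (\<lambda>i j. ?P n i j / t ^ Suc n) (?N n / t ^ Suc n)" for n
      using op_bound_scale[OF nonneg_opD(2)[OF P], of "1 / t ^ Suc n" n] t0 by simp
  qed
  moreover have "nonneg_matrix R (resolvent_mat R A t)"
    unfolding nonneg_matrix_def is_matrix_def resolvent_mat_def
    using t0 by (auto simp: Pout simp del: power_Suc intro!: suminf_nonneg smP divide_nonneg_nonneg Pnn)
  ultimately show "\<exists>D. nonneg_op R (resolvent_mat R A t) D" unfolding nonneg_op_def by blast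
  have "ennreal (resolvent_mat R A t i j) = (\<Sum>n. ennreal (1 / t ^ Suc n) * ennreal (?P n i j))" for j
    unfolding resolvent_mat_def
    by (subst suminf_ennreal2[symmetric]) (use t0 Pnn smP in \<open>auto simp: ennreal_mult[symmetric]\<close>)
  then have "mat_app R (resolvent_mat R A t) x i
      = (\<integral>\<^sup>+j. (\<Sum>n. ennreal (1 / t ^ Suc n) * (ennreal (?P n i j) * x j)) \<partial>count_space R)"
    unfolding mat_app_def by (simp add: mult.assoc[symmetric])
  also have "\<dots> = (\<Sum>n. ennreal (1 / t ^ Suc n) * mat_app R (?P n) x i)"
    unfolding mat_app_def by (subst nn_integral_suminf) (simp_all add: nn_integral_cmult)
  finally show "mat_app R (resolvent_mat R A t) x i
      = (\<Sum>n. ennreal (1 / t ^ Suc n) * mat_app R (?P n) x i)" .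
qed

lemma mat_app_suminf:
  "mat_app R A (\<lambda>j. \<Sum>n. x n j) i = (\<Sum>n. mat_app R A (x n) i)"
  unfolding mat_app_def by (subst nn_integral_suminf[symmetric]) simp_all

lemma resolvent_mat_eq:
  assumes A: "nonneg_op R A C" and t: "joint_spectral_radius R {A} < t" and i: "i \<in> R"
  shows "ennreal t * mat_app R (resolvent_mat R A t) x i
       = x i + mat_app R A (mat_app R (resolvent_mat R A t) x) i"
proof -
  let ?P = "\<lambda>n. mat_app R (mat_pow R A n) x"
  have t0: "0 < t" using joint_spectral_radius_nonneg[OF nonneg_ops_singleton[OF A]] t by simp
  have "ennreal t * mat_app R (resolvent_mat R A t) x i = (\<Sum>n. ennreal (1 / t ^ n) * ?P n i)"
    unfolding mat_app_resolvent_mat[OF A t] ennreal_suminf_cmult[symmetric] mult.assoc[symmetric]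
    using t0 by (simp add: ennreal_mult[symmetric])
  also have "\<dots> = x i + (\<Sum>n. ennreal (1 / t ^ Suc n) * ?P (Suc n) i)"
    using suminf_offset[of "\<lambda>n. ennreal (1 / t ^ n) * ?P n i" 1] i
    by (simp add: mat_app_mat_pow_0 summableI del: power_Suc)
  also have "(\<Sum>n. ennreal (1 / t ^ Suc n) * ?P (Suc n) i)
      = mat_app R A (\<lambda>j. \<Sum>n. ennreal (1 / t ^ Suc n) * ?P n j) i"
    by (simp add: mat_app_suminf mat_app_cmult mat_app_mat_pow_Suc[OF A])
  also have "(\<lambda>j. \<Sum>n. ennreal (1 / t ^ Suc n) * ?P n j) = mat_app R (resolvent_mat R A t) x"
    by (simp add: mat_app_resolvent_mat[OF A t] fun_eq_iff)
  finally show ?thesis .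
qed

text \<open>From (a + b)^2 \<le> 2a^2 + 2b^2. This crude form of the triangle inequality is good
  enough for the absorption argument in \<open>resolvent_bound\<close>.\<close>

lemma sq_norm_cabs_add:
  "sq_norm R (cabs (\<lambda>i. x i + y i)) \<le> 2 * sq_norm R (cabs x) + 2 * sq_norm R (cabs y)"
proof -
  have *: "(cabs (\<lambda>i. x i + y i) i)\<^sup>2 \<le> 2 * (cabs x i)\<^sup>2 + 2 * (cabs y i)\<^sup>2" for i
  proof -
    have "(cmod (x i + y i))\<^sup>2 \<le> (cmod (x i) + cmod (y i))\<^sup>2"
      by (intro power_mono norm_triangle_ineq) simp
    also have "\<dots> \<le> 2 * (cmod (x i))\<^sup>2 + 2 * (cmod (y i))\<^sup>2"
      using sum_squares_bound[of "cmod (x i)" "cmod (y i)"] by (simp add: power2_sum)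
    finally have "ennreal ((cmod (x i + y i))\<^sup>2) \<le> ennreal (2 * (cmod (x i))\<^sup>2 + 2 * (cmod (y i))\<^sup>2)"
      by (rule ennreal_leI)
    then show ?thesis by (simp add: ennreal_power ennreal_plus ennreal_mult)
  qed
  have "sq_norm R (cabs (\<lambda>i. x i + y i))
      \<le> (\<integral>\<^sup>+i. 2 * (cabs x i)\<^sup>2 + 2 * (cabs y i)\<^sup>2 \<partial>count_space R)"
    unfolding sq_norm_def by (intro nn_integral_mono *)
  also have "\<dots> = 2 * sq_norm R (cabs x) + 2 * sq_norm R (cabs y)"
    unfolding sq_norm_def by (simp add: nn_integral_add nn_integral_cmult)
  finally show ?thesis .
qed

lemma sq_norm_cabs_cmult: "sq_norm R (cabs (\<lambda>i. c * x i)) = (ennreal (cmod c))\<^sup>2 * sq_norm R (cabs x)"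
  unfolding sq_norm_cmult[symmetric] by (simp add: norm_mult ennreal_mult)

lemma l2_cmult: "x \<in> l2 R \<Longrightarrow> (\<lambda>i. c * x i) \<in> l2 R"
  unfolding l2_iff sq_norm_cabs_cmult by (auto simp: ennreal_mult_less_top power2_eq_square)

lemma mat_vec_add:
  assumes "nonneg_op R A C" "x \<in> l2 R" "y \<in> l2 R"
  shows "mat_vec R A (\<lambda>i. x i + y i) = (\<lambda>i. mat_vec R A x i + mat_vec R A y i)"
  unfolding mat_vec_def
  using mat_vec_summable[OF assms(1,2)] mat_vec_summable[OF assms(1,3)]
  by (simp add: distrib_left infsum_add)

lemma mat_vec_cmult: "mat_vec R A (\<lambda>i. c * x i) = (\<lambda>i. c * mat_vec R A x i)"
  unfolding mat_vec_def by (simp add: infsum_cmult_right'[symmetric] mult.left_commute)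

text \<open>The entrywise majorant compares the complex Neumann series term by term with the
  nonnegative one.\<close>

lemma mat_vec_pow:
  assumes A: "nonneg_op R A C" and x: "x \<in> l2 R"
  shows "(mat_vec R A ^^ n) x \<in> l2 R"
    and "i \<in> R \<Longrightarrow> cabs ((mat_vec R A ^^ n) x) i \<le> mat_app R (mat_pow R A n) (cabs x) i"
proof -
  have *: "(mat_vec R A ^^ n) x \<in> l2 R \<and>
      (\<forall>i\<in>R. cabs ((mat_vec R A ^^ n) x) i \<le> mat_app R (mat_pow R A n) (cabs x) i)"
  proof (induction n)
    case (Suc n)
    let ?y = "(mat_vec R A ^^ n) x"
    have "cabs (mat_vec R A ?y) i \<le> mat_app R (mat_pow R A (Suc n)) (cabs x) i" if "i \<in> R" for i
    proof -
      have "cabs (mat_vec R A ?y) i \<le> mat_app R A (cabs ?y) i"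
        using Suc by (intro cabs_mat_vec_le[OF A]) simp
      also have "\<dots> \<le> mat_app R A (mat_app R (mat_pow R A n) (cabs x)) i"
        using Suc by (intro mat_app_mono) auto
      finally show ?thesis by (simp add: mat_app_mat_pow_Suc[OF A])
    qed
    then show ?case using Suc mat_vec_in_l2[OF A, of ?y] by simp
  qed (simp add: x mat_app_mat_pow_0)
  then show "(mat_vec R A ^^ n) x \<in> l2 R"
    "i \<in> R \<Longrightarrow> cabs ((mat_vec R A ^^ n) x) i \<le> mat_app R (mat_pow R A n) (cabs x) i" by auto
qed

lemma mat_vec_pow_add:
  assumes "nonneg_op R A C" "x \<in> l2 R" "y \<in> l2 R"
  shows "(mat_vec R A ^^ n) (\<lambda>i. x i + y i)
    = (\<lambda>i. (mat_vec R A ^^ n) x i + (mat_vec R A ^^ n) y i)"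
  by (induction n) (simp_all add: mat_vec_add[OF assms(1)] mat_vec_pow[OF assms(1)] assms)

lemma mat_vec_pow_cmult:
  "(mat_vec R A ^^ n) (\<lambda>i. c * x i) = (\<lambda>i. c * (mat_vec R A ^^ n) x i)"
  by (induction n) (simp_all add: mat_vec_cmult)

lemma infsum_telescope:
  fixes a :: "nat \<Rightarrow> complex"
  assumes "(\<lambda>n. cmod (a n)) summable_on UNIV"
  shows "infsum a UNIV - infsum (\<lambda>n. a (Suc n)) UNIV = a 0"
proof -
  have "a summable_on UNIV" using assms by (rule abs_summable_summable)
  then have s: "a sums infsum a UNIV" using has_sum_imp_sums has_sum_infsum by blast
  have "a summable_on range Suc"
    using \<open>a summable_on UNIV\<close> by (rule summable_on_subset_banach) simp
  then have "(\<lambda>n. a (Suc n)) summable_on UNIV"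
    by (subst (asm) summable_on_reindex) (simp_all add: o_def)
  then have "(\<lambda>n. a (Suc n)) sums infsum (\<lambda>n. a (Suc n)) UNIV"
    using has_sum_imp_sums has_sum_infsum by blast
  moreover have "(\<lambda>n. a (Suc n)) sums (infsum a UNIV - a 0)" using s by (simp add: sums_Suc_iff)
  ultimately show ?thesis using sums_unique2 by force
qed

text \<open>The inverse is the Neumann series with terms T^n x / c^(n+1). In absolute value these
  are at most the terms of the nonnegative resolvent at |c|, applied to |x|; convergence,
  boundedness and the interchange of sums all follow from this one majorant.\<close>

lemma not_in_op_spectrum:
  assumes A: "nonneg_op R A C" and c: "joint_spectral_radius R {A} < cmod c"
  shows "c \<notin> op_spectrum R (mat_vec R A)"
proof -
  define t where "t = cmod c"
  have t: "joint_spectral_radius R {A} < t" using c by (simp add: t_def)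
  have t0: "0 < t" using joint_spectral_radius_nonneg[OF nonneg_ops_singleton[OF A]] t by simp
  then have c0: "c \<noteq> 0" by (auto simp: t_def)
  let ?T = "mat_vec R A" and ?G = "resolvent_mat R A t"
  obtain D where G: "nonneg_op R ?G D" using nonneg_op_resolvent_mat[OF A t] by blast
  define tm where "tm x n i = (?T ^^ n) x i / c ^ Suc n" for x n i
  define S where "S x i = (\<Sum>\<^sub>\<infinity>n. tm x n i)" for x i
  have bound: "(\<integral>\<^sup>+n. ennreal (cmod (tm x n i)) \<partial>count_space UNIV) \<le> mat_app R ?G (cabs x) i"
    if x: "x \<in> l2 R" and i: "i \<in> R" for x i
  proof -
    have "ennreal (cmod (tm x n i)) \<le> ennreal (1 / t ^ Suc n) * mat_app R (mat_pow R A n) (cabs x) i" for n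
    proof -
      have "ennreal (cmod (tm x n i)) = ennreal (1 / t ^ Suc n) * cabs ((?T ^^ n) x) i"
        using t0 by (simp add: tm_def norm_divide norm_power norm_mult t_def ennreal_mult[symmetric])
      also have "\<dots> \<le> ennreal (1 / t ^ Suc n) * mat_app R (mat_pow R A n) (cabs x) i"
        by (intro mult_left_mono mat_vec_pow(2)[OF A x i]) simp
      finally show ?thesis .
    qed
    then show ?thesis
      unfolding mat_app_resolvent_mat[OF A t] nn_integral_count_space_nat by (intro suminf_le) auto
  qed
  have out: "tm x n i = 0" if "x \<in> l2 R" "i \<notin> R" for x n i
    using mat_vec_pow(1)[OF A that(1), of n] that(2) by (simp add: tm_def l2_def)
  have fin: "(\<integral>\<^sup>+n. ennreal (cmod (tm x n i)) \<partial>count_space UNIV) < top" if x: "x \<in> l2 R" for x i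
  proof (cases "i \<in> R")
    case True
    then show ?thesis using bound[OF x True] mat_app_cabs_finite[OF G x] le_less_trans by blast
  qed (simp add: out[OF x])
  note sm = summable_nn_integral[OF fin] and asm = abs_summable_nn_integral[OF fin]
  have cabs_S: "cabs (S x) i \<le> mat_app R ?G (cabs x) i" if x: "x \<in> l2 R" and i: "i \<in> R" for x i
    unfolding S_def by (rule order_trans[OF cmod_infsum_le_nn_integral[OF fin[OF x]] bound[OF x i]])
  have sq_S: "sq_norm R (cabs (S x)) \<le> ennreal ((D * l2_norm R x)\<^sup>2)" if x: "x \<in> l2 R" for x
    by (rule order_trans[OF sq_norm_mono[OF cabs_S[OF x]] op_bound_app[OF nonneg_opD(2)[OF G]]])
      (simp_all add: l2_norm_nonneg sq_norm_l2[OF x])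
  have S_l2: "S x \<in> l2 R" if x: "x \<in> l2 R" for x
    unfolding l2_iff using le_less_trans[OF sq_S[OF x] ennreal_less_top]
    by (simp add: S_def out[OF x])
  have S_norm: "l2_norm R (S x) \<le> D * l2_norm R x" if x: "x \<in> l2 R" for x
    using sq_S[OF x] sq_norm_cabs_le_iff[OF S_l2[OF x], of "D * l2_norm R x"] nonneg_opD(3)[OF G]
    by (simp add: l2_norm_nonneg)
  have S_add: "S (\<lambda>i. x i + y i) = (\<lambda>i. S x i + S y i)" if x: "x \<in> l2 R" and y: "y \<in> l2 R" for x y
  proof
    fix i
    have "S (\<lambda>i. x i + y i) i = (\<Sum>\<^sub>\<infinity>n. tm x n i + tm y n i)"
      by (simp add: S_def tm_def mat_vec_pow_add[OF A x y] add_divide_distrib)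
    also have "\<dots> = S x i + S y i" unfolding S_def by (rule infsum_add[OF sm[OF x] sm[OF y]])
    finally show "S (\<lambda>i. x i + y i) i = S x i + S y i" .
  qed
  have S_cmult: "S (\<lambda>i. d * x i) = (\<lambda>i. d * S x i)" for d x
    by (rule ext) (simp add: S_def tm_def mat_vec_pow_cmult infsum_cmult_right'[symmetric])
  have tm_shift: "tm (?T x) n i = c * tm x (Suc n) i" for x n i
    using c0 by (simp add: tm_def funpow_swap1)
  have telescope: "c * S x i - (\<Sum>\<^sub>\<infinity>n. c * tm x (Suc n) i) = x i" if x: "x \<in> l2 R" for x i
  proof -
    have "(\<lambda>n. cmod (c * tm x n i)) summable_on UNIV"
      unfolding norm_mult by (intro summable_on_cmult_right asm[OF x])
    from infsum_telescope[OF this] show ?thesis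
      using c0 by (simp only: S_def infsum_cmult_right') (simp add: tm_def)
  qed
  \<comment> \<open>The operator is moved inside the series by interchanging two sums, which is
    legitimate because A G |x| has finite coordinates.\<close>
  have TS: "?T (S x) i = (\<Sum>\<^sub>\<infinity>n. c * tm x (Suc n) i)" if x: "x \<in> l2 R" for x i
  proof (cases "i \<in> R")
    case True
    let ?f = "\<lambda>j n. of_real (A i j) * tm x n j"
    have "(\<integral>\<^sup>+j. \<integral>\<^sup>+n. ennreal (cmod (?f j n)) \<partial>count_space UNIV \<partial>count_space R)
        = (\<integral>\<^sup>+j. ennreal (A i j) * (\<integral>\<^sup>+n. ennreal (cmod (tm x n j)) \<partial>count_space UNIV) \<partial>count_space R)"
      by (simp add: norm_mult ennreal_mult nonneg_opD(1)[OF A] nn_integral_cmult)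
    also have "\<dots> \<le> mat_app R A (mat_app R ?G (cabs x)) i"
      unfolding mat_app_def[of R A] by (intro nn_integral_mono mult_left_mono) (auto simp: bound[OF x])
    also have "\<dots> < top"
      using x by (intro finite_of_sq_norm[OF sq_norm_mat_app_finite[OF nonneg_opD(2)[OF A]
            sq_norm_mat_app_finite[OF nonneg_opD(2)[OF G]]] True]) (simp add: l2_iff)
    finally have swap: "infsum (\<lambda>j. infsum (?f j) UNIV) R = infsum (\<lambda>n. infsum (\<lambda>j. ?f j n) R) UNIV"
      by (rule infsum_swap_nn_integral)
    have "?T (S x) i = infsum (\<lambda>j. infsum (?f j) UNIV) R"
      by (simp add: mat_vec_def S_def infsum_cmult_right')
    also note swap
    also have "infsum (\<lambda>n. infsum (\<lambda>j. ?f j n) R) UNIV = (\<Sum>\<^sub>\<infinity>n. c * tm x (Suc n) i)"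
    proof (rule infsum_cong)
      fix n
      have "infsum (\<lambda>j. ?f j n) R = infsum (\<lambda>j. of_real (A i j) * (?T ^^ n) x j * (1 / c ^ Suc n)) R"
        by (simp add: tm_def)
      also have "\<dots> = ?T ((?T ^^ n) x) i / c ^ Suc n"
        by (subst infsum_cmult_left') (simp add: mat_vec_def)
      also have "\<dots> = c * tm x (Suc n) i" using c0 by (simp add: tm_def)
      finally show "infsum (\<lambda>j. ?f j n) R = c * tm x (Suc n) i" .
    qed
    finally show ?thesis .
  next
    case False
    then show ?thesis
      by (simp add: mat_vec_def out[OF x] nonneg_opD(5)[OF A])
  qed
  have "bounded_operator R S"
    unfolding bounded_operator_def using S_l2 S_add S_cmult S_norm by blast
  moreover have "S (\<lambda>i. c * x i - ?T x i) = x" if x: "x \<in> l2 R" for x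
  proof
    fix i
    have Tx: "?T x \<in> l2 R" by (rule mat_vec_in_l2[OF A x])
    \<comment> \<open>The difference is written as a sum with coefficient -1, so that additivity and
      homogeneity of \<open>S\<close> apply.\<close>
    have "S (\<lambda>i. c * x i + (- 1) * ?T x i) = (\<lambda>i. c * S x i + (- 1) * S (?T x) i)"
      by (simp only: S_add[OF l2_cmult[OF x] l2_cmult[OF Tx]] S_cmult)
    then have "S (\<lambda>i. c * x i - ?T x i) i = c * S x i - S (?T x) i"
      by (simp add: fun_eq_iff)
    also have "S (?T x) i = (\<Sum>\<^sub>\<infinity>n. c * tm x (Suc n) i)" by (simp add: S_def tm_shift)
    finally show "S (\<lambda>i. c * x i - ?T x i) i = x i" by (simp add: telescope[OF x])
  qed
  moreover have "(\<lambda>i. c * S x i - ?T (S x) i) = x" if x: "x \<in> l2 R" for x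
    by (simp add: TS[OF x] telescope[OF x])
  ultimately show ?thesis unfolding op_spectrum_def by blast
qed

text \<open>Let \<open>S\<close> invert L - T and let v solve (t - T)v = x. Then v = S(x - (t -
  L)v). If \<open>K\<close> bounds \<open>S\<close> and (t - L)K \<le> 1/2, the term with v on the
  right is absorbed on the left, uniformly as t approaches L. Only nonnegative x occur, as
  \<open>op_bound\<close> tests no others.\<close>

lemma resolvent_bound:
  assumes A: "nonneg_op R A C" and L: "L = joint_spectral_radius R {A}"
    and notin: "complex_of_real L \<notin> op_spectrum R (mat_vec R A)"
  obtains K where "0 < K"
    "\<And>t. L < t \<Longrightarrow> t \<le> L + 1 / (2 * K) \<Longrightarrow> op_bound R (resolvent_mat R A t) (2 * K)"
proof -
  let ?T = "mat_vec R A"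
  obtain S where S: "bounded_operator R S"
    and inv: "\<And>x. x \<in> l2 R \<Longrightarrow> S (\<lambda>i. of_real L * x i - ?T x i) = x"
    using notin unfolding op_spectrum_def by blast
  obtain C where C: "\<And>x. x \<in> l2 R \<Longrightarrow> l2_norm R (S x) \<le> C * l2_norm R x"
    using S unfolding bounded_operator_def by blast
  \<comment> \<open>The summand 1 makes \<open>K\<close> positive, so that 1 / (2 * K) is a positive
    distance from L.\<close>
  define K where "K = \<bar>C\<bar> + 1"
  have K: "0 < K" by (simp add: K_def)
  have S_l2: "S x \<in> l2 R" if "x \<in> l2 R" for x using S that unfolding bounded_operator_def by blast
  have SK: "l2_norm R (S x) \<le> K * l2_norm R x" if "x \<in> l2 R" for x
  proof -
    have "C * l2_norm R x \<le> K * l2_norm R x"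
      by (intro mult_right_mono l2_norm_nonneg) (simp add: K_def)
    then show ?thesis using C[OF that] by simp
  qed
  have "op_bound R (resolvent_mat R A t) (2 * K)" if t: "L < t" "t \<le> L + 1 / (2 * K)" for t
    unfolding op_bound_def
  proof (intro conjI allI impI)
    show "0 \<le> 2 * K" using K by simp
    fix x assume x1: "sq_norm R x \<le> 1"
    then have x_fin: "sq_norm R x < top" by (auto intro: le_less_trans)
    have tL: "joint_spectral_radius R {A} < t" using t L by simp
    have t0: "0 < t" using joint_spectral_radius_nonneg[OF nonneg_ops_singleton[OF A]] tL by simp
    obtain D where G: "nonneg_op R (resolvent_mat R A t) D" using nonneg_op_resolvent_mat[OF A tL] by blast
    let ?u = "mat_app R (resolvent_mat R A t) x"
    have u_fin: "sq_norm R ?u < top" by (rule sq_norm_mat_app_finite[OF nonneg_opD(2)[OF G] x_fin])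
    have Au_fin: "sq_norm R (mat_app R A ?u) < top"
      by (rule sq_norm_mat_app_finite[OF nonneg_opD(2)[OF A] u_fin])
    let ?x = "to_l2 R x" and ?v = "to_l2 R ?u"
    note x = to_l2_in_l2[OF x_fin] and v = to_l2_in_l2[OF u_fin]
    have eq: "of_real t * ?v i - ?T ?v i = ?x i" for i
    proof (cases "i \<in> R")
      case True
      have "enn2real (ennreal t * ?u i) = enn2real (x i + mat_app R A ?u i)"
        by (simp only: resolvent_mat_eq[OF A tL True])
      then have "t * enn2real (?u i) = enn2real (x i) + enn2real (mat_app R A ?u i)"
        using t0 finite_of_sq_norm[OF x_fin True] finite_of_sq_norm[OF Au_fin True]
        by (simp add: enn2real_mult enn2real_plus)
      then have "complex_of_real (t * enn2real (?u i))
          = complex_of_real (enn2real (x i) + enn2real (mat_app R A ?u i))" by (rule arg_cong)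
      then show ?thesis using True
        by (simp add: mat_vec_to_l2[OF A u_fin]) (simp add: to_l2_def)
    qed (simp add: mat_vec_to_l2[OF A u_fin], simp add: to_l2_def)
    define d where "d = t - L"
    have d: "0 < d" "d * K \<le> 1 / 2" using t K by (simp_all add: d_def field_simps)
    have "(\<lambda>i. of_real L * ?v i - ?T ?v i) = (\<lambda>i. ?x i + (- of_real d) * ?v i)"
      using eq by (simp add: d_def algebra_simps fun_eq_iff)
    then have "?v = S (\<lambda>i. ?x i + (- of_real d) * ?v i)" using inv[OF v] by simp
    also have "\<dots> = (\<lambda>i. S ?x i + (- of_real d) * S ?v i)"
      using S x v l2_cmult[OF v] unfolding bounded_operator_def by metis
    finally have veq: "?v = (\<lambda>i. S ?x i + (- of_real d) * S ?v i)" .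
    have "ennreal ((l2_norm R ?v)\<^sup>2) = sq_norm R (cabs (\<lambda>i. S ?x i + (- of_real d) * S ?v i))"
      using arg_cong[OF veq, of "\<lambda>z. sq_norm R (cabs z)"] sq_norm_l2[OF v] by (simp only:)
    also have "\<dots> \<le> 2 * sq_norm R (cabs (S ?x)) + 2 * ((ennreal (cmod (- of_real d)))\<^sup>2 * sq_norm R (cabs (S ?v)))"
      by (rule order_trans[OF sq_norm_cabs_add]) (simp only: sq_norm_cabs_cmult order_refl)
    also have "\<dots> = ennreal (2 * (l2_norm R (S ?x))\<^sup>2 + 2 * (d\<^sup>2 * (l2_norm R (S ?v))\<^sup>2))"
      using d by (simp add: sq_norm_l2 S_l2 x v ennreal_power ennreal_mult ennreal_plus)
    finally have "(l2_norm R ?v)\<^sup>2 \<le> 2 * (l2_norm R (S ?x))\<^sup>2 + 2 * (d\<^sup>2 * (l2_norm R (S ?v))\<^sup>2)"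
      by (subst (asm) ennreal_le_iff) auto
    also have "\<dots> \<le> 2 * (K * 1)\<^sup>2 + 2 * (d\<^sup>2 * (K * l2_norm R ?v)\<^sup>2)"
    proof -
      have "l2_norm R (S ?x) \<le> K * 1"
        using l2_norm_to_l2[of R x 1] x1 K by (intro order_trans[OF SK[OF x]] mult_left_mono) auto
      then have "(l2_norm R (S ?x))\<^sup>2 \<le> (K * 1)\<^sup>2"
        by (rule power_mono) (rule l2_norm_nonneg)
      moreover have "(l2_norm R (S ?v))\<^sup>2 \<le> (K * l2_norm R ?v)\<^sup>2"
        by (rule power_mono[OF SK[OF v] l2_norm_nonneg])
      then have "d\<^sup>2 * (l2_norm R (S ?v))\<^sup>2 \<le> d\<^sup>2 * (K * l2_norm R ?v)\<^sup>2"
        by (rule mult_left_mono) simp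
      ultimately show ?thesis by linarith
    qed
    also have "\<dots> = 2 * K\<^sup>2 + 2 * ((d * K)\<^sup>2 * (l2_norm R ?v)\<^sup>2)" by (simp add: power_mult_distrib)
    \<comment> \<open>The last summand is now half of the left-hand side; absorbing it leaves
      4K^2.\<close>
    also have "\<dots> \<le> 2 * K\<^sup>2 + 2 * ((1 / 2)\<^sup>2 * (l2_norm R ?v)\<^sup>2)"
      using d K by (intro add_left_mono mult_left_mono mult_right_mono power_mono) auto
    finally have "(l2_norm R ?v)\<^sup>2 \<le> (2 * K)\<^sup>2" by (simp add: power2_eq_square)
    then have "l2_norm R ?v \<le> 2 * K" by (rule power2_le_imp_le) (use K in simp)
    then show "sq_norm R ?u \<le> ennreal ((2 * K)\<^sup>2)"
      using sq_norm_cabs_le_iff[OF v, of "2 * K"] sq_norm_to_l2[OF u_fin] K by simp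
  qed
  then show thesis using that[OF K] by blast
qed

text \<open>
  If \<open>L = lim \<parallel>A\<^sup>n\<parallel>\<^sup>1\<^sup>/\<^sup>n\<close> were not in the spectrum, the resolvents at \<open>t > L\<close> would be bounded by some
  \<open>M\<close> as \<open>t\<close> tends to \<open>L\<close>. The square of the resolvent dominates its single term
  \<open>(n + 1) A\<^sup>n / t\<^sup>n\<^sup>+\<^sup>2\<close>, and \<open>L\<^sup>n \<le> \<parallel>A\<^sup>n\<parallel>\<close>; hence \<open>n + 1 \<le> M\<^sup>2L\<^sup>2\<close> for all \<open>n\<close>. The case \<open>n = 0\<close> shows
  \<open>L > 0\<close>, which is needed to cancel \<open>L\<^sup>n\<close>.
\<close>

lemma joint_spectral_radius_in_op_spectrum:
  assumes A: "nonneg_op R A C" and R: "R \<noteq> {}"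
  shows "complex_of_real (joint_spectral_radius R {A}) \<in> op_spectrum R (mat_vec R A)"
proof (rule ccontr)
  define L where "L = joint_spectral_radius R {A}"
  let ?N = "\<lambda>n. set_norm R (set_power R {A} n)"
  note sing = nonneg_ops_singleton[OF A]
  have L0: "0 \<le> L" unfolding L_def by (rule joint_spectral_radius_nonneg[OF sing])
  assume "complex_of_real (joint_spectral_radius R {A}) \<notin> op_spectrum R (mat_vec R A)"
  then obtain K where K: "0 < K"
    and bd: "\<And>t. L < t \<Longrightarrow> t \<le> L + 1 / (2 * K) \<Longrightarrow> op_bound R (resolvent_mat R A t) (2 * K)"
    using resolvent_bound[OF A L_def] unfolding L_def by blast
  define M where "M = 2 * K"
  have M: "0 < M" using K by (simp add: M_def)
  have N_ge: "L ^ n \<le> ?N n" for n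
  proof (cases "n = 0")
    \<comment> \<open>There is no root estimate at n = 0. Here the identity matrix has norm at least
      1 because \<open>R\<close> is nonempty.\<close>
    case True
    obtain i where i: "i \<in> R" using R by blast
    have "nonneg_op R (mat_one R) (?N 0)" using nonneg_op_mat_pow[OF A, of 0] by (simp add: mat_pow_def)
    then have "mat_one R i i \<le> ?N 0" using i by (intro op_bound_entry[OF nonneg_opD(2)])
    then show ?thesis using True i by (simp add: mat_one_def)
  qed (simp add: L_def joint_spectral_radius_power_le[OF sing])
  have key: "real (Suc n) * L ^ n \<le> M\<^sup>2 * t ^ (n + 2)" if t: "L < t" "t \<le> L + 1 / M" for n t
  proof -
    have t0: "0 < t" using t L0 by simp
    have tL: "joint_spectral_radius R {A} < t" using t by (simp add: L_def)
    let ?G = "resolvent_mat R A t" and ?P = "mat_pow R A"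
    let ?w = "\<lambda>n. ennreal (1 / t ^ Suc n)"
    have G: "op_bound R ?G M" using bd[of t] t by (simp add: M_def)
    have lower: "ennreal (real (Suc n) / t ^ (n + 2)) * mat_app R (?P n) x i \<le> mat_app R ?G (mat_app R ?G x) i"
      if i: "i \<in> R" for x i
    proof -
      have one: "?w b * mat_app R (?P b) x j \<le> mat_app R ?G x j" for b j x
        unfolding mat_app_resolvent_mat[OF A tL]
        using sum_le_suminf[of "\<lambda>n. ?w n * mat_app R (?P n) x j" "{b}"] by (simp add: summableI)
      \<comment> \<open>Each of the n + 1 splittings n = a + (n - a) contributes the same weight,
        t^-(a+1) times t^-(n-a+1), that is t^-(n+2).\<close>
      have "ennreal (real (Suc n) / t ^ (n + 2)) * mat_app R (?P n) x i
          = (\<Sum>a\<le>n. ?w a * ?w (n - a) * mat_app R (?P n) x i)"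
      proof -
        have "?w a * ?w (n - a) = ennreal (1 / t ^ (n + 2))" if "a \<le> n" for a
          using t0 that by (simp add: ennreal_mult[symmetric] power_add[symmetric] flip: power_Suc)
        then have "(\<Sum>a\<le>n. ?w a * ?w (n - a) * mat_app R (?P n) x i)
            = (\<Sum>a\<le>n. ennreal (1 / t ^ (n + 2)) * mat_app R (?P n) x i)"
          by (intro sum.cong) auto
        also have "\<dots> = (of_nat (Suc n) * ennreal (1 / t ^ (n + 2))) * mat_app R (?P n) x i"
          by (simp add: mult.assoc)
        also have "of_nat (Suc n) * ennreal (1 / t ^ (n + 2)) = ennreal (real (Suc n) / t ^ (n + 2))"
          unfolding ennreal_of_nat_eq_real_of_nat using t0 by (subst ennreal_mult[symmetric]) auto
        finally show ?thesis by simp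
      qed
      also have "\<dots> \<le> (\<Sum>a\<le>n. ?w a * mat_app R (?P a) (mat_app R ?G x) i)"
      proof (rule sum_mono)
        fix a assume "a \<in> {..n}"
        then have "mat_app R (?P n) x i = mat_app R (?P a) (mat_app R (?P (n - a)) x) i"
          using mat_app_mat_pow_add[OF A i, of a "n - a" x] by simp
        then have "?w a * ?w (n - a) * mat_app R (?P n) x i
            = ?w a * mat_app R (?P a) (\<lambda>j. ?w (n - a) * mat_app R (?P (n - a)) x j) i"
          by (simp add: mat_app_cmult mult.assoc)
        also have "\<dots> \<le> ?w a * mat_app R (?P a) (mat_app R ?G x) i"
          by (intro mult_left_mono mat_app_mono one) auto
        finally show "?w a * ?w (n - a) * mat_app R (?P n) x i
            \<le> ?w a * mat_app R (?P a) (mat_app R ?G x) i" .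
      qed
      also have "\<dots> \<le> mat_app R ?G (mat_app R ?G x) i"
        unfolding mat_app_resolvent_mat[OF A tL, of "mat_app R ?G x"]
        by (intro sum_le_suminf summableI) auto
      finally show ?thesis .
    qed
    define q where "q = real (Suc n) / t ^ (n + 2)"
    have q: "0 < q" using t0 by (simp add: q_def)
    have "op_bound R (\<lambda>i j. q * ?P n i j) (M * M)"
      unfolding op_bound_def
    proof (intro conjI allI impI)
      fix x assume x: "sq_norm R x \<le> 1"
      have "mat_app R (\<lambda>i j. q * ?P n i j) x i = ennreal q * mat_app R (?P n) x i" for i
        unfolding mat_app_def using q by (subst nn_integral_cmult[symmetric]) (auto simp: ennreal_mult' mult.assoc)
      then have "sq_norm R (mat_app R (\<lambda>i j. q * ?P n i j) x) \<le> sq_norm R (mat_app R ?G (mat_app R ?G x))"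
        using lower by (intro sq_norm_mono) (simp add: q_def)
      also have "\<dots> \<le> ennreal ((M * M)\<^sup>2)"
        using G x M by (intro op_bound_app[OF G]) (auto simp: op_bound_def)
      finally show "sq_norm R (mat_app R (\<lambda>i j. q * ?P n i j) x) \<le> ennreal ((M * M)\<^sup>2)" .
    qed (use M in simp)
    from op_bound_scale[OF this, of "1 / q"] q
    have "op_bound R (?P n) (M * M / q)" by simp
    then have "nonneg_op R (?P n) (M * M / q)"
      using nonneg_op_mat_pow[OF A, of n] by (simp add: nonneg_op_def)
    then have "?N n \<le> M * M / q"
      by (intro set_norm_le) (simp add: set_power_singleton nonneg_ops_singleton)
    then have "L ^ n \<le> M * M / q" using N_ge[of n] by simp
    then have "L ^ n * q \<le> M * M" using q by (simp add: le_divide_eq)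
    then show ?thesis using t0 by (simp add: q_def field_simps power2_eq_square)
  qed
  \<comment> \<open>\<open>M\<close> does not depend on t, so the estimate survives the limit as t
    decreases to L.\<close>
  have key': "real (Suc n) * L ^ n \<le> M\<^sup>2 * L ^ (n + 2)" for n
  proof (rule tendsto_lowerbound)
    show "((\<lambda>t. M\<^sup>2 * t ^ (n + 2)) \<longlongrightarrow> M\<^sup>2 * L ^ (n + 2)) (at_right L)"
      by (intro tendsto_intros)
    have "\<forall>\<^sub>F t in at_right L. t \<in> {L<..<L + 1 / M}"
      using M by (intro eventually_at_right_real) simp
    then show "\<forall>\<^sub>F t in at_right L. real (Suc n) * L ^ n \<le> M\<^sup>2 * t ^ (n + 2)"
      by eventually_elim (use key in auto)
  qed simp
  have "L \<noteq> 0" using key'[of 0] by auto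
  then have Lp: "0 < L" using L0 by simp
  have "real (Suc n) \<le> M\<^sup>2 * L\<^sup>2" for n
  proof -
    have "real (Suc n) * L ^ n \<le> (M\<^sup>2 * L\<^sup>2) * L ^ n" using key'[of n] by (simp add: power_add power2_eq_square mult_ac)
    then show ?thesis using Lp by (subst (asm) mult_le_cancel_right_pos) auto
  qed
  moreover obtain n where "M\<^sup>2 * L\<^sup>2 < real n" using reals_Archimedean2 by blast
  ultimately have "real (Suc n) < real n" by (meson le_less_trans)
  then show False by simp
qed

text \<open>The joint radius lies in the spectrum and bounds its moduli, so the supremum is a
  maximum. For empty \<open>R\<close> the spectrum would be empty and the supremum
  unspecified.\<close>

theorem op_spectral_radius_eq:
  assumes A: "nonneg_op R A C" and R: "R \<noteq> {}"
  shows "op_spectral_radius R (mat_vec R A) = joint_spectral_radius R {A}"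
proof (rule antisym)
  let ?L = "joint_spectral_radius R {A}"
  have le: "cmod c \<le> ?L" if "c \<in> op_spectrum R (mat_vec R A)" for c
    using not_in_op_spectrum[OF A, of c] that by force
  note L = joint_spectral_radius_in_op_spectrum[OF A R]
  show "op_spectral_radius R (mat_vec R A) \<le> ?L"
    unfolding op_spectral_radius_def using L le by (intro cSUP_least) auto
  have "cmod (of_real ?L) \<le> op_spectral_radius R (mat_vec R A)"
    unfolding op_spectral_radius_def using L le by (intro cSUP_upper bdd_aboveI2) auto
  then show "?L \<le> op_spectral_radius R (mat_vec R A)"
    by (simp add: joint_spectral_radius_nonneg[OF nonneg_ops_singleton[OF A]])
qed

section \<open>Norms and self-adjoint products\<close>

text \<open>The form of AA* at (x, x) is the squared norm of A*x; this bounds the norm of A*, which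
  has the same bounds as A.\<close>

lemma op_norm_square_le:
  assumes A: "nonneg_op R A C"
  shows "(mat_norm R A)\<^sup>2 \<le> mat_norm R (mat_mul R A (transpose_mat A))"
proof -
  let ?D = "mat_norm R (mat_mul R A (transpose_mat A))"
  note At = nonneg_op_transpose[OF A]
  have D: "nonneg_op R (mat_mul R A (transpose_mat A)) ?D"
    by (rule nonneg_op_op_norm[OF nonneg_op_mat_mul[OF A At]])
  have D0: "0 \<le> ?D" by (rule nonneg_opD(3)[OF D])
  have "op_bound R (transpose_mat A) (sqrt ?D)"
    unfolding op_bound_def
  proof (intro conjI allI impI)
    fix x assume x: "sq_norm R x \<le> 1"
    let ?y = "mat_app R (transpose_mat A) x"
    have "sq_norm R ?y = (\<integral>\<^sup>+i. ?y i * ?y i \<partial>count_space R)"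
      by (simp add: sq_norm_def power2_eq_square)
    also have "\<dots> = (\<integral>\<^sup>+i. mat_app R A ?y i * x i \<partial>count_space R)" by (rule form_transpose)
    also have "\<dots> = (\<integral>\<^sup>+i. mat_app R (mat_mul R A (transpose_mat A)) x i * x i \<partial>count_space R)"
      by (simp add: mat_app_mat_mul[OF A At])
    also have "\<dots> \<le> ennreal ?D" by (rule op_bound_imp_form_le[OF nonneg_opD(2)[OF D] x x])
    finally show "sq_norm R ?y \<le> ennreal ((sqrt ?D)\<^sup>2)" using D0 by simp
  qed (simp add: D0)
  then have "op_bound R A (sqrt ?D)" using op_bound_transpose[of R "transpose_mat A"] by simp
  then have "mat_norm R A \<le> sqrt ?D"
    using nonneg_opD(4)[OF A] by (intro op_norm_le) (simp add: nonneg_op_def)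
  then have "(mat_norm R A)\<^sup>2 \<le> (sqrt ?D)\<^sup>2"
    using op_norm_nonneg[OF A] by (rule power_mono)
  then show ?thesis using D0 by simp
qed

lemma mat_pow_add:
  assumes "nonneg_op R A C"
  shows "mat_pow R A (k + l) = mat_mul R (mat_pow R A k) (mat_pow R A l)"
  using set_power_add[OF nonneg_ops_singleton[OF assms], of k l]
  by (simp add: set_power_singleton set_mul_singleton)

text \<open>For symmetric T the previous inequality reads ||T||^2 \<le> ||T^2||. Repeated squaring
  gives it for all exponents 2^n, with symmetry of the powers carried along in the induction; the
  roots converge along this subsequence.\<close>

lemma op_norm_le_joint_spectral_radius_symmetric:
  assumes T: "nonneg_op R T C" and sym: "transpose_mat T = T"
  shows "mat_norm R T \<le> joint_spectral_radius R {T}"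
proof -
  let ?P = "mat_pow R T"
  have P: "nonneg_op R (?P k) (set_norm R (set_power R {T} k))" for k by (rule nonneg_op_mat_pow[OF T])
  have N: "set_norm R (set_power R {T} k) = mat_norm R (?P k)" for k
    unfolding set_power_singleton by (rule set_norm_singleton[OF P])
  have *: "transpose_mat (?P (2 ^ n)) = ?P (2 ^ n) \<and> mat_norm R T ^ 2 ^ n \<le> mat_norm R (?P (2 ^ n))" for n
  proof (induction n)
    case 0
    have "?P 1 = T" by (simp add: mat_pow_def mat_mul_one_right[OF T])
    then show ?case using sym by simp
  next
    case (Suc n)
    let ?S = "?P (2 ^ n)"
    have S: "transpose_mat ?S = ?S" using Suc by blast
    have sq: "?P (2 ^ Suc n) = mat_mul R ?S ?S" using mat_pow_add[OF T, of "2 ^ n" "2 ^ n"] by (simp add: mult_2)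
    have "?S i j = ?S j i" for i j using fun_cong[OF fun_cong[OF S, of j], of i] .
    then have "mat_mul R ?S ?S i k = mat_mul R ?S ?S k i" for i k
      unfolding mat_mul_def by (intro infsum_cong) (metis mult.commute)
    then have "transpose_mat (mat_mul R ?S ?S) = mat_mul R ?S ?S" by (simp add: fun_eq_iff)
    moreover have "mat_norm R T ^ 2 ^ Suc n \<le> mat_norm R (mat_mul R ?S ?S)"
    proof -
      have "mat_norm R T ^ 2 ^ Suc n = (mat_norm R T ^ 2 ^ n)\<^sup>2" by (simp add: power_mult[symmetric] mult.commute)
      also have "\<dots> \<le> (mat_norm R ?S)\<^sup>2"
        using Suc op_norm_nonneg[OF T] by (intro power_mono) auto
      also have "\<dots> \<le> mat_norm R (mat_mul R ?S ?S)" using op_norm_square_le[OF P, of "2 ^ n"] unfolding S .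
      finally show ?thesis .
    qed
    ultimately show ?case by (simp only: sq)
  qed
  have "mat_norm R T \<le> set_norm R (set_power R {T} (2 ^ n)) powr (1 / real (2 ^ n))" for n
  proof -
    have "mat_norm R T = (mat_norm R T ^ 2 ^ n) powr (1 / real (2 ^ n))"
      using op_norm_nonneg[OF T]
      by (cases "mat_norm R T = 0") (auto simp: powr_powr simp flip: powr_realpow)
    also have "\<dots> \<le> set_norm R (set_power R {T} (2 ^ n)) powr (1 / real (2 ^ n))"
      unfolding N using * op_norm_nonneg[OF T] by (intro powr_mono2) auto
    finally show ?thesis .
  qed
  moreover have "strict_mono (\<lambda>n. 2 ^ n :: nat)" by (simp add: strict_mono_def)
  note LIMSEQ_subseq_LIMSEQ[OF joint_spectral_radius_tendsto[OF nonneg_ops_singleton[OF T]] this]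
  ultimately show ?thesis by (intro LIMSEQ_le_const[of _ _ "mat_norm R T"]) (auto simp: o_def)
qed

lemma op_norm_square_le_joint_spectral_radius:
  assumes A: "nonneg_op R A C"
  shows "(mat_norm R A)\<^sup>2 \<le> joint_spectral_radius R {mat_mul R A (transpose_mat A)}"
proof -
  have "transpose_mat (mat_mul R A (transpose_mat A)) = mat_mul R A (transpose_mat A)"
    by (simp add: mat_mul_def mult.commute)
  from op_norm_le_joint_spectral_radius_symmetric[OF nonneg_op_mat_mul[OF A nonneg_op_transpose[OF A]] this]
  show ?thesis using op_norm_square_le[OF A] by simp
qed

section \<open>The generalized spectral radius\<close>

lemma joint_spectral_radius_member_le:
  assumes "nonneg_ops R \<Sigma> C" "A \<in> \<Sigma>"
  shows "joint_spectral_radius R {A} \<le> joint_spectral_radius R \<Sigma>"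
  by (rule joint_spectral_radius_dominated[OF nonneg_ops_singleton[OF nonneg_opsD[OF assms]] assms(1)])
    (use assms(2) in \<open>auto simp: dominated_def\<close>)

lemma joint_spectral_radius_le_set_norm:
  assumes "nonneg_ops R \<Sigma> C"
  shows "joint_spectral_radius R \<Sigma> \<le> set_norm R \<Sigma>"
  using joint_spectral_radius_power_le[OF assms, of 1] set_power_1[OF assms] by simp

lemma set_sup_radius_eq:
  assumes "nonneg_ops R \<Sigma> C" "R \<noteq> {}"
  shows "set_sup_radius R \<Sigma> = Sup (insert 0 ((\<lambda>A. joint_spectral_radius R {A}) ` \<Sigma>))"
proof -
  have "(\<lambda>A. op_spectral_radius R (mat_vec R A)) ` \<Sigma> = (\<lambda>A. joint_spectral_radius R {A}) ` \<Sigma>"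
    by (intro image_cong refl op_spectral_radius_eq[OF nonneg_opsD[OF assms(1)] assms(2)])
  then show ?thesis by (simp add: set_sup_radius_def)
qed

lemma set_sup_radius_least:
  assumes "nonneg_ops R \<Sigma> C" "R \<noteq> {}" "0 \<le> c" "\<And>A. A \<in> \<Sigma> \<Longrightarrow> joint_spectral_radius R {A} \<le> c"
  shows "set_sup_radius R \<Sigma> \<le> c"
  unfolding set_sup_radius_eq[OF assms(1,2)] using assms(3,4) by (intro cSup_least) auto

lemma
  assumes \<Sigma>: "nonneg_ops R \<Sigma> C" and R: "R \<noteq> {}"
  shows set_sup_radius_upper: "A \<in> \<Sigma> \<Longrightarrow> joint_spectral_radius R {A} \<le> set_sup_radius R \<Sigma>"
    and set_sup_radius_nonneg: "0 \<le> set_sup_radius R \<Sigma>"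
    and set_sup_radius_le: "set_sup_radius R \<Sigma> \<le> C"
proof -
  have le: "joint_spectral_radius R {A} \<le> C" if "A \<in> \<Sigma>" for A
    using joint_spectral_radius_member_le[OF \<Sigma> that] joint_spectral_radius_le_set_norm[OF \<Sigma>]
      set_norm_le[OF \<Sigma>] by simp
  then show "set_sup_radius R \<Sigma> \<le> C"
    using nonneg_opsD_nonneg[OF \<Sigma>] by (intro set_sup_radius_least[OF \<Sigma> R])
  have bdd: "bdd_above (insert 0 ((\<lambda>A. joint_spectral_radius R {A}) ` \<Sigma>))"
    using le by (intro bdd_aboveI[of _ "max 0 C"]) (auto simp: le_max_iff_disj)
  show "A \<in> \<Sigma> \<Longrightarrow> joint_spectral_radius R {A} \<le> set_sup_radius R \<Sigma>" "0 \<le> set_sup_radius R \<Sigma>"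
    unfolding set_sup_radius_eq[OF \<Sigma> R] by (auto intro: cSup_upper[OF _ bdd])
qed

abbreviation radius_root :: "nat set \<Rightarrow> rmat set \<Rightarrow> nat \<Rightarrow> real" where
  "radius_root R \<Sigma> k \<equiv> set_sup_radius R (set_power R \<Sigma> k) powr (1 / real k)"

lemma radius_root_le:
  assumes \<Sigma>: "nonneg_ops R \<Sigma> C" and R: "R \<noteq> {}" and k: "1 \<le> k"
  shows "radius_root R \<Sigma> k \<le> C"
proof -
  note P = nonneg_ops_set_power[OF \<Sigma>, of k]
  have "radius_root R \<Sigma> k \<le> (C ^ k) powr (1 / real k)"
    by (intro powr_mono2 set_sup_radius_le[OF P R] set_sup_radius_nonneg[OF P R]) simp
  also have "\<dots> = C"
    using k nonneg_opsD_nonneg[OF \<Sigma>]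
    by (cases "C = 0") (auto simp: powr_powr simp flip: powr_realpow)
  finally show ?thesis .
qed

text \<open>From index 1 on the roots lie in [0, C], so the limsup is finite and
  \<open>real_of_ereal\<close> discards nothing.\<close>

lemma
  assumes \<Sigma>: "nonneg_ops R \<Sigma> C" and R: "R \<noteq> {}"
  shows gen_spectral_radius_limsup:
      "ereal (gen_spectral_radius R \<Sigma>) = limsup (\<lambda>k. ereal (radius_root R \<Sigma> k))"
    and gen_spectral_radius_nonneg: "0 \<le> gen_spectral_radius R \<Sigma>"
proof -
  let ?l = "limsup (\<lambda>k. ereal (radius_root R \<Sigma> k))"
  have "?l \<le> ereal C"
    by (rule Limsup_bounded) (use radius_root_le[OF \<Sigma> R] in \<open>auto intro!: eventually_sequentiallyI[of 1]\<close>)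
  moreover have ge: "0 \<le> ?l"
    by (rule le_Limsup) auto
  ultimately show "ereal (gen_spectral_radius R \<Sigma>) = ?l"
    unfolding gen_spectral_radius_def by (intro ereal_real') auto
  with ge show "0 \<le> gen_spectral_radius R \<Sigma>" by (metis ereal_less_eq(3) zero_ereal_def)
qed

lemma gen_spectral_radius_leI:
  assumes "nonneg_ops R \<Sigma> C" "R \<noteq> {}" "\<forall>\<^sub>F k in sequentially. radius_root R \<Sigma> k \<le> c"
  shows "gen_spectral_radius R \<Sigma> \<le> c"
proof -
  have "ereal (gen_spectral_radius R \<Sigma>) \<le> ereal c"
    unfolding gen_spectral_radius_limsup[OF assms(1,2)]
    by (rule Limsup_bounded) (use assms(3) in simp)
  then show ?thesis by simp
qed

lemma gen_spectral_radius_lessD: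
  assumes "nonneg_ops R \<Sigma> C" "R \<noteq> {}" "gen_spectral_radius R \<Sigma> < t"
  shows "\<forall>\<^sub>F k in sequentially. radius_root R \<Sigma> k < t"
proof -
  have "limsup (\<lambda>k. ereal (radius_root R \<Sigma> k)) < ereal t"
    using assms(3) unfolding gen_spectral_radius_limsup[OF assms(1,2), symmetric] by simp
  then show ?thesis using Limsup_lessD by fastforce
qed

lemma gen_spectral_radius_geI:
  assumes "nonneg_ops R \<Sigma> C" "R \<noteq> {}" "\<And>k. 1 \<le> k \<Longrightarrow> c \<le> radius_root R \<Sigma> k"
  shows "c \<le> gen_spectral_radius R \<Sigma>"
proof (rule ccontr)
  assume "\<not> c \<le> gen_spectral_radius R \<Sigma>"
  then have "\<forall>\<^sub>F k in sequentially. radius_root R \<Sigma> k < c"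
    by (intro gen_spectral_radius_lessD[OF assms(1,2)]) simp
  then obtain k0 where "\<And>k. k \<ge> k0 \<Longrightarrow> radius_root R \<Sigma> k < c"
    by (auto simp: eventually_sequentially)
  from this[of "Suc k0"] have "radius_root R \<Sigma> (Suc k0) < c" by (simp del: of_nat_Suc)
  moreover have "c \<le> radius_root R \<Sigma> (Suc k0)" by (rule assms(3)) simp
  ultimately show False by simp
qed

text \<open>Every t above the radius of \<Phi> eventually exceeds the roots of \<Phi>, which bounds
  the roots of \<Sigma> by t^p. Then t decreases to the radius; p > 0 gives continuity of the power
  even at 0.\<close>

lemma gen_spectral_radius_powr_le:
  assumes \<Sigma>: "nonneg_ops R \<Sigma> a" and \<Phi>: "nonneg_ops R \<Phi> b" and R: "R \<noteq> {}" and p: "0 < p"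
    and le: "\<And>k. 1 \<le> k \<Longrightarrow> set_sup_radius R (set_power R \<Sigma> k) \<le> set_sup_radius R (set_power R \<Phi> k) powr p"
  shows "gen_spectral_radius R \<Sigma> \<le> gen_spectral_radius R \<Phi> powr p"
proof (rule tendsto_lowerbound)
  let ?g = "gen_spectral_radius R \<Phi>"
  have nonneg: "0 \<le> ?g" by (rule gen_spectral_radius_nonneg[OF \<Phi> R])
  show "((\<lambda>t. t powr p) \<longlongrightarrow> ?g powr p) (at_right ?g)"
    using nonneg p by (intro tendsto_powr2 tendsto_intros) (auto simp: eventually_at_filter)
  have "gen_spectral_radius R \<Sigma> \<le> t powr p" if t: "?g < t" for t
  proof (rule gen_spectral_radius_leI[OF \<Sigma> R])
    show "\<forall>\<^sub>F k in sequentially. radius_root R \<Sigma> k \<le> t powr p"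
      using gen_spectral_radius_lessD[OF \<Phi> R t] eventually_ge_at_top[of 1]
    proof eventually_elim
      case (elim k)
      have "radius_root R \<Sigma> k \<le> (set_sup_radius R (set_power R \<Phi> k) powr p) powr (1 / real k)"
        using elim by (intro powr_mono2 le set_sup_radius_nonneg[OF nonneg_ops_set_power[OF \<Sigma>] R]) auto
      also have "\<dots> = radius_root R \<Phi> k powr p" by (simp add: powr_powr mult.commute)
      also have "\<dots> \<le> t powr p" using elim p by (intro powr_mono2) auto
      finally show ?case .
    qed
  qed
  then show "\<forall>\<^sub>F t in at_right ?g. gen_spectral_radius R \<Sigma> \<le> t powr p"
    by (auto simp: eventually_at_filter)
qed simp

lemma mat_pow_in_set_power: "A \<in> \<Sigma> \<Longrightarrow> mat_pow R A k \<in> set_power R \<Sigma> k"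
  by (induction k) (auto simp: mat_pow_def set_power_0 set_power_Suc set_mul_def)

lemma joint_spectral_radius_mat_pow:
  assumes "nonneg_op R A C" "1 \<le> k"
  shows "joint_spectral_radius R {A} ^ k \<le> joint_spectral_radius R {mat_pow R A k}"
  using joint_spectral_radius_power[OF nonneg_ops_singleton[OF assms(1)] assms(2)]
  by (simp add: set_power_singleton)

lemma le_powr_inverse:
  fixes x y :: real
  assumes "0 \<le> x" "1 \<le> m" "x ^ m \<le> y"
  shows "x \<le> y powr (1 / real m)"
proof -
  have "x = (x ^ m) powr (1 / real m)"
    using assms by (cases "x = 0") (auto simp: powr_powr simp flip: powr_realpow)
  also have "\<dots> \<le> y powr (1 / real m)" using assms by (intro powr_mono2) auto
  finally show ?thesis .
qed

text \<open>All powers of \<open>A\<close> occur in the powers of \<Sigma>, and \<rho>(A)^k \<le>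
  \<rho>(A^k). The resulting lower bound holds for every k, so it passes to the limsup.\<close>

lemma joint_spectral_radius_member_le_gen:
  assumes \<Sigma>: "nonneg_ops R \<Sigma> C" and R: "R \<noteq> {}" and A: "A \<in> \<Sigma>"
  shows "joint_spectral_radius R {A} \<le> gen_spectral_radius R \<Sigma>"
proof (rule gen_spectral_radius_geI[OF \<Sigma> R])
  fix k :: nat assume k: "1 \<le> k"
  have A': "nonneg_op R A C" by (rule nonneg_opsD[OF \<Sigma> A])
  have "joint_spectral_radius R {A} ^ k \<le> set_sup_radius R (set_power R \<Sigma> k)"
    by (rule order_trans[OF joint_spectral_radius_mat_pow[OF A' k]])
      (rule set_sup_radius_upper[OF nonneg_ops_set_power[OF \<Sigma>] R mat_pow_in_set_power[OF A]])
  then show "joint_spectral_radius R {A} \<le> radius_root R \<Sigma> k"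
    by (intro le_powr_inverse k joint_spectral_radius_nonneg[OF nonneg_ops_singleton[OF A']])
qed

lemma joint_spectral_radius_singleton_mono:
  assumes "nonneg_op R A a" "nonneg_op R B b" "\<And>i k. A i k \<le> B i k"
  shows "joint_spectral_radius R {A} \<le> joint_spectral_radius R {B}"
  by (rule joint_spectral_radius_dominated[OF nonneg_ops_singleton[OF assms(1)] nonneg_ops_singleton[OF assms(2)]])
    (use assms(3) in \<open>auto simp: dominated_def\<close>)

section \<open>Powers, cyclic exchange and Hadamard products for the two radii\<close>

lemma joint_spectral_radius_power_dominated:
  assumes \<Sigma>: "nonneg_ops R \<Sigma> a" and \<Phi>: "nonneg_ops R \<Phi> b" and m: "1 \<le> m"
    and dom: "dominated (set_power R \<Sigma> m) \<Phi>"
  shows "joint_spectral_radius R \<Sigma> \<le> joint_spectral_radius R \<Phi> powr (1 / real m)"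
  using joint_spectral_radius_power[OF \<Sigma> m]
    joint_spectral_radius_dominated[OF nonneg_ops_set_power[OF \<Sigma>] \<Phi> dom]
  by (intro le_powr_inverse joint_spectral_radius_nonneg[OF \<Sigma>] m) simp

text \<open>For A in \<Sigma>^k the power A^m lies in \<Sigma>^(km), which is also the k-th power of
  \<Sigma>^m and hence dominated by \<Phi>^k. So \<rho>(A)^m is at most \<rho>(B) for some B in
  \<Phi>^k.\<close>

lemma gen_spectral_radius_power_dominated:
  assumes \<Sigma>: "nonneg_ops R \<Sigma> a" and \<Phi>: "nonneg_ops R \<Phi> b" and R: "R \<noteq> {}" and m: "1 \<le> m"
    and dom: "dominated (set_power R \<Sigma> m) \<Phi>"
  shows "gen_spectral_radius R \<Sigma> \<le> gen_spectral_radius R \<Phi> powr (1 / real m)"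
proof (rule gen_spectral_radius_powr_le[OF \<Sigma> \<Phi> R])
  show "0 < 1 / real m" using m by simp
  fix k :: nat
  note \<Sigma>k = nonneg_ops_set_power[OF \<Sigma>, of k] and \<Phi>k = nonneg_ops_set_power[OF \<Phi>, of k]
  show "set_sup_radius R (set_power R \<Sigma> k) \<le> set_sup_radius R (set_power R \<Phi> k) powr (1 / real m)"
  proof (rule set_sup_radius_least[OF \<Sigma>k R])
    fix A assume A: "A \<in> set_power R \<Sigma> k"
    note A' = nonneg_opsD[OF \<Sigma>k A]
    have "mat_pow R A m \<in> set_power R (set_power R \<Sigma> m) k"
      using mat_pow_in_set_power[OF A, of R m] set_power_mult[OF \<Sigma>, of k m] set_power_mult[OF \<Sigma>, of m k]
      by (simp add: mult.commute)
    then obtain B where B: "B \<in> set_power R \<Phi> k" "\<And>i j. mat_pow R A m i j \<le> B i j"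
      using dominated_set_power[OF nonneg_ops_set_power[OF \<Sigma>] \<Phi> dom, of k] unfolding dominated_def by blast
    have "joint_spectral_radius R {A} ^ m \<le> joint_spectral_radius R {B}"
      using joint_spectral_radius_mat_pow[OF A' m]
        joint_spectral_radius_singleton_mono[OF nonneg_op_mat_pow[OF A'] nonneg_opsD[OF \<Phi>k B(1)] B(2)] by simp
    also have "\<dots> \<le> set_sup_radius R (set_power R \<Phi> k)" by (rule set_sup_radius_upper[OF \<Phi>k R B(1)])
    finally show "joint_spectral_radius R {A} \<le> set_sup_radius R (set_power R \<Phi> k) powr (1 / real m)"
      by (intro le_powr_inverse m joint_spectral_radius_nonneg[OF nonneg_ops_singleton[OF A']])
  qed simp
qed

lemma set_mulI: "A \<in> \<Sigma> \<Longrightarrow> B \<in> \<Phi> \<Longrightarrow> mat_mul R A B \<in> set_mul R \<Sigma> \<Phi>"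
  by (auto simp: set_mul_def)

lemma set_mulE:
  assumes "X \<in> set_mul R \<Sigma> \<Phi>"
  obtains A B where "A \<in> \<Sigma>" "B \<in> \<Phi>" "X = mat_mul R A B"
  using assms by (auto simp: set_mul_def)

text \<open>An element of (XY)^k is xz with x in X and z in (YX)^(k-1) Y. Then zx lies in (YX)^k,
  and for single matrices the radius of xz is at most that of zx.\<close>

lemma set_sup_radius_commute:
  assumes X: "nonneg_ops R X a" and Y: "nonneg_ops R Y b" and R: "R \<noteq> {}" and k: "1 \<le> k"
  shows "set_sup_radius R (set_power R (set_mul R X Y) k) \<le> set_sup_radius R (set_power R (set_mul R Y X) k)"
proof -
  note XY = nonneg_ops_set_mul[OF X Y] and YX = nonneg_ops_set_mul[OF Y X]
  obtain n where n: "k = Suc n" using k by (cases k) auto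
  have P: "nonneg_ops R (set_power R (set_mul R Y X) n) ((b * a) ^ n)" by (rule nonneg_ops_set_power[OF YX])
  note Z = nonneg_ops_set_mul[OF P Y]
  have shift: "set_mul R (set_mul R (set_power R (set_mul R Y X) n) Y) X = set_power R (set_mul R Y X) k"
    using set_power_add[OF YX, of n 1] set_power_1[OF YX] set_mul_assoc[OF P Y X] by (simp add: n)
  show ?thesis
  proof (rule set_sup_radius_least[OF nonneg_ops_set_power[OF XY] R])
    show "0 \<le> set_sup_radius R (set_power R (set_mul R Y X) k)"
      by (rule set_sup_radius_nonneg[OF nonneg_ops_set_power[OF YX] R])
    fix A assume "A \<in> set_power R (set_mul R X Y) k"
    then obtain x z where xz: "x \<in> X" "z \<in> set_mul R (set_power R (set_mul R Y X) n) Y" "A = mat_mul R x z"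
      unfolding n set_power_mul_Suc[OF X Y] by (rule set_mulE)
    have "joint_spectral_radius R {A} \<le> joint_spectral_radius R {mat_mul R z x}"
      using joint_spectral_radius_commute[OF nonneg_ops_singleton[OF nonneg_opsD[OF X xz(1)]]
          nonneg_ops_singleton[OF nonneg_opsD[OF Z xz(2)]]]
      by (simp add: set_mul_singleton xz(3))
    also have "\<dots> \<le> set_sup_radius R (set_power R (set_mul R Y X) k)"
    proof (rule set_sup_radius_upper[OF nonneg_ops_set_power[OF YX] R])
      show "mat_mul R z x \<in> set_power R (set_mul R Y X) k"
        unfolding shift[symmetric] using xz(2,1) by (rule set_mulI)
    qed
    finally show "joint_spectral_radius R {A} \<le> set_sup_radius R (set_power R (set_mul R Y X) k)" .
  qed
qed

lemma powr_power_nat: "1 \<le> m \<Longrightarrow> (x powr a) ^ m = x powr (a * real m)" for x :: real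
  by (cases "x = 0") (auto simp: powr_power mult.commute power_0_left)

lemma hadamard_cong:
  "(\<And>j. j \<in> {1..m} \<Longrightarrow> A j = B j) \<Longrightarrow> hadamard m a A = hadamard m a B"
  unfolding hadamard_def by (intro ext prod.cong) auto

lemma joint_spectral_radius_hadamard:
  assumes m: "1 \<le> m" "1 / real m \<le> \<alpha>" and A: "\<And>j. j \<in> {1..m} \<Longrightarrow> nonneg_op R (A j) (C j)"
  shows "joint_spectral_radius R {hadamard m (\<lambda>_. \<alpha>) A} \<le> (\<Prod>j=1..m. joint_spectral_radius R {A j} powr \<alpha>)"
proof -
  have "set_hadamard m (\<lambda>_. \<alpha>) (\<lambda>j. {A j}) = {hadamard m (\<lambda>_. \<alpha>) A}"
  proof (intro equalityI subsetI)
    fix X assume "X \<in> set_hadamard m (\<lambda>_. \<alpha>) (\<lambda>j. {A j})"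
    then obtain B where "X = hadamard m (\<lambda>_. \<alpha>) B" "\<forall>j\<in>{1..m}. B j \<in> {A j}"
      unfolding set_hadamard_def by blast
    then have "X = hadamard m (\<lambda>_. \<alpha>) A" by (simp only:) (rule hadamard_cong, blast)
    then show "X \<in> {hadamard m (\<lambda>_. \<alpha>) A}" by simp
  qed (auto simp: set_hadamard_def)
  then show ?thesis
    using joint_spectral_radius_set_hadamard[where \<Sigma> = "\<lambda>j. {A j}", OF m nonneg_ops_singleton[OF A]] by simp
qed

text \<open>Comparing all m components with one \<Phi> at each fixed k leaves a single sequence
  under the limsup; its exponent \<alpha> m counts the components.\<close>

lemma gen_spectral_radius_set_hadamard_le:
  assumes m: "1 \<le> m" "1 / real m \<le> \<alpha>"
    and \<Sigma>: "\<And>j. j \<in> {1..m} \<Longrightarrow> nonneg_ops R (\<Sigma> j) (C j)" and \<Phi>: "nonneg_ops R \<Phi> D" and R: "R \<noteq> {}"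
    and le: "\<And>j k. j \<in> {1..m} \<Longrightarrow> 1 \<le> k \<Longrightarrow>
      set_sup_radius R (set_power R (\<Sigma> j) k) \<le> set_sup_radius R (set_power R \<Phi> k)"
  shows "gen_spectral_radius R (set_hadamard m (\<lambda>_. \<alpha>) \<Sigma>) \<le> gen_spectral_radius R \<Phi> powr (\<alpha> * real m)"
proof (rule gen_spectral_radius_powr_le[OF nonneg_ops_set_hadamard[where \<Sigma> = \<Sigma>, OF m \<Sigma>] \<Phi> R])
  have \<alpha>: "0 < \<alpha>" using m by (intro less_le_trans[OF _ m(2)]) simp
  then show "0 < \<alpha> * real m" using m by simp
  fix k :: nat assume k: "1 \<le> k"
  note H = nonneg_ops_set_power[OF nonneg_ops_set_hadamard[where \<Sigma> = \<Sigma>, OF m \<Sigma>], of k]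
  let ?b = "set_sup_radius R (set_power R \<Phi> k)"
  show "set_sup_radius R (set_power R (set_hadamard m (\<lambda>_. \<alpha>) \<Sigma>) k) \<le> ?b powr (\<alpha> * real m)"
  proof (rule set_sup_radius_least[OF H R])
    fix A assume A: "A \<in> set_power R (set_hadamard m (\<lambda>_. \<alpha>) \<Sigma>) k"
    then obtain X where X: "X \<in> set_hadamard m (\<lambda>_. \<alpha>) (\<lambda>j. set_power R (\<Sigma> j) k)" "\<And>i j. A i j \<le> X i j"
      using dominated_power_set_hadamard[where \<Sigma> = \<Sigma> and k = k, OF m \<Sigma>] unfolding dominated_def by blast
    then obtain B where B: "X = hadamard m (\<lambda>_. \<alpha>) B" "\<And>j. j \<in> {1..m} \<Longrightarrow> B j \<in> set_power R (\<Sigma> j) k"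
      unfolding set_hadamard_def by blast
    have Bop: "nonneg_op R (B j) (C j ^ k)" if "j \<in> {1..m}" for j
      by (rule nonneg_opsD[OF nonneg_ops_set_power[OF \<Sigma>[OF that]] B(2)[OF that]])
    have "joint_spectral_radius R {A} \<le> joint_spectral_radius R {X}"
      unfolding B(1)
      by (rule joint_spectral_radius_singleton_mono[OF nonneg_opsD[OF H A]
            nonneg_op_hadamard[where A = B, OF m Bop] X(2)[unfolded B(1)]])
    also have "\<dots> \<le> (\<Prod>j=1..m. joint_spectral_radius R {B j} powr \<alpha>)"
      unfolding B(1) by (rule joint_spectral_radius_hadamard[where A = B, OF m Bop])
    also have "\<dots> \<le> (\<Prod>j=1..m. ?b powr \<alpha>)"
    proof (intro prod_mono conjI powr_mono2)
      fix j assume j: "j \<in> {1..m}"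
      show "joint_spectral_radius R {B j} \<le> ?b"
        using set_sup_radius_upper[OF nonneg_ops_set_power[OF \<Sigma>[OF j]] R B(2)[OF j]] le[OF j k] by simp
      show "0 \<le> joint_spectral_radius R {B j}"
        by (rule joint_spectral_radius_nonneg[OF nonneg_ops_singleton[OF Bop[OF j]]])
    qed (use \<alpha> in auto)
    also have "\<dots> = ?b powr (\<alpha> * real m)"
      using m(1) by (simp add: powr_power_nat)
    finally show "joint_spectral_radius R {A} \<le> ?b powr (\<alpha> * real m)" .
  qed simp_all
qed

lemma joint_spectral_radius_set_hadamard_le:
  assumes m: "1 \<le> m" "1 / real m \<le> \<alpha>"
    and \<Sigma>: "\<And>j. j \<in> {1..m} \<Longrightarrow> nonneg_ops R (\<Sigma> j) (C j)" and \<Phi>: "nonneg_ops R \<Phi> D"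
    and le: "\<And>j. j \<in> {1..m} \<Longrightarrow> joint_spectral_radius R (\<Sigma> j) \<le> joint_spectral_radius R \<Phi>"
  shows "joint_spectral_radius R (set_hadamard m (\<lambda>_. \<alpha>) \<Sigma>) \<le> joint_spectral_radius R \<Phi> powr (\<alpha> * real m)"
proof -
  have \<alpha>: "0 < \<alpha>" using m by (intro less_le_trans[OF _ m(2)]) simp
  have "joint_spectral_radius R (set_hadamard m (\<lambda>_. \<alpha>) \<Sigma>) \<le> (\<Prod>j=1..m. joint_spectral_radius R (\<Sigma> j) powr \<alpha>)"
    by (rule joint_spectral_radius_set_hadamard[where \<Sigma> = \<Sigma>, OF m \<Sigma>])
  also have "\<dots> \<le> (\<Prod>j=1..m. joint_spectral_radius R \<Phi> powr \<alpha>)"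
    using \<alpha> by (intro prod_mono conjI powr_mono2 le joint_spectral_radius_nonneg[OF \<Sigma>]) auto
  also have "\<dots> = joint_spectral_radius R \<Phi> powr (\<alpha> * real m)"
    using m(1) by (simp add: powr_power_nat)
  finally show ?thesis .
qed

section \<open>The cyclic products\<close>

lemma set_adj_eq: "nonneg_ops R \<Sigma> C \<Longrightarrow> set_adj R \<Sigma> = transpose_mat ` \<Sigma>"
  unfolding set_adj_def by (intro image_cong refl mat_adj_eq_transpose) (rule nonneg_opsD)

lemma nonneg_ops_set_adj: "nonneg_ops R \<Sigma> C \<Longrightarrow> nonneg_ops R (set_adj R \<Sigma>) C"
  by (auto simp: set_adj_eq nonneg_ops_def intro: nonneg_op_transpose)

section \<open>Arithmetic of the cyclic indices\<close>

lemma cyc_in: "1 \<le> m \<Longrightarrow> cyc m i \<in> {1..m}"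
  by (simp add: cyc_def Suc_le_eq)

lemma cyc_eq: "j \<in> {1..m} \<Longrightarrow> cyc m j = j"
  by (cases j) (auto simp: cyc_def)

lemma cyc_cyc: "cyc m (cyc m i) = cyc m i"
  by (simp add: cyc_def)

lemma cyc_cyc_Suc: "1 \<le> i \<Longrightarrow> cyc m (cyc m i + 1) = cyc m (i + 1)"
  by (cases i) (simp_all add: cyc_def mod_Suc_eq)

lemma cyc_add_mult: "1 \<le> i \<Longrightarrow> cyc m (i + k * m) = cyc m i"
proof -
  assume "1 \<le> i"
  then have "i + k * m - 1 = (i - 1) + k * m" by simp
  then show ?thesis by (simp add: cyc_def)
qed

text \<open>Differences of images are d(k - j) modulo m with d invertible, so the map is injective,
  hence onto the finite set. It is used with d = 2, where oddness of m enters, and with d = 1, the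
  shift by one.\<close>

lemma bij_betw_cyc_affine:
  assumes m: "1 \<le> m" and d: "coprime d m"
  shows "bij_betw (\<lambda>j. cyc m (d * (j - 1) + c + 1)) {1..m} {1..m}"
proof -
  let ?f = "\<lambda>j. cyc m (d * (j - 1) + c + 1)"
  have eq: "j = k" if jk: "j \<in> {1..m}" "k \<in> {1..m}" "j \<le> k" "?f j = ?f k" for j k
  proof -
    have "(d * (k - 1) + c) mod m = (d * (j - 1) + c) mod m" using jk(4) by (simp add: cyc_def)
    then have "m dvd (d * (k - 1) + c) - (d * (j - 1) + c)"
      using jk(3) by (subst (asm) mod_eq_dvd_iff_nat) auto
    also have "(d * (k - 1) + c) - (d * (j - 1) + c) = d * (k - j)"
      using jk(1) by (simp add: diff_mult_distrib2[symmetric])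
    finally have "m dvd k - j" using d by (simp add: coprime_dvd_mult_right_iff coprime_commute)
    moreover have "k - j < m" using jk(1,2) by auto
    ultimately show ?thesis using jk(3) by (auto dest: nat_dvd_not_less[rotated])
  qed
  have "inj_on ?f {1..m}"
  proof (rule inj_onI)
    fix j k assume "j \<in> {1..m}" "k \<in> {1..m}" "?f j = ?f k"
    then show "j = k" using eq[of j k] eq[of k j] by (metis nat_le_linear)
  qed
  moreover from this have "?f ` {1..m} = {1..m}"
    by (rule endo_inj_surj[rotated 2]) (use cyc_in[OF m] in auto)
  ultimately show ?thesis by (simp add: bij_betw_def)
qed

lemma hadamard_reindex:
  assumes "bij_betw \<sigma> {1..m} {1..m}"
  shows "hadamard m (\<lambda>_. \<alpha>) (\<lambda>j. A (\<sigma> j)) = hadamard m (\<lambda>_. \<alpha>) A"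
  unfolding hadamard_def
  by (intro ext) (rule prod.reindex_bij_betw[OF assms])

lemma set_hadamard_reindex:
  assumes "bij_betw \<sigma> {1..m} {1..m}"
  shows "set_hadamard m (\<lambda>_. \<alpha>) \<Sigma> \<subseteq> set_hadamard m (\<lambda>_. \<alpha>) (\<lambda>j. \<Sigma> (\<sigma> j))"
proof
  fix X assume "X \<in> set_hadamard m (\<lambda>_. \<alpha>) \<Sigma>"
  then obtain A where A: "X = hadamard m (\<lambda>_. \<alpha>) A" "\<forall>j\<in>{1..m}. A j \<in> \<Sigma> j"
    unfolding set_hadamard_def by blast
  have "X = hadamard m (\<lambda>_. \<alpha>) (\<lambda>j. A (\<sigma> j))"
    unfolding A(1) by (rule hadamard_reindex[OF assms, symmetric])
  moreover have "\<forall>j\<in>{1..m}. A (\<sigma> j) \<in> \<Sigma> (\<sigma> j)"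
    using A(2) bij_betwE[OF assms] by blast
  ultimately show "X \<in> set_hadamard m (\<lambda>_. \<alpha>) (\<lambda>j. \<Sigma> (\<sigma> j))"
    unfolding set_hadamard_def by blast
qed

lemma pair_prod_cyc: "1 \<le> i \<Longrightarrow> pair_prod R m \<Psi> (cyc m i) = pair_prod R m \<Psi> i"
  unfolding pair_prod_def cyc_cyc by (simp only: cyc_cyc_Suc)

lemma pair_prod_add_mult: "1 \<le> i \<Longrightarrow> pair_prod R m \<Psi> (i + k * m) = pair_prod R m \<Psi> i"
  using cyc_add_mult[of i m k] cyc_add_mult[of "i + 1" m k] by (simp add: pair_prod_def)

lemma nonneg_ops_pair_prod:
  assumes "1 \<le> m" "\<And>j. j \<in> {1..m} \<Longrightarrow> nonneg_ops R (\<Psi> j) (C j)"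
  shows "nonneg_ops R (pair_prod R m \<Psi> i) (C (cyc m i) * C (cyc m (i + 1)))"
  unfolding pair_prod_def
  by (intro nonneg_ops_set_mul nonneg_ops_set_adj assms(2) cyc_in[OF assms(1)])

text \<open>The t-th factor of \<Omega>_j is Q (t + j - 1), where Q has period m. Cutting \<Omega>_1
  after j - 1 factors into Y and X therefore exhibits \<Omega>_j as XY; for j = 1 the product Y is
  empty.\<close>

lemma Omega_rotate:
  assumes j: "j \<in> {1..m}"
    and P: "\<And>i. nonneg_ops R (pair_prod R m \<Psi> i) (D i)"
  obtains X Y a b where "nonneg_ops R X a" "nonneg_ops R Y b"
    "Omega R m \<Psi> j = set_mul R X Y" "Omega R m \<Psi> 1 = set_mul R Y X"
proof -
  define Q where "Q t = pair_prod R m \<Psi> (1 + 2 * t)" for t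
  define s where "s = j - 1"
  have s: "s < m" using j by (auto simp: s_def)
  have Q: "\<Sigma> \<in> set (map Q ts) \<Longrightarrow> \<exists>C. nonneg_ops R \<Sigma> C" for ts \<Sigma> using P by (auto simp: Q_def)
  have ops: "\<exists>C. nonneg_ops R (set_prod R (map Q ts)) C" for ts
    by (rule nonneg_ops_set_prod) (rule Q)
  \<comment> \<open>Each factor advances the index by two, so m factors advance it by 2m, which is
    two full rounds.\<close>
  have period: "Q (t + m) = Q t" for t
    using pair_prod_add_mult[of "1 + 2 * t" R m \<Psi> 2] by (simp add: Q_def)
  let ?X = "map Q [s..<m]" and ?Y = "map Q [0..<s]"
  obtain a b where ab: "nonneg_ops R (set_prod R ?X) a" "nonneg_ops R (set_prod R ?Y) b"
    using ops by blast
  have "map (\<lambda>t. pair_prod R m \<Psi> (2 * j - 1 + 2 * t)) [0..<m] = map (\<lambda>t. Q (t + s)) [0..<m]"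
    using j by (auto simp: Q_def s_def diff_mult_distrib2 intro!: arg_cong[where f = "pair_prod R m \<Psi>"])
  also have "\<dots> = map Q [s..<m + s]"
    by (simp add: map_add_upt[symmetric, of s m] o_def add.commute)
  also have "\<dots> = ?X @ map Q [m..<m + s]"
    using s upt_add_eq_append[of s m s] by simp
  also have "map Q [m..<m + s] = ?Y"
  proof -
    have "[m..<m + s] = map (\<lambda>i. i + m) [0..<s]" by (simp add: map_add_upt add.commute)
    then show ?thesis by (simp add: period del: map_add_upt)
  qed
  finally have "Omega R m \<Psi> j = set_mul R (set_prod R ?X) (set_prod R ?Y)"
    unfolding Omega_def by (simp only: set_prod_append[OF Q Q])
  moreover have "Omega R m \<Psi> 1 = set_mul R (set_prod R ?Y) (set_prod R ?X)"
  proof -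
    have "map (\<lambda>t. pair_prod R m \<Psi> (2 * 1 - 1 + 2 * t)) [0..<m] = map Q [0..<m]" by (simp add: Q_def)
    also have "\<dots> = ?Y @ ?X" using s upt_add_eq_append[of 0 s "m - s"] by simp
    finally show ?thesis unfolding Omega_def by (simp only: set_prod_append[OF Q Q])
  qed
  ultimately show thesis using that ab by blast
qed

lemma dominated_set_prod:
  assumes "\<And>t. t \<in> set ts \<Longrightarrow> nonneg_ops R (\<Sigma> t) (a t)" "\<And>t. t \<in> set ts \<Longrightarrow> nonneg_ops R (\<Phi> t) (b t)"
    and "\<And>t. t \<in> set ts \<Longrightarrow> dominated (\<Sigma> t) (\<Phi> t)"
  shows "dominated (set_prod R (map \<Sigma> ts)) (set_prod R (map \<Phi> ts))"
  using assms
proof (induction ts)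
  case (Cons t ts)
  obtain c where c: "nonneg_ops R (set_prod R (map \<Sigma> ts)) c"
    using nonneg_ops_set_prod[of "map \<Sigma> ts" R] Cons.prems(1) by auto
  obtain d where d: "nonneg_ops R (set_prod R (map \<Phi> ts)) d"
    using nonneg_ops_set_prod[of "map \<Phi> ts" R] Cons.prems(2) by auto
  have "nonneg_ops R (\<Sigma> t) (a t)" "nonneg_ops R (\<Phi> t) (b t)" "dominated (\<Sigma> t) (\<Phi> t)"
    "dominated (set_prod R (map \<Sigma> ts)) (set_prod R (map \<Phi> ts))"
    using Cons by auto
  from dominated_set_mul[OF this(1,2) c d this(3,4)] show ?case by (simp add: set_prod_Cons)
qed (simp add: dominated_refl)

text \<open>The t-th of the m factors of the power is rewritten in its own order, so that its j-th
  component is the t-th factor of \<Omega>_j. Multiplying componentwise then yields exactly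
  \<Omega>_j.\<close>

lemma dominated_pair_prod_power_Omega:
  assumes m: "1 \<le> m" "1 / real m \<le> \<alpha>" "odd m"
    and P: "\<And>i. nonneg_ops R (pair_prod R m \<Psi> i) (D i)"
  shows "dominated (set_power R (set_hadamard m (\<lambda>_. \<alpha>) (pair_prod R m \<Psi>)) m)
    (set_hadamard m (\<lambda>_. \<alpha>) (Omega R m \<Psi>))"
proof -
  let ?H = "set_hadamard m (\<lambda>_. \<alpha>) (pair_prod R m \<Psi>)"
  let ?S = "\<lambda>t j. pair_prod R m \<Psi> (2 * j - 1 + 2 * t)"
  let ?Ht = "\<lambda>t. set_hadamard m (\<lambda>_. \<alpha>) (?S t)"
  have sub: "?H \<subseteq> ?Ht t" for t
  proof -
    let ?\<sigma> = "\<lambda>j. cyc m (2 * (j - 1) + 2 * t + 1)"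
    have "bij_betw ?\<sigma> {1..m} {1..m}"
      by (rule bij_betw_cyc_affine[OF m(1)]) (use m(3) in simp)
    then have "?H \<subseteq> set_hadamard m (\<lambda>_. \<alpha>) (\<lambda>j. pair_prod R m \<Psi> (?\<sigma> j))"
      by (rule set_hadamard_reindex)
    also have "\<dots> = ?Ht t"
    proof -
      have "pair_prod R m \<Psi> (?\<sigma> j) = ?S t j" if "j \<in> {1..m}" for j
      proof -
        have "2 * (j - 1) + 2 * t + 1 = 2 * j - 1 + 2 * t" using that by auto
        moreover have "pair_prod R m \<Psi> (?\<sigma> j) = pair_prod R m \<Psi> (2 * (j - 1) + 2 * t + 1)"
          by (rule pair_prod_cyc) simp
        ultimately show ?thesis by (simp only:)
      qed
      then show ?thesis unfolding set_hadamard_def by auto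
    qed
    finally show ?thesis .
  qed
  have H: "nonneg_ops R ?H (\<Prod>j=1..m. D j powr \<alpha>)"
    by (rule nonneg_ops_set_hadamard[OF m(1,2) P])
  have Ht: "nonneg_ops R (?Ht t) (\<Prod>j=1..m. D (2 * j - 1 + 2 * t) powr \<alpha>)" for t
    by (rule nonneg_ops_set_hadamard[OF m(1,2) P])
  have "set_power R ?H m = set_prod R (map (\<lambda>_. ?H) [0..<m])"
    by (simp add: set_power_def map_replicate_const)
  moreover have "dominated (set_prod R (map (\<lambda>_. ?H) [0..<m])) (set_prod R (map ?Ht [0..<m]))"
    by (rule dominated_set_prod[OF H Ht]) (use sub in \<open>auto simp: dominated_def\<close>)
  moreover have "dominated (set_prod R (map ?Ht [0..<m]))
      (set_hadamard m (\<lambda>_. \<alpha>) (\<lambda>j. set_prod R (map (\<lambda>t. ?S t j) [0..<m])))"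
    by (rule dominated_prod_set_hadamard[OF m(1,2)]) (rule P)
  ultimately show ?thesis
    using dominated_trans by (simp add: Omega_def[abs_def])
qed

text \<open>Transposition acts on each Hadamard component, and the order of the components is free.
  Shifting it by one pairs \<open>X j\<close> with the transpose of the next component, as
  \<open>pair_prod\<close> prescribes.\<close>

lemma op_norm_hadamard_le:
  assumes m: "1 \<le> m" "1 / real m \<le> \<alpha>"
    and \<Psi>: "\<And>j. j \<in> {1..m} \<Longrightarrow> nonneg_ops R (\<Psi> j) (C j)"
    and A: "A \<in> set_hadamard m (\<lambda>_. \<alpha>) \<Psi>"
  obtains B where "B \<in> set_hadamard m (\<lambda>_. \<alpha>) (pair_prod R m \<Psi>)"
    "(mat_norm R A)\<^sup>2 \<le> joint_spectral_radius R {B}"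
proof -
  obtain X where X: "A = hadamard m (\<lambda>_. \<alpha>) X" "\<And>j. j \<in> {1..m} \<Longrightarrow> X j \<in> \<Psi> j"
    using A unfolding set_hadamard_def by blast
  let ?Y = "\<lambda>j. transpose_mat (X (cyc m (j + 1)))"
  have Xop: "nonneg_op R (X j) (C j)" if "j \<in> {1..m}" for j by (rule nonneg_opsD[OF \<Psi>[OF that] X(2)[OF that]])
  have Yop: "nonneg_op R (?Y j) (C (cyc m (j + 1)))" for j
    by (rule nonneg_op_transpose[OF Xop[OF cyc_in[OF m(1)]]])
  let ?B = "hadamard m (\<lambda>_. \<alpha>) (\<lambda>j. mat_mul R (X j) (?Y j))"
  have Aop: "nonneg_op R A (\<Prod>j=1..m. C j powr \<alpha>)" unfolding X(1) by (rule nonneg_op_hadamard[OF m Xop])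
  have bij: "bij_betw (\<lambda>j. cyc m (j + 1)) {1..m} {1..m}"
  proof (rule bij_betw_cong[THEN iffD1, OF _ bij_betw_cyc_affine[OF m(1), of 1 1]])
    fix j assume "j \<in> {1..m}"
    then have "1 * (j - 1) + 1 + 1 = j + 1" by simp
    then show "cyc m (1 * (j - 1) + 1 + 1) = cyc m (j + 1)" by (rule arg_cong)
  qed simp
  have "transpose_mat A = hadamard m (\<lambda>_. \<alpha>) (\<lambda>j. transpose_mat (X j))"
    unfolding X(1) hadamard_def by simp
  also have "\<dots> = hadamard m (\<lambda>_. \<alpha>) ?Y" by (rule hadamard_reindex[OF bij, symmetric])
  finally have tr: "transpose_mat A = hadamard m (\<lambda>_. \<alpha>) ?Y" .
  have Bop: "nonneg_op R ?B (\<Prod>j=1..m. (C j * C (cyc m (j + 1))) powr \<alpha>)"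
    by (rule nonneg_op_hadamard[OF m nonneg_op_mat_mul[OF Xop Yop]])
  have "mat_mul R A (transpose_mat A) i k \<le> ?B i k" for i k
    unfolding tr unfolding X(1) by (rule mat_mul_hadamard_le[OF m Xop Yop])
  then have "joint_spectral_radius R {mat_mul R A (transpose_mat A)} \<le> joint_spectral_radius R {?B}"
    by (rule joint_spectral_radius_singleton_mono[OF nonneg_op_mat_mul[OF Aop nonneg_op_transpose[OF Aop]] Bop])
  then have "(mat_norm R A)\<^sup>2 \<le> joint_spectral_radius R {?B}"
    using op_norm_square_le_joint_spectral_radius[OF Aop] by simp
  moreover have "?B \<in> set_hadamard m (\<lambda>_. \<alpha>) (pair_prod R m \<Psi>)"
  proof -
    have "mat_mul R (X j) (?Y j) \<in> pair_prod R m \<Psi> j" if j: "j \<in> {1..m}" for j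
    proof -
      have c: "cyc m (j + 1) \<in> {1..m}" by (rule cyc_in[OF m(1)])
      have "?Y j \<in> set_adj R (\<Psi> (cyc m (j + 1)))"
        unfolding set_adj_eq[OF \<Psi>[OF c]] using X(2)[OF c] by (rule imageI)
      then show ?thesis
        unfolding pair_prod_def cyc_eq[OF j] using X(2)[OF j] by (intro set_mulI)
    qed
    then show ?thesis unfolding set_hadamard_def by blast
  qed
  ultimately show thesis using that by blast
qed

theorem theorem3p6:
  fixes R :: "nat set" and m :: nat and \<Psi> :: "nat \<Rightarrow> rmat set" and \<alpha> :: real
    and r :: "rmat set \<Rightarrow> real"
  assumes "R = {1..} \<or> (\<exists>N\<ge>1. R = {1..N})"
    and "odd m"
    and "\<And>j A. j \<in> {1..m} \<Longrightarrow> A \<in> \<Psi> j \<Longrightarrow> nonneg_matrix R A \<and> defines_operator R A"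
    and "\<And>j. j \<in> {1..m} \<Longrightarrow> bounded_mats R (\<Psi> j)"
    and "\<alpha> \<ge> 1 / real m"
    and "r \<in> {gen_spectral_radius R, joint_spectral_radius R}"
  shows "set_norm R (set_hadamard m (\<lambda>_. \<alpha>) \<Psi>)
           \<le> r (set_hadamard m (\<lambda>_. \<alpha>) (pair_prod R m \<Psi>)) powr (1 / 2)
       \<and> r (set_hadamard m (\<lambda>_. \<alpha>) (pair_prod R m \<Psi>)) powr (1 / 2)
           \<le> r (set_hadamard m (\<lambda>_. \<alpha>) (Omega R m \<Psi>)) powr (1 / (2 * real m))
       \<and> r (set_hadamard m (\<lambda>_. \<alpha>) (Omega R m \<Psi>)) powr (1 / (2 * real m))
           \<le> r (Omega R m \<Psi> 1) powr (\<alpha> / 2)"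
proof -
  let ?H = "set_hadamard m (\<lambda>_. \<alpha>) (pair_prod R m \<Psi>)"
  let ?K = "set_hadamard m (\<lambda>_. \<alpha>) (Omega R m \<Psi>)"
  have R: "R \<noteq> {}" using assms(1) by auto
  have m: "1 \<le> m" "1 / real m \<le> \<alpha>" using assms(2,5) by (auto simp: Suc_le_eq odd_pos)
  have \<alpha>: "0 < \<alpha>" using m by (intro less_le_trans[OF _ m(2)]) simp
  \<comment> \<open>Boundedness supplies one constant for the whole set, and the operator hypothesis
    makes the row series converge; together they give extended nonnegative bounds.\<close>
  have "\<exists>C. nonneg_ops R (\<Psi> j) C" if j: "j \<in> {1..m}" for j
  proof -
    obtain C where C: "\<And>A x. A \<in> \<Psi> j \<Longrightarrow> x \<in> l2 R \<Longrightarrow> l2_norm R (mat_vec R A x) \<le> C * l2_norm R x"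
      using assms(4)[OF j] unfolding bounded_mats_def by blast
    have "nonneg_op R A \<bar>C\<bar>" if "A \<in> \<Psi> j" for A
      using assms(3)[OF j that] C[OF that] by (intro nonneg_opI_defines_operator) auto
    then show ?thesis unfolding nonneg_ops_def by (intro exI[of _ "\<bar>C\<bar>"]) auto
  qed
  then obtain C where \<Psi>: "\<And>j. j \<in> {1..m} \<Longrightarrow> nonneg_ops R (\<Psi> j) (C j)" by metis
  define D where "D i = C (cyc m i) * C (cyc m (i + 1))" for i
  have P: "nonneg_ops R (pair_prod R m \<Psi> i) (D i)" for i
    unfolding D_def by (rule nonneg_ops_pair_prod[OF m(1) \<Psi>])
  have "\<exists>E. nonneg_ops R (Omega R m \<Psi> j) E" for j
    unfolding Omega_def using P by (intro nonneg_ops_set_prod) auto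
  then obtain E where \<Omega>: "\<And>j. nonneg_ops R (Omega R m \<Psi> j) (E j)" by metis
  have H: "nonneg_ops R ?H (\<Prod>j=1..m. D j powr \<alpha>)"
    by (rule nonneg_ops_set_hadamard[OF m P])
  have K: "nonneg_ops R ?K (\<Prod>j=1..m. E j powr \<alpha>)"
    by (rule nonneg_ops_set_hadamard[OF m \<Omega>])
  have r_nonneg: "0 \<le> r \<Sigma>" if "nonneg_ops R \<Sigma> c" for \<Sigma> c
    using assms(6) joint_spectral_radius_nonneg[OF that] gen_spectral_radius_nonneg[OF that R] by auto
  \<comment> \<open>Passing through one matrix settles both radii at once, as each is at least the
    radius of any single element.\<close>
  have member: "joint_spectral_radius R {B} \<le> r ?H" if "B \<in> ?H" for B
    using assms(6) joint_spectral_radius_member_le[OF H that]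
      joint_spectral_radius_member_le_gen[OF H R that] by auto

  have first: "set_norm R (set_hadamard m (\<lambda>_. \<alpha>) \<Psi>) \<le> r ?H powr (1 / 2)"
  proof (rule set_norm_le, unfold nonneg_ops_def, intro conjI ballI)
    fix A assume A: "A \<in> set_hadamard m (\<lambda>_. \<alpha>) \<Psi>"
    have Aop: "nonneg_op R A (\<Prod>j=1..m. C j powr \<alpha>)"
      by (rule nonneg_opsD[OF nonneg_ops_set_hadamard[where \<Sigma> = \<Psi>, OF m \<Psi>] A])
    obtain B where "B \<in> ?H" "(mat_norm R A)\<^sup>2 \<le> joint_spectral_radius R {B}"
      using op_norm_hadamard_le[OF m \<Psi> A] by blast
    then have "(mat_norm R A)\<^sup>2 \<le> r ?H" using member by fastforce
    then have "mat_norm R A \<le> r ?H powr (1 / real 2)"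
      by (intro le_powr_inverse op_norm_nonneg[OF Aop]) auto
    then show "nonneg_op R A (r ?H powr (1 / 2))"
      using nonneg_op_weaken[OF nonneg_op_op_norm[OF Aop]] by simp
  qed simp

  note dom = dominated_pair_prod_power_Omega[OF m assms(2) P]
  have "r ?H \<le> r ?K powr (1 / real m)"
    using assms(6) joint_spectral_radius_power_dominated[OF H K m(1) dom]
      gen_spectral_radius_power_dominated[OF H K R m(1) dom] by auto
  then have "r ?H powr (1 / 2) \<le> (r ?K powr (1 / real m)) powr (1 / 2)"
    using r_nonneg[OF H] by (intro powr_mono2) auto
  then have second: "r ?H powr (1 / 2) \<le> r ?K powr (1 / (2 * real m))"
    by (simp add: powr_powr mult.commute)

  have "set_sup_radius R (set_power R (Omega R m \<Psi> j) k) \<le> set_sup_radius R (set_power R (Omega R m \<Psi> 1) k)"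
    if "j \<in> {1..m}" "1 \<le> k" for j k
    using Omega_rotate[OF that(1) P] set_sup_radius_commute[OF _ _ R that(2)] by metis
  moreover have "joint_spectral_radius R (Omega R m \<Psi> j) \<le> joint_spectral_radius R (Omega R m \<Psi> 1)"
    if "j \<in> {1..m}" for j
    using Omega_rotate[OF that P] joint_spectral_radius_commute by metis
  ultimately have "r ?K \<le> r (Omega R m \<Psi> 1) powr (\<alpha> * real m)"
    using assms(6) gen_spectral_radius_set_hadamard_le[where \<Sigma> = "Omega R m \<Psi>", OF m \<Omega> \<Omega> R]
      joint_spectral_radius_set_hadamard_le[where \<Sigma> = "Omega R m \<Psi>", OF m \<Omega> \<Omega>] by auto
  then have "r ?K powr (1 / (2 * real m)) \<le> (r (Omega R m \<Psi> 1) powr (\<alpha> * real m)) powr (1 / (2 * real m))"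
    using r_nonneg[OF K] by (intro powr_mono2) auto
  \<comment> \<open>The m components contribute \<alpha> each, and the exponent 1/(2m) turns
    \<alpha> m into \<alpha>/2.\<close>
  also have "\<dots> = r (Omega R m \<Psi> 1) powr (\<alpha> / 2)"
    using m(1) by (simp add: powr_powr)
  finally show ?thesis using first second by blast
qed

end
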